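(* Let $p$ be a prime, let $R$ be a ring satisfying the Hypothesis (H) of the context, and let $G$ be a finite group. The inclusion $R[G]^\times\subset \mathrm{GL}(R[G])$ induces an equality $$\mathrm{Det}(R[G]^\times)=\mathrm{Det}(\mathrm{GL}(R[G]))=\mathrm{Det}(\mathrm{K}_1(R[G]))$$ in each of the following two circumstances: (a) $G$ is a $p$-group; (b) $G$ is an arbitrary finite group and $R$ is additionally Noetherian and normal.
   Context: Hypothesis (H) on $R$ (for the prime $p$): (i) $R$ is an integral domain which is torsion free as an abelian group; (ii) the natural map $R\to\varprojlim_n R/p^nR$ is an isomorphism; (iii) $R$ has a lift of Frobenius, i.e. a ring endomorphism $F:R\to R$ with $F(r)\equiv r^p \bmod pR$ for all $r\in R$. Let $N$ be the field of fractions of $R$ and $N^c$ an algebraic closure of $N$. The map $\mathrm{Det}:\mathrm{K}_1(R[G])\to \mathrm{K}_1(N^c[G])=\prod_\chi N^{c\times}$ (product over the irreducible $N^c$-valued characters $\chi$ of $G$) is induced by $R[G]\subset N^c[G]$; concretely, for $x\in\mathrm{GL}_n(R[G])$, $\mathrm{Det}(x)(\chi)=\det(T_\chi(x))$, where $T_\chi$ is a representation with character $\chi$, extended linearly to $n\times n$ matrices over $R[G]$. $\mathrm{GL}(R[G])=\varinjlim_n\mathrm{GL}_n(R[G])$, and $\mathrm{Det}(\mathrm{GL}(R[G]))$ is the image of $\mathrm{GL}(R[G])\to \mathrm{K}_1(R[G])\to\prod_\chi N^{c\times}$, which by definition equals $\mathrm{Det}(\mathrm{K}_1(R[G]))$.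 $\mathrm{Det}(R[G]^\times)$ is the image of the subgroup $R[G]^\times=\mathrm{GL}_1(R[G])$. *)

theory Defs
  imports
    "HOL-Computational_Algebra.Computational_Algebra"
    "HOL-Algebra.Algebraic_Closure_Type"
    "HOL-Algebra.Ring_Divisibility"
    "HOL-Algebra.Generated_Groups"
    "HOL-Library.Poly_Mapping"
    "Jordan_Normal_Form.VS_Connect"
    "Jordan_Normal_Form.Determinant"
begin

text \<open>
  The base ring is a type \<open>'r\<close> of class \<open>idom\<close>, the finite group a type \<open>'g\<close> of class
  \<open>{group_add, finite}\<close>. The class \<open>group_add\<close> does not require commutativity; the group law of
  \<open>G\<close> is merely written \<open>+\<close>, its neutral element \<open>0\<close>. The group ring \<open>R[G]\<close> is then
  the type \<open>'g \<Rightarrow>\<^sub>0 'r\<close>, whose multiplication is the convolution product.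
\<close>

section \<open>Hypotheses on the base ring\<close>

definition torsion_free :: "'r::idom itself \<Rightarrow> bool" where
  "torsion_free _ \<longleftrightarrow> (\<forall>(n::nat) (r::'r). 0 < n \<longrightarrow> of_nat n * r = 0 \<longrightarrow> r = 0)"

definition power_ideal :: "nat \<Rightarrow> nat \<Rightarrow> 'r::idom set" where
  "power_ideal p n = {r. of_nat (p ^ n) dvd r}"

text \<open>
  The inverse limit of the rings \<open>R/p\<^sup>nR\<close>. Elements of \<open>R/p\<^sup>nR\<close> are cosets, and the
  transition map sends a coset of \<open>p\<^sup>n\<^sup>+\<^sup>1R\<close> to the unique coset of \<open>p\<^sup>nR\<close> containing it.
\<close>

definition adic_limit :: "nat \<Rightarrow> (nat \<Rightarrow> 'r::idom set) set" where
  "adic_limit p = {x. (\<forall>n. x n \<in> carrier ((class_ring :: 'r ring) Quot power_ideal p n))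
                      \<and> (\<forall>n. x (Suc n) \<subseteq> x n)}"

definition adic_map :: "nat \<Rightarrow> 'r::idom \<Rightarrow> nat \<Rightarrow> 'r set" where
  "adic_map p r = (\<lambda>n. power_ideal p n +>\<^bsub>class_ring\<^esub> r)"

text \<open>
  The natural map is a ring homomorphism by construction, the operations of the limit being
  computed componentwise; so it is an isomorphism iff it is bijective.
\<close>

definition adically_complete :: "nat \<Rightarrow> 'r::idom itself \<Rightarrow> bool" where
  "adically_complete p _ \<longleftrightarrow> bij_betw (adic_map p) (UNIV :: 'r set) (adic_limit p)"

definition frobenius_lift :: "nat \<Rightarrow> ('r::idom \<Rightarrow> 'r) \<Rightarrow> bool" where
  "frobenius_lift p F \<longleftrightarrow> comm_ring_hom F \<and> (\<forall>r. of_nat p dvd F r - r ^ p)"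

definition hypothesis_H :: "nat \<Rightarrow> 'r::idom itself \<Rightarrow> bool" where
  "hypothesis_H p R \<longleftrightarrow>
     torsion_free R \<and> adically_complete p R \<and> (\<exists>F :: 'r \<Rightarrow> 'r. frobenius_lift p F)"

definition normal_domain :: "'r::idom itself \<Rightarrow> bool" where
  "normal_domain _ \<longleftrightarrow>
     (\<forall>z :: 'r fract. (\<exists>f :: 'r poly. lead_coeff f = 1 \<and> poly (map_poly to_fract f) z = 0)
        \<longrightarrow> z \<in> range to_fract)"


section \<open>Representations and characters over a field\<close>

definition representation :: "nat \<Rightarrow> ('g::group_add \<Rightarrow> 'c::field mat) \<Rightarrow> bool" where
  "representation m T \<longleftrightarrow>
     (\<forall>g. T g \<in> carrier_mat m m) \<and> T 0 = 1\<^sub>m m \<and> (\<forall>g h. T (g + h) = T g * T h)"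

definition irreducible_representation :: "nat \<Rightarrow> ('g::group_add \<Rightarrow> 'c::field mat) \<Rightarrow> bool" where
  "irreducible_representation m T \<longleftrightarrow>
     representation m T \<and> 0 < m \<and>
     (\<forall>W. VectorSpace.subspace class_ring W (module_vec TYPE('c) m) \<longrightarrow>
          (\<forall>g. \<forall>w\<in>W. T g *\<^sub>v w \<in> W) \<longrightarrow> W = {0\<^sub>v m} \<or> W = carrier_vec m)"

definition character_of :: "('g \<Rightarrow> 'c::field mat) \<Rightarrow> 'g \<Rightarrow> 'c" where
  "character_of T g = (\<Sum>i<dim_row (T g). T g $$ (i, i))"

definition irreducible_characters :: "('g::group_add \<Rightarrow> 'c::field) set" where
  "irreducible_characters = {character_of T |m T. irreducible_representation m T}"

definition rep_of_character :: "('g::group_add \<Rightarrow> 'c::field) \<Rightarrow> 'g \<Rightarrow> 'c mat" where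
  "rep_of_character \<chi> = (SOME T. (\<exists>m. representation m T) \<and> character_of T = \<chi>)"


section \<open>The stable general linear group and K1\<close>

definition GL_fin :: "nat \<Rightarrow> 'a::ring_1 mat set" where
  "GL_fin n = Units (ring_mat TYPE('a) n ())"

text \<open>
  The direct limit of the groups \<open>GL\<^sub>n\<close> along \<open>A \<mapsto> A \<oplus> 1\<close>, realised by infinite
  matrices: \<open>stabilize\<close> is the canonical map from \<open>GL\<^sub>n\<close> to the limit. The sum in the
  product is finite because the rows have finite support.
\<close>

definition stabilize :: "'a::ring_1 mat \<Rightarrow> nat \<Rightarrow> nat \<Rightarrow> 'a" where
  "stabilize A = (\<lambda>i j. if i < dim_row A \<and> j < dim_col A then A $$ (i, j)
                        else if i = j then 1 else 0)"

definition GL :: "'a::ring_1 itself \<Rightarrow> (nat \<Rightarrow> nat \<Rightarrow> 'a) monoid" where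
  "GL _ = \<lparr>carrier = stabilize ` (\<Union>n. GL_fin n),
           monoid.mult = (\<lambda>A B i j. (\<Sum>k\<in>{k. A i k \<noteq> 0}. A i k * B k j)),
           one = (\<lambda>i j. if i = j then 1 else 0)\<rparr>"

definition K1 :: "'a::ring_1 itself \<Rightarrow> (nat \<Rightarrow> nat \<Rightarrow> 'a) set monoid" where
  "K1 A = GL A Mod derived (GL A) (carrier (GL A))"

definition unit_to_GL :: "'a::ring_1 \<Rightarrow> nat \<Rightarrow> nat \<Rightarrow> 'a" where
  "unit_to_GL u = stabilize (mat 1 1 (\<lambda>_. u))"

section \<open>The map Det on matrices over the group ring\<close>

definition to_Nc :: "'r::idom \<Rightarrow> 'r fract alg_closure" where
  "to_Nc r = to_ac (to_fract r)"

text \<open>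
  The linear extension of \<open>T\<close> to \<open>n \<times> n\<close> matrices over \<open>R[G]\<close>: the \<open>nm \<times> nm\<close>
  matrix whose \<open>(i, j)\<close> block of size \<open>m\<close> is \<open>\<Sum>g. A\<^sub>i\<^sub>j(g) T(g)\<close>, where \<open>m\<close> is
  the degree of \<open>T\<close>.
\<close>

definition extend_rep ::
  "('g::{group_add,finite} \<Rightarrow> 'r::idom fract alg_closure mat) \<Rightarrow> ('g \<Rightarrow>\<^sub>0 'r) mat
     \<Rightarrow> 'r fract alg_closure mat" where
  "extend_rep T A = (let m = dim_row (T 0) in
     mat (dim_row A * m) (dim_col A * m) (\<lambda>(a, b).
       \<Sum>g\<in>UNIV. to_Nc (Poly_Mapping.lookup (A $$ (a div m, b div m)) g) * T g $$ (a mod m, b mod m)))"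

definition Det_fin ::
  "('g::{group_add,finite} \<Rightarrow>\<^sub>0 'r::idom) mat
     \<Rightarrow> ('g \<Rightarrow> 'r fract alg_closure) \<Rightarrow> 'r fract alg_closure" where
  "Det_fin A = (\<lambda>\<chi>\<in>irreducible_characters. det (extend_rep (rep_of_character \<chi>) A))"

text \<open>
  \<open>Det\<close> on the limit is computed on any finite level representing the given element, and
  on a class in \<open>K1\<close> it is the common value on the elements of that class.
\<close>

definition Det_GL ::
  "(nat \<Rightarrow> nat \<Rightarrow> ('g::{group_add,finite} \<Rightarrow>\<^sub>0 'r::idom))
     \<Rightarrow> ('g \<Rightarrow> 'r fract alg_closure) \<Rightarrow> 'r fract alg_closure" where
  "Det_GL M = Det_fin (SOME A. (\<exists>n. A \<in> GL_fin n) \<and> stabilize A = M)"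

definition Det_K1 ::
  "(nat \<Rightarrow> nat \<Rightarrow> ('g::{group_add,finite} \<Rightarrow>\<^sub>0 'r::idom)) set
     \<Rightarrow> ('g \<Rightarrow> 'r fract alg_closure) \<Rightarrow> 'r fract alg_closure" where
  "Det_K1 C = the_elem (Det_GL ` C)"

end

theory Submission
  imports
    Defs
    "HOL-Algebra.Group_Action"
    "HOL-Algebra.Multiplicative_Group"
    "Jordan_Normal_Form.Char_Poly"
begin

text \<open>
  Let \<open>A = R[G]\<close> and let \<open>J\<close> be its Jacobson radical. The claim to prove is that for every invertible
  matrix \<open>M\<close> over \<open>A\<close> there is a unit \<open>u\<close> of \<open>A\<close> such that \<open>det (T M) = det (T u)\<close> for all
  representations \<open>T\<close> of \<open>G\<close> simultaneously.

  The tool for eliminations is Sylvester's identity \<open>det (1 + M N) = det (1 + N M)\<close> for rectangular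
  matrices, which holds after applying any representation. It clears a matrix congruent to \<open>1\<close>
  modulo \<open>J\<close> column by column, so such a matrix has the determinant of a unit
  (\<open>det_of_unit_one_plus_jacobson\<close>). The difficulty is that invertible matrices over \<open>A/J\<close> need not be
  products of elementary and diagonal ones: \<open>A/J\<close> is a product of matrix rings over commutative rings
  that are not local in general. Commutativity helps in another way: if the entries of a matrix
  lie in a commutative subring, its determinant can be formed inside that subring, and a representation
  applied to this element has the same determinant as the representation applied to the matrix
  (\<open>det_block_matrix_commutative\<close>).

  To reach commutative coefficients, consider the image \<open>F\<close> of \<open>\<int>[G]\<close> in \<open>A/J\<close>. Completeness puts \<open>p\<close>
  into \<open>J\<close>, so \<open>F\<close> is a finite ring, and it has no nonzero nilpotent ideals. Hence \<open>F\<close> is generated as an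
  ideal by finitely many minimal idempotents \<open>f\<close> with \<open>f F g = 0\<close> for \<open>f \<noteq> g\<close>, and each
  \<open>f F f\<close> is a finite division ring, thus a field by Wedderburn's little theorem, and consists of \<open>0\<close> and
  the powers of one element \<open>\<alpha> f\<close> (\<open>ex_cyclic_basic_idempotents\<close>). Lift \<open>f\<close> and \<open>\<alpha> f\<close> to \<open>A\<close>
  arbitrarily. As \<open>F\<close> spans \<open>A/J\<close> over \<open>R\<close>, modulo \<open>J\<close> the set \<open>f A f\<close> lies in the commutative ring
  \<open>R[\<alpha> f]\<close>, and \<open>f A g\<close> vanishes for \<open>f \<noteq> g\<close>.

  Finally write \<open>1 = P Q\<close> with a row \<open>P\<close> with entries in the \<open>A f\<close> and a column \<open>Q\<close> with entries in
  the \<open>f A\<close>. By Sylvester's identity \<open>M = 1 + (M - 1) P Q\<close> may be replaced by \<open>1 + Q (M - 1) P\<close>. Modulo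
  \<open>J\<close> this matrix is block diagonal, with one block over each of the commutative rings \<open>R[\<alpha> f]\<close>, and
  the remaining factor is congruent to \<open>1\<close> modulo \<open>J\<close> (\<open>det_of_unit_GL\<close>, \<open>det_of_unit_group_ring\<close>).

  That \<open>Det\<close> has the same image on \<open>K\<^sub>1\<close> as on \<open>GL\<close> holds because it is multiplicative with
  values in a commutative group, so that it is constant on the cosets of the derived subgroup.
\<close>

section \<open>Determinants of block matrices\<close>

text \<open>
The size of the blocks is a parameter, since the matrix may have no entries to read it off. For the
linear extension of \<open>T\<close> to the group ring this is the matrix \<open>extend_rep T M\<close>.
\<close>

definition block_matrix :: "nat \<Rightarrow> ('a \<Rightarrow> 'k mat) \<Rightarrow> 'a mat \<Rightarrow> 'k mat" where
  "block_matrix m \<phi> M = mat (dim_row M * m) (dim_col M * m)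
     (\<lambda>(a, b). \<phi> (M $$ (a div m, b div m)) $$ (a mod m, b mod m))"

lemma block_matrix_carrier [simp]:
  "M \<in> carrier_mat n k \<Longrightarrow> block_matrix m \<phi> M \<in> carrier_mat (n * m) (k * m)"
  by (auto simp: block_matrix_def)

lemma div_mod_bounds:
  assumes "a < n * m"
  shows "a div m < n" "a mod m < (m::nat)"
  using assms by (auto simp: less_mult_imp_div_less intro!: mod_less_divisor gr0I)

lemma sum_div_mod:
  fixes f :: "nat \<Rightarrow> nat \<Rightarrow> 'b::comm_monoid_add"
  shows "(\<Sum>c\<in>{0..<k * m}. f (c div m) (c mod m)) = (\<Sum>j\<in>{0..<k}. \<Sum>r\<in>{0..<m}. f j r)"
proof -
  have "(\<Sum>c\<in>{0..<k * m}. f (c div m) (c mod m))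
      = (\<Sum>j<k. \<Sum>c\<in>{j * m..<j * m + m}. f (c div m) (c mod m))"
    using sum.nat_group[of "\<lambda>c. f (c div m) (c mod m)" m k] by (simp add: atLeast0LessThan)
  also have "\<dots> = (\<Sum>j<k. \<Sum>r\<in>{0..<m}. f j r)"
  proof (rule sum.cong[OF refl])
    fix j
    have "(\<Sum>c\<in>{j * m..<j * m + m}. f (c div m) (c mod m))
        = (\<Sum>r\<in>{0..<m}. f ((r + j * m) div m) ((r + j * m) mod m))"
      using sum.shift_bounds_nat_ivl[of "\<lambda>c. f (c div m) (c mod m)" 0 "j * m" m]
      by (simp add: add.commute)
    also have "\<dots> = (\<Sum>r\<in>{0..<m}. f j r)"
      by (rule sum.cong) auto
    finally show "(\<Sum>c\<in>{j * m..<j * m + m}. f (c div m) (c mod m)) = (\<Sum>r\<in>{0..<m}. f j r)" .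
  qed
  finally show ?thesis by (simp add: atLeast0LessThan)
qed

text \<open>
Determinants are compared under all finite-dimensional representations of a ring at once, so that
characters and irreducibility play their part only in the evaluation of \<open>Det\<close>. The same notion serves for
representations of polynomial rings obtained by substitution.
\<close>

locale matrix_hom =
  fixes m :: nat and \<phi> :: "'a::ring_1 \<Rightarrow> 'k::idom mat"
  assumes carrier [simp]: "\<phi> a \<in> carrier_mat m m"
    and one: "\<phi> 1 = 1\<^sub>m m"
    and add: "\<phi> (a + b) = \<phi> a + \<phi> b"
    and mult: "\<phi> (a * b) = \<phi> a * \<phi> b"
begin

lemma dims [simp]: "dim_row (\<phi> a) = m" "dim_col (\<phi> a) = m"
  by (rule carrier_matD[OF carrier])+

lemma index_add: "i < m \<Longrightarrow> j < m \<Longrightarrow> \<phi> (a + b) $$ (i, j) = \<phi> a $$ (i, j) + \<phi> b $$ (i, j)"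
  by (simp add: add)

lemma zero: "\<phi> 0 = 0\<^sub>m m m"
proof (rule eq_matI)
  fix i j assume "i < dim_row (0\<^sub>m m m :: 'k mat)" "j < dim_col (0\<^sub>m m m :: 'k mat)"
  then show "\<phi> 0 $$ (i, j) = 0\<^sub>m m m $$ (i, j)"
    using index_add[of i j 0 0] by (metis add_0 add_cancel_left_left index_zero_mat)
qed auto

lemma index_sum:
  "i < m \<Longrightarrow> j < m \<Longrightarrow> \<phi> (\<Sum>x\<in>S. f x) $$ (i, j) = (\<Sum>x\<in>S. \<phi> (f x) $$ (i, j))"
  by (induction S rule: infinite_finite_induct) (auto simp: zero index_add)

lemma index_mult:
  "i < m \<Longrightarrow> j < m \<Longrightarrow> \<phi> (a * b) $$ (i, j) = (\<Sum>r\<in>{0..<m}. \<phi> a $$ (i, r) * \<phi> b $$ (r, j))"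
  by (simp add: mult scalar_prod_def)

abbreviation "blk \<equiv> block_matrix m \<phi>"

lemma block_matrix_add:
  assumes "M \<in> carrier_mat n k" "N \<in> carrier_mat n k"
  shows "blk (M + N) = blk M + blk N"
proof (rule eq_matI)
  fix a b assume ab: "a < dim_row (blk M + blk N)" "b < dim_col (blk M + blk N)"
  then have *: "a < n * m" "b < k * m" using assms by (auto simp: block_matrix_def)
  then have "a div m < n" "b div m < k" "a mod m < m" "b mod m < m"
    by (auto dest: div_mod_bounds)
  then show "blk (M + N) $$ (a, b) = (blk M + blk N) $$ (a, b)"
    using assms * by (simp add: block_matrix_def index_add)
qed (use assms in \<open>auto simp: block_matrix_def\<close>)

lemma block_matrix_mult:
  assumes M: "M \<in> carrier_mat n k" and N: "N \<in> carrier_mat k l"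
  shows "blk (M * N) = blk M * blk N"
proof (rule eq_matI)
  fix a b assume ab: "a < dim_row (blk M * blk N)" "b < dim_col (blk M * blk N)"
  then have *: "a < n * m" "b < l * m" using assms by (auto simp: block_matrix_def)
  then have i: "a div m < n" "b div m < l" "a mod m < m" "b mod m < m"
    by (auto dest: div_mod_bounds)
  have "blk (M * N) $$ (a, b)
      = \<phi> (\<Sum>j\<in>{0..<k}. M $$ (a div m, j) * N $$ (j, b div m)) $$ (a mod m, b mod m)"
    using M N * i by (simp add: block_matrix_def scalar_prod_def)
  also have "\<dots> = (\<Sum>j\<in>{0..<k}. \<Sum>r\<in>{0..<m}. \<phi> (M $$ (a div m, j)) $$ (a mod m, r)
                       * \<phi> (N $$ (j, b div m)) $$ (r, b mod m))"
    using i by (simp add: index_sum index_mult)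
  also have "\<dots> = (\<Sum>c\<in>{0..<k * m}. \<phi> (M $$ (a div m, c div m)) $$ (a mod m, c mod m)
                       * \<phi> (N $$ (c div m, b div m)) $$ (c mod m, b mod m))"
    by (rule sum_div_mod[symmetric])
  also have "\<dots> = (blk M * blk N) $$ (a, b)"
    using M N * by (simp add: block_matrix_def scalar_prod_def)
  finally show "blk (M * N) $$ (a, b) = (blk M * blk N) $$ (a, b)" .
qed (use assms in \<open>auto simp: block_matrix_def\<close>)

lemma block_matrix_zero: "blk (0\<^sub>m n k) = 0\<^sub>m (n * m) (k * m)"
proof (rule eq_matI)
  fix a b assume "a < dim_row (0\<^sub>m (n * m) (k * m) :: 'k mat)" "b < dim_col (0\<^sub>m (n * m) (k * m) :: 'k mat)"
  then have *: "a < n * m" "b < k * m" by auto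
  then have "a div m < n" "b div m < k" "a mod m < m" "b mod m < m"
    by (auto dest: div_mod_bounds)
  then show "blk (0\<^sub>m n k) $$ (a, b) = 0\<^sub>m (n * m) (k * m) $$ (a, b)"
    using * by (simp add: block_matrix_def zero)
qed (auto simp: block_matrix_def)

lemma block_matrix_one: "blk (1\<^sub>m n) = 1\<^sub>m (n * m)"
proof (rule eq_matI)
  fix a b assume "a < dim_row (1\<^sub>m (n * m) :: 'k mat)" "b < dim_col (1\<^sub>m (n * m) :: 'k mat)"
  then have *: "a < n * m" "b < n * m" by auto
  then have i: "a div m < n" "b div m < n" "a mod m < m" "b mod m < m"
    by (auto dest: div_mod_bounds)
  have "a = b \<longleftrightarrow> a div m = b div m \<and> a mod m = b mod m"
    by (metis div_mult_mod_eq)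
  then show "blk (1\<^sub>m n) $$ (a, b) = 1\<^sub>m (n * m) $$ (a, b)"
    using * i by (auto simp: block_matrix_def zero one)
qed (auto simp: block_matrix_def)

lemma block_matrix_single: "blk (mat 1 1 (\<lambda>_. a)) = \<phi> a"
  by (rule eq_matI) (auto simp: block_matrix_def)

lemma block_matrix_four_block:
  assumes "A \<in> carrier_mat n1 k1" "B \<in> carrier_mat n1 k2" "C \<in> carrier_mat n2 k1" "D \<in> carrier_mat n2 k2"
  shows "blk (four_block_mat A B C D) = four_block_mat (blk A) (blk B) (blk C) (blk D)"
proof (rule eq_matI)
  let ?R = "four_block_mat (blk A) (blk B) (blk C) (blk D)"
  fix a b assume "a < dim_row ?R" "b < dim_col ?R"
  then have *: "a < n1 * m + n2 * m" "b < k1 * m + k2 * m" using assms by (auto simp: block_matrix_def)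
  then have m: "m > 0" by (cases m) auto
  have lt: "(x < n * m) = (x div m < n)" for x n using m by (simp add: div_less_iff_less_mult)
  have sub: "(x - n * m) div m = x div m - n" "\<not> x div m < n \<Longrightarrow> (x - n * m) mod m = x mod m" for x n
  proof -
    have eq: "x = (x - n * m) + n * m" if "\<not> x div m < n" using lt[of x n] that by simp
    show "(x - n * m) div m = x div m - n"
    proof (cases "x div m < n")
      case True
      then show ?thesis using lt[of x n] by simp
    next
      case False
      from eq[OF this] have "x div m = (x - n * m) div m + n" using m by (metis div_mult_self1 add.commute gr_implies_not0)
      then show ?thesis by simp
    qed
    show "(x - n * m) mod m = x mod m" if "\<not> x div m < n"
      using eq[OF that] by (metis mod_mult_self1)
  qed
  have i: "a div m < n1 + n2" "b div m < k1 + k2"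
    using * by (auto simp: lt[symmetric] algebra_simps)
  have ub: "a - n1 * m < n2 * m" if "\<not> a < n1 * m" using that * by auto
  have vb: "b - k1 * m < k2 * m" if "\<not> b < k1 * m" using that * by auto
  show "blk (four_block_mat A B C D) $$ (a, b) = ?R $$ (a, b)"
    using assms * i ub vb by (auto simp: block_matrix_def lt sub distrib_right)
qed (use assms in \<open>auto simp: block_matrix_def distrib_right\<close>)

end

abbreviation units :: "'a::ring_1 set" where
  "units \<equiv> Units (class_ring :: 'a ring)"

lemma units_iff: "(a :: 'a::ring_1) \<in> units \<longleftrightarrow> (\<exists>b. a * b = 1 \<and> b * a = 1)"
  by (auto simp: Units_def)

lemma GL_fin_iff:
  "M \<in> GL_fin n \<longleftrightarrow> M \<in> carrier_mat n n \<and> (\<exists>N \<in> carrier_mat n n. M * N = 1\<^sub>m n \<and> N * M = 1\<^sub>m n)"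
  by (auto simp: GL_fin_def Units_def ring_mat_def)

text \<open>
Sylvester's identity: both sides are the determinant of the block matrix with rows \<open>(1, -M)\<close> and
\<open>(N, 1)\<close>, which has two factorisations into block triangular matrices.
\<close>

lemma det_one_plus_mult_commute:
  fixes M :: "'k::idom mat"
  assumes M: "M \<in> carrier_mat n k" and N: "N \<in> carrier_mat k n"
  shows "det (1\<^sub>m n + M * N) = det (1\<^sub>m k + N * M)"
proof -
  let ?B = "four_block_mat (1\<^sub>m n) (- M) N (1\<^sub>m k)"
  have "?B = four_block_mat (1\<^sub>m n) (0\<^sub>m n k) N (1\<^sub>m k) * four_block_mat (1\<^sub>m n) (- M) (0\<^sub>m k n) (1\<^sub>m k + N * M)"
    using assms by (subst mult_four_block_mat[of _ n n _ k _ k _ _ n _ k]) auto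
  then have 1: "det ?B = det (1\<^sub>m k + N * M)"
    using assms by (simp add: det_mult[of _ "n + k"] det_four_block_mat_upper_right_zero[of _ n _ k]
        det_four_block_mat_lower_left_zero[of _ n _ k])
  have "?B = four_block_mat (1\<^sub>m n + M * N) (- M) (0\<^sub>m k n) (1\<^sub>m k) * four_block_mat (1\<^sub>m n) (0\<^sub>m n k) N (1\<^sub>m k)"
    using assms by (subst mult_four_block_mat[of _ n n _ k _ k _ _ n _ k]) auto
  then have 2: "det ?B = det (1\<^sub>m n + M * N)"
    using assms by (simp add: det_mult[of _ "n + k"] det_four_block_mat_upper_right_zero[of _ n _ k]
        det_four_block_mat_lower_left_zero[of _ n _ k])
  show ?thesis using 1 2 by simp
qed

context matrix_hom
begin

lemma det_blk_mult:
  assumes "M \<in> carrier_mat n n" "N \<in> carrier_mat n n"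
  shows "det (blk (M * N)) = det (blk M) * det (blk N)"
  using assms by (simp add: block_matrix_mult[of _ n n _ n] det_mult[of _ "n * m"])

lemma det_blk_commute:
  assumes "M \<in> carrier_mat n k" "N \<in> carrier_mat k n"
  shows "det (blk (1\<^sub>m n + M * N)) = det (blk (1\<^sub>m k + N * M))"
proof -
  have "blk (1\<^sub>m n + M * N) = 1\<^sub>m (n * m) + blk M * blk N"
    using assms by (simp add: block_matrix_add[of _ n n] block_matrix_mult[of _ n k _ n] block_matrix_one)
  moreover have "blk (1\<^sub>m k + N * M) = 1\<^sub>m (k * m) + blk N * blk M"
    using assms by (simp add: block_matrix_add[of _ k k] block_matrix_mult[of _ k n _ k] block_matrix_one)
  ultimately show ?thesis
    using assms det_one_plus_mult_commute[of "blk M" "n * m" "k * m" "blk N"] by simp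
qed

end

text \<open>
If \<open>W\<close> inverts \<open>1 + Q P\<close>, then \<open>1 - P W Q\<close> inverts \<open>1 + P Q\<close>.
\<close>

lemma one_plus_mult_invertible:
  assumes P: "P \<in> carrier_mat n k" and Q: "(Q :: 'a::ring_1 mat) \<in> carrier_mat k n"
    and inv: "1\<^sub>m k + Q * P \<in> GL_fin k"
  shows "1\<^sub>m n + P * Q \<in> GL_fin n"
proof -
  obtain W where W: "W \<in> carrier_mat k k" "(1\<^sub>m k + Q * P) * W = 1\<^sub>m k" "W * (1\<^sub>m k + Q * P) = 1\<^sub>m k"
    using inv by (auto simp: GL_fin_iff)
  have c [simp]: "P * W \<in> carrier_mat n k" "W * Q \<in> carrier_mat k n" "Q * P \<in> carrier_mat k k"
    "P * Q \<in> carrier_mat n n" "P * W * Q \<in> carrier_mat n n" "Q * P * (W * Q) \<in> carrier_mat k n"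
    "P * W * (Q * P) \<in> carrier_mat n k" using P Q W(1) by auto
  have "W * Q + Q * P * (W * Q) = (1\<^sub>m k + Q * P) * W * Q"
    using P Q W(1) by (simp add: add_mult_distrib_mat[of _ k k _ _ k] add_mult_distrib_mat[of _ k k _ _ n]
        assoc_mult_mat[of _ k n _ k _ n] assoc_mult_mat[of _ k k _ k _ n])
  then have WQ: "W * Q + Q * P * (W * Q) = Q" using Q by (simp only: W left_mult_one_mat)
  have "P * W + P * W * (Q * P) = P * (W * (1\<^sub>m k + Q * P))"
    using P Q W(1) by (simp add: mult_add_distrib_mat[of _ k k _ k] mult_add_distrib_mat[of _ n k _ k]
        assoc_mult_mat[of _ n k _ k _ k])
  then have PW: "P * W + P * W * (Q * P) = P" using P by (simp only: W right_mult_one_mat)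
  define U where "U = P * W * Q"
  have U: "U \<in> carrier_mat n n" by (simp add: U_def)
  have "P * Q * U = P * (Q * P * (W * Q))" unfolding U_def
    using P Q W(1) by (simp add: assoc_mult_mat[of _ n k _ n _ n] assoc_mult_mat[of _ n k _ k _ n] assoc_mult_mat[of _ k n _ k _ n])
  then have "U + P * Q * U = P * (W * Q + Q * P * (W * Q))"
    using P Q W(1) by (simp add: U_def mult_add_distrib_mat[of _ n k _ n] assoc_mult_mat[of _ n k _ k _ n])
  then have 1: "U + P * Q * U = P * Q" by (simp only: WQ)
  have "U * (P * Q) = P * W * (Q * P) * Q" unfolding U_def
    using P Q W(1) by (simp add: assoc_mult_mat[of _ n k _ n _ n] assoc_mult_mat[of _ n k _ k _ n] assoc_mult_mat[of _ k n _ k _ n]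
        assoc_mult_mat[of _ k k _ n _ n])
  then have "U + U * (P * Q) = (P * W + P * W * (Q * P)) * Q"
    using P Q W(1) by (simp add: U_def add_mult_distrib_mat[of _ n k _ _ n] del: assoc_mult_mat)
  then have 2: "U + U * (P * Q) = P * Q" by (simp only: PW)
  have cancel: "1\<^sub>m n + Z - Z = 1\<^sub>m n" if "Z \<in> carrier_mat n n" for Z :: "'a mat" using that by auto
  let ?V = "1\<^sub>m n - U"
  have V: "?V \<in> carrier_mat n n" using U by (simp add: minus_carrier_mat)
  have "(1\<^sub>m n + P * Q) * ?V = 1\<^sub>m n + P * Q - (U + P * Q * U)"
    using U P Q by (simp add: mult_minus_distrib_mat[of _ n n _ n] add_mult_distrib_mat[of _ n n _ _ n])
  then have 1: "(1\<^sub>m n + P * Q) * ?V = 1\<^sub>m n" using cancel[OF c(4)] by (simp only: 1)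
  have "?V * (1\<^sub>m n + P * Q) = 1\<^sub>m n + P * Q - (U + U * (P * Q))"
    using U P Q by (simp add: minus_mult_distrib_mat[of _ n n _ _ n] mult_add_distrib_mat[of _ n n _ n])
  then have 2: "?V * (1\<^sub>m n + P * Q) = 1\<^sub>m n" using cancel[OF c(4)] by (simp only: 2)
  show ?thesis using 1 2 V P Q by (auto simp: GL_fin_iff)
qed

lemma units_mult: "a \<in> units \<Longrightarrow> b \<in> units \<Longrightarrow> a * b \<in> (units :: 'a::ring_1 set)"
  unfolding units_iff by (metis mult.assoc mult_1_right)

lemma one_in_units: "1 \<in> (units :: 'a::ring_1 set)"
  by (auto simp: units_iff)

lemma one_plus_commute_units:
  fixes a b :: "'a::ring_1"
  assumes "1 + a * b \<in> units"
  shows "1 + b * a \<in> units"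
proof -
  obtain c where c: "(1 + a * b) * c = 1" "c * (1 + a * b) = 1"
    using assms by (auto simp: units_iff)
  have 1: "a * (b * c) = 1 - c" using c(1) by (simp add: algebra_simps)
  have 2: "c * (a * b) = 1 - c" using c(2) by (simp add: algebra_simps)
  have "(1 + b * a) * (1 - b * c * a) = 1 + b * a - b * (c + a * (b * c)) * a"
    by (simp add: algebra_simps)
  moreover have "(1 - b * c * a) * (1 + b * a) = 1 + b * a - b * (c + c * (a * b)) * a"
    by (simp add: algebra_simps)
  ultimately show ?thesis unfolding units_iff 1 2 by (intro exI[of _ "1 - b * c * a"]) simp
qed

section \<open>The Jacobson radical\<close>

text \<open>
As \<open>1 + a b\<close> and \<open>1 + b a\<close> are units simultaneously, multiplying by \<open>x\<close> on the right only already
gives a two-sided ideal.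
\<close>

definition jacobson_radical :: "'a::ring_1 set" where
  "jacobson_radical = {a. \<forall>x. 1 + a * x \<in> units}"

lemma jacobson_zero: "0 \<in> jacobson_radical"
  by (simp add: jacobson_radical_def one_in_units)

lemma jacobson_one_plus: "a \<in> jacobson_radical \<Longrightarrow> 1 + a \<in> units"
  by (metis (mono_tags, lifting) jacobson_radical_def mem_Collect_eq mult_1_right)

lemma jacobson_mult_right: "a \<in> jacobson_radical \<Longrightarrow> a * b \<in> jacobson_radical"
  by (simp add: jacobson_radical_def mult.assoc)

lemma jacobson_mult_left:
  assumes "a \<in> jacobson_radical"
  shows "b * a \<in> jacobson_radical"
proof -
  have "1 + b * a * x \<in> units" for x
    using one_plus_commute_units[of "a * x" b] assms
    by (simp add: jacobson_radical_def mult.assoc)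
  then show ?thesis by (simp add: jacobson_radical_def)
qed

lemma jacobson_add:
  assumes a: "a \<in> jacobson_radical" and b: "b \<in> jacobson_radical"
  shows "a + b \<in> jacobson_radical"
proof -
  have "1 + (a + b) * x \<in> units" for x
  proof -
    obtain c where c: "(1 + a * x) * c = 1" "c * (1 + a * x) = 1"
      using a by (auto simp: jacobson_radical_def units_iff)
    have u: "1 + a * x \<in> units" using c by (auto simp: units_iff)
    have "1 + c * b * x \<in> units"
      using jacobson_mult_left[OF b, of c] by (simp add: jacobson_radical_def)
    then have "(1 + a * x) * (1 + c * b * x) \<in> units" by (rule units_mult[OF u])
    moreover have "(1 + a * x) * (1 + c * b * x) = 1 + a * x + ((1 + a * x) * c) * b * x"
      by (simp only: distrib_left mult_1_right mult.assoc)
    then have "(1 + a * x) * (1 + c * b * x) = 1 + (a + b) * x"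
      by (simp only: c) (simp add: algebra_simps)
    ultimately show ?thesis by simp
  qed
  then show ?thesis by (simp add: jacobson_radical_def)
qed

lemma jacobson_uminus: "a \<in> jacobson_radical \<Longrightarrow> - a \<in> jacobson_radical"
  using jacobson_mult_left[of a "- 1"] by simp

lemma jacobson_sum: "(\<And>x. x \<in> S \<Longrightarrow> f x \<in> jacobson_radical) \<Longrightarrow> (\<Sum>x\<in>S. f x) \<in> jacobson_radical"
  by (induction S rule: infinite_finite_induct) (auto intro: jacobson_zero jacobson_add)

lemma unit_mod_jacobson:
  assumes "a * b - 1 \<in> jacobson_radical" "b * a - 1 \<in> jacobson_radical"
  shows "a \<in> units"
proof -
  have "a * b \<in> units" "b * a \<in> units"
    using jacobson_one_plus[OF assms(1)] jacobson_one_plus[OF assms(2)] by simp_all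
  then obtain c d where "a * b * c = 1" "d * (b * a) = 1" by (auto simp: units_iff)
  then have "a * (b * c) = 1" "d * b * a = 1" by (simp_all add: mult.assoc)
  then show ?thesis unfolding units_iff by (metis mult.assoc mult_1_left mult_1_right)
qed

text \<open>
A single unit has to serve all representations over all degrees. This is what makes the property
strong enough to compare values of \<open>Det\<close>, which are functions of the character.
\<close>

definition det_of_unit :: "'k::idom itself \<Rightarrow> 'a::ring_1 mat \<Rightarrow> bool" where
  "det_of_unit _ M \<longleftrightarrow>
     (\<exists>u\<in>units. \<forall>m (\<phi> :: 'a \<Rightarrow> 'k mat). matrix_hom m \<phi> \<longrightarrow> det (block_matrix m \<phi> M) = det (\<phi> u))"

lemma det_of_unit_mult:
  assumes "det_of_unit TYPE('k::idom) M" "det_of_unit TYPE('k) N"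
    and "M \<in> carrier_mat n n" "N \<in> carrier_mat n n"
  shows "det_of_unit TYPE('k) (M * N)"
proof -
  obtain u v where uv: "u \<in> units" "v \<in> units"
    and "\<forall>m (\<phi> :: 'a \<Rightarrow> 'k mat). matrix_hom m \<phi> \<longrightarrow> det (block_matrix m \<phi> M) = det (\<phi> u)"
    and "\<forall>m (\<phi> :: 'a \<Rightarrow> 'k mat). matrix_hom m \<phi> \<longrightarrow> det (block_matrix m \<phi> N) = det (\<phi> v)"
    using assms(1,2) unfolding det_of_unit_def by blast
  then have "det (block_matrix m \<phi> (M * N)) = det (\<phi> (u * v))"
    if "matrix_hom m \<phi>" for m and \<phi> :: "'a \<Rightarrow> 'k mat"
    using that assms(3,4) by (simp add: matrix_hom.det_blk_mult matrix_hom.mult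
        det_mult[OF matrix_hom.carrier matrix_hom.carrier])
  then show ?thesis using units_mult[OF uv] unfolding det_of_unit_def by blast
qed

lemma GL_fin_mult:
  assumes "M \<in> GL_fin n" "N \<in> GL_fin n"
  shows "M * N \<in> (GL_fin n :: 'a::ring_1 mat set)"
proof -
  interpret semiring "ring_mat TYPE('a) n ()" by (rule semiring_mat)
  show ?thesis using Units_m_closed[OF assms[unfolded GL_fin_def]]
    by (simp add: GL_fin_def ring_mat_def)
qed

text \<open>
Gaussian elimination, one column at a time. Let \<open>v\<close> be the last nonzero column of \<open>M\<close>, let \<open>w\<close> be the
coordinate row with \<open>M = M' + v w\<close>, where that column of \<open>M'\<close> is zero, and let \<open>V\<close> invert \<open>1 + M'\<close>. Then
\<open>1 + M = (1 + M') (1 + V v w)\<close>, and by Sylvester's identity the second factor has the determinant of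
\<open>1 + w V v\<close>, a matrix of size one whose entry is a unit.
\<close>

lemma det_of_unit_one_plus_jacobson:
  fixes M :: "'a::ring_1 mat"
  assumes M: "M \<in> carrier_mat n n"
    and rad: "\<And>i j. i < n \<Longrightarrow> j < n \<Longrightarrow> M $$ (i, j) \<in> jacobson_radical"
  shows "1\<^sub>m n + M \<in> GL_fin n \<and> det_of_unit TYPE('k::idom) (1\<^sub>m n + M)"
proof -
  note One_nat_def [simp del]
  have "1\<^sub>m n + M \<in> GL_fin n \<and> det_of_unit TYPE('k) (1\<^sub>m n + M)"
    if "M \<in> carrier_mat n n" "\<And>i j. i < n \<Longrightarrow> j < n \<Longrightarrow> M $$ (i, j) \<in> jacobson_radical"
      "\<And>i j. i < n \<Longrightarrow> j < n \<Longrightarrow> c \<le> j \<Longrightarrow> M $$ (i, j) = 0" for c and M :: "'a mat"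
    using that
  proof (induction c arbitrary: M)
    case 0
    then have "1\<^sub>m n + M = 1\<^sub>m n" by (intro eq_matI) auto
    moreover have "det_of_unit TYPE('k) (1\<^sub>m n :: 'a mat)"
      unfolding det_of_unit_def
      by (intro bexI[OF _ one_in_units]) (auto simp: matrix_hom.block_matrix_one matrix_hom.one)
    ultimately show ?case by (auto simp: GL_fin_iff)
  next
    case (Suc c)
    show ?case
    proof (cases "c < n")
      case False
      then show ?thesis using Suc by (metis Suc_leI le_less_trans not_less not_less_eq_eq)
    next
      case c: True
      define M' where "M' = mat n n (\<lambda>(i, j). if j = c then 0 else M $$ (i, j))"
      define v where "v = mat n 1 (\<lambda>(i, _). M $$ (i, c))"
      define w where "w = mat 1 n (\<lambda>(_, j). if j = c then 1 else (0::'a))"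
      have car [simp]: "M' \<in> carrier_mat n n" "v \<in> carrier_mat n 1" "w \<in> carrier_mat 1 n"
        by (simp_all add: M'_def v_def w_def)
      have "1\<^sub>m n + M' \<in> GL_fin n \<and> det_of_unit TYPE('k) (1\<^sub>m n + M')"
        using Suc.prems by (intro Suc.IH) (auto simp: M'_def jacobson_zero)
      then obtain V where V: "V \<in> carrier_mat n n" "(1\<^sub>m n + M') * V = 1\<^sub>m n"
        and IH: "1\<^sub>m n + M' \<in> GL_fin n" "det_of_unit TYPE('k) (1\<^sub>m n + M')"
        by (auto simp: GL_fin_iff)
      have Vv [simp]: "V * v \<in> carrier_mat n 1" "V * v * w \<in> carrier_mat n n"
        using mult_carrier_mat[OF V(1) car(2)] mult_carrier_mat[OF mult_carrier_mat[OF V(1) car(2)] car(3)] by auto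
      have eq: "(1\<^sub>m n + M') * (1\<^sub>m n + V * v * w) = 1\<^sub>m n + M"
      proof -
        have "(1\<^sub>m n + M') * (1\<^sub>m n + V * v * w) = 1\<^sub>m n + M' + (1\<^sub>m n + M') * (V * v * w)"
          by (simp add: mult_add_distrib_mat[of _ n n _ n] right_mult_one_mat[of _ n n])
        also have "(1\<^sub>m n + M') * (V * v * w) = (1\<^sub>m n + M') * V * v * w"
          using V(1) by (simp add: assoc_mult_mat[of _ n n _ n _ n] assoc_mult_mat[of _ n n _ n _ 1]
              assoc_mult_mat[of _ n n _ 1 _ n])
        also have "(1\<^sub>m n + M') * V * v * w = v * w" by (simp only: V(2) left_mult_one_mat[OF car(2)])
        also have "1\<^sub>m n + M' + v * w = 1\<^sub>m n + M"
          using Suc.prems(1) by (intro eq_matI) (auto simp: M'_def v_def w_def scalar_prod_def)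
        finally show ?thesis .
      qed
      have [simp]: "dim_row w = 1" "dim_col w = n" "dim_row v = n" "dim_col v = 1" "dim_row V = n" "dim_col V = n"
        using V(1) by (auto simp: v_def w_def)
      define a where "a = (V * v) $$ (c, 0)"
      have w: "w * (V * v) = mat 1 1 (\<lambda>_. a)"
      proof (rule eq_matI)
        fix i j assume "i < dim_row (mat 1 1 (\<lambda>_. a) :: 'a mat)" "j < dim_col (mat 1 1 (\<lambda>_. a) :: 'a mat)"
        moreover have "(\<Sum>k = 0..<n. (if k = c then 1 else 0) * (V * v) $$ (k, 0)) = (\<Sum>k = 0..<n. if k = c then a else 0)"
          by (intro sum.cong) (auto simp: a_def)
        ultimately show "(w * (V * v)) $$ (i, j) = mat 1 1 (\<lambda>_. a) $$ (i, j)"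
          using c by (simp add: w_def scalar_prod_def)
      qed simp_all
      have "a \<in> jacobson_radical"
        using c V Suc.prems(2) by (auto simp: a_def scalar_prod_def v_def intro!: jacobson_sum jacobson_mult_left)
      then have u: "1 + a \<in> units" by (rule jacobson_one_plus)
      then obtain b where b: "(1 + a) * b = 1" "b * (1 + a) = 1" by (auto simp: units_iff)
      have one: "1\<^sub>m 1 + w * (V * v) = mat 1 1 (\<lambda>_. 1 + a)"
        unfolding w by (intro eq_matI) auto
      have "1\<^sub>m 1 + w * (V * v) \<in> GL_fin 1"
        unfolding GL_fin_iff one using b
        by (intro conjI bexI[of _ "mat 1 1 (\<lambda>_. b)"]) (auto intro!: eq_matI simp: scalar_prod_def)
      then have G: "1\<^sub>m n + V * v * w \<in> GL_fin n"
        by (rule one_plus_mult_invertible[OF Vv(1) car(3)])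
      have "det (block_matrix m \<phi> (1\<^sub>m n + V * v * w)) = det (\<phi> (1 + a))"
        if "matrix_hom m \<phi>" for m and \<phi> :: "'a \<Rightarrow> 'k mat"
        using matrix_hom.det_blk_commute[OF that Vv(1) car(3)] matrix_hom.block_matrix_single[OF that, of "1 + a"]
        by (simp add: one del: One_nat_def)
      then have "det_of_unit TYPE('k) (1\<^sub>m n + V * v * w)"
        using u unfolding det_of_unit_def by blast
      then show ?thesis
        using GL_fin_mult[OF IH(1) G] det_of_unit_mult[OF IH(2), of _ n] unfolding eq[symmetric] by simp
    qed
  qed
  from this[of M n] show ?thesis using M rad by auto
qed

section \<open>Commuting blocks\<close>

lemma det_pencil_poly:
  fixes A B :: "'k::field mat"
  assumes "A \<in> carrier_mat n n" "B \<in> carrier_mat n n"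
  shows "\<exists>p. \<forall>x. det (A + x \<cdot>\<^sub>m B) = poly p x"
proof -
  let ?C = "mat n n (\<lambda>ij. [:A $$ ij, B $$ ij:])"
  have "poly (det ?C) x = det (A + x \<cdot>\<^sub>m B)" for x
    by (rule poly_det_cong[of _ n]) (use assms in auto)
  then show ?thesis by metis
qed

text \<open>
The polynomial is the characteristic polynomial of \<open>- A\<close>.
\<close>

lemma det_shift_poly:
  fixes A :: "'k::field mat"
  assumes A: "A \<in> carrier_mat n n"
  shows "\<exists>p. p \<noteq> 0 \<and> (\<forall>x. det (A + x \<cdot>\<^sub>m 1\<^sub>m n) = poly p x)"
proof (intro exI conjI allI)
  have mA: "- A \<in> carrier_mat n n" using A by simp
  show "char_poly (- A) \<noteq> 0" using degree_monic_char_poly[OF mA] by auto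
  fix x
  show "det (A + x \<cdot>\<^sub>m 1\<^sub>m n) = poly (char_poly (- A)) x"
    unfolding char_poly_def
    by (rule poly_det_cong[of _ n, symmetric]) (use A in \<open>auto simp: char_poly_matrix_def\<close>)
qed

lemma (in matrix_hom) of_nat_mult:
  "\<phi> (of_nat k * a) = of_nat k \<cdot>\<^sub>m \<phi> a"
proof (induction k)
  case 0
  then show ?case by (auto simp: zero intro!: eq_matI)
next
  case (Suc k)
  have "\<phi> (of_nat (Suc k) * a) = \<phi> a + \<phi> (of_nat k * a)" by (simp add: algebra_simps add)
  also have "\<dots> = of_nat (Suc k) \<cdot>\<^sub>m \<phi> a" unfolding Suc
    by (intro eq_matI) (auto simp: algebra_simps)
  finally show ?case .
qed

lemma det_add_corner:
  fixes M :: "'b::comm_ring_1 mat"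
  assumes M: "M \<in> carrier_mat (Suc n) (Suc n)"
  shows "\<exists>c. \<forall>x. det (mat (Suc n) (Suc n) (\<lambda>(i, j). if i = 0 \<and> j = 0 then M $$ (i, j) + x else M $$ (i, j)))
            = det M + x * c"
proof -
  define N where "N x = mat (Suc n) (Suc n) (\<lambda>(i, j). if i = 0 \<and> j = 0 then M $$ (i, j) + x else M $$ (i, j))" for x
  have N: "N x \<in> carrier_mat (Suc n) (Suc n)" for x by (simp add: N_def)
  have "mat_delete (N x) i 0 = mat_delete M i 0" if "i < Suc n" for i x
    using M that by (intro eq_matI) (auto simp: mat_delete_def N_def)
  then have cof: "cofactor (N x) i 0 = cofactor M i 0" if "i < Suc n" for i x
    using that by (simp add: cofactor_def)
  have "det (N x) = det M + x * cofactor M 0 0" for x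
  proof -
    have "det (N x) = (\<Sum>i<Suc n. N x $$ (i, 0) * cofactor M i 0)"
      using laplace_expansion_column[OF N, of 0 x] cof by simp
    also have "\<dots> = (\<Sum>i<Suc n. M $$ (i, 0) * cofactor M i 0 + (if i = 0 then x * cofactor M i 0 else 0))"
      by (intro sum.cong) (auto simp: N_def algebra_simps)
    also have "\<dots> = det M + x * cofactor M 0 0"
      using laplace_expansion_column[OF M, of 0] by (simp add: sum.distrib del: sum.lessThan_Suc)
    finally show ?thesis .
  qed
  then show ?thesis unfolding N_def by blast
qed

text \<open>
Induction on the size of \<open>M\<close>, with corner entry \<open>a\<close>, first column \<open>(a, c)\<close> and first row \<open>(a, r)\<close>.
Multiplication by the matrix with rows \<open>(1, 0)\<close> and \<open>(-c, a)\<close> clears the column \<open>c\<close> without any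
division. Comparing the determinants before and after applying \<open>\<phi>\<close> yields the claim multiplied by a
power of \<open>det (\<phi> a)\<close>. This factor can be cancelled after adding to \<open>a\<close> a natural number outside a finite set,
and both sides depend polynomially on that number.
\<close>

theorem det_block_matrix_commutative:
  fixes \<phi> :: "'b::idom \<Rightarrow> 'k::field mat"
  assumes hom: "matrix_hom m \<phi>" and char0: "inj (of_nat :: nat \<Rightarrow> 'k)"
    and M: "M \<in> carrier_mat n n"
  shows "det (block_matrix m \<phi> M) = det (\<phi> (det M))"
  using M
proof (induction n arbitrary: M)
  interpret matrix_hom m \<phi> by (rule hom)
  case 0
  then have "det M = 1" by (simp add: det_dim_zero)
  moreover have "blk M \<in> carrier_mat 0 0" using 0 block_matrix_carrier[of M 0 0 m \<phi>] by simp
  ultimately show ?case by (simp add: det_dim_zero one)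
next
  interpret matrix_hom m \<phi> by (rule hom)
  have pow: "det (\<phi> (a ^ k)) = det (\<phi> a) ^ k" for a k
    by (induction k) (auto simp: one mult det_mult[OF carrier carrier])
  case (Suc n)
  have invertible_case: "det (blk M) = det (\<phi> (det M))"
    if M: "M \<in> carrier_mat (Suc n) (Suc n)" and nz: "det (\<phi> (M $$ (0, 0))) \<noteq> 0" for M
  proof -
    define a where "a = M $$ (0, 0)"
    define r where "r = mat 1 n (\<lambda>(_, j). M $$ (0, Suc j))"
    define c where "c = mat n 1 (\<lambda>(i, _). M $$ (Suc i, 0))"
    define D where "D = mat n n (\<lambda>(i, j). M $$ (Suc i, Suc j))"
    define S where "S = a \<cdot>\<^sub>m D - c * r"
    define P where "P = four_block_mat (1\<^sub>m 1) (0\<^sub>m 1 n) (- c) (a \<cdot>\<^sub>m 1\<^sub>m n)"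
    define A where "A = mat 1 1 (\<lambda>_. a)"
    have car: "r \<in> carrier_mat 1 n" "c \<in> carrier_mat n 1" "D \<in> carrier_mat n n" "S \<in> carrier_mat n n"
      "A \<in> carrier_mat 1 1" "P \<in> carrier_mat (Suc n) (Suc n)" "a \<cdot>\<^sub>m 1\<^sub>m n \<in> carrier_mat n n"
      by (auto simp: r_def c_def D_def S_def A_def P_def)
    have bcar: "blk (- c) \<in> carrier_mat (n * m) m" "blk (a \<cdot>\<^sub>m 1\<^sub>m n) \<in> carrier_mat (n * m) (n * m)"
      "blk r \<in> carrier_mat m (n * m)" "blk S \<in> carrier_mat (n * m) (n * m)"
      using car block_matrix_carrier[of "- c" n 1 m \<phi>] block_matrix_carrier[of r 1 n m \<phi>] by simp_all
    have M_eq: "M = four_block_mat A r c D"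
      using M by (intro eq_matI) (auto simp: A_def a_def r_def c_def D_def)
    have PM: "P * M = four_block_mat A r (0\<^sub>m n 1) S"
    proof -
      have "P * M = four_block_mat (1\<^sub>m 1 * A + 0\<^sub>m 1 n * c) (1\<^sub>m 1 * r + 0\<^sub>m 1 n * D)
          (- c * A + (a \<cdot>\<^sub>m 1\<^sub>m n) * c) (- c * r + (a \<cdot>\<^sub>m 1\<^sub>m n) * D)"
        unfolding P_def M_eq using car by (intro mult_four_block_mat) auto
      also have "1\<^sub>m 1 * A + 0\<^sub>m 1 n * c = A" using car by simp
      also have "1\<^sub>m 1 * r + 0\<^sub>m 1 n * D = r" using car by simp
      also have "- c * A + (a \<cdot>\<^sub>m 1\<^sub>m n) * c = 0\<^sub>m n 1"
      proof -
        have "(a \<cdot>\<^sub>m 1\<^sub>m n) * c = a \<cdot>\<^sub>m c"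
          using car by (simp add: mult_smult_assoc_mat[of _ n n _ 1])
        then show ?thesis using car by (intro eq_matI) (auto simp: A_def c_def scalar_prod_def)
      qed
      also have "- c * r + (a \<cdot>\<^sub>m 1\<^sub>m n) * D = S"
        using car by (intro eq_matI) (auto simp: S_def)
      finally show ?thesis .
    qed
    have "a ^ n * det M = det (P * M)"
      using car M by (simp add: det_mult[of _ "Suc n"] P_def det_four_block_mat_upper_right_zero[of _ 1 _ n]
          det_smult)
    also have "\<dots> = a * det S"
      unfolding PM using car
      by (simp add: det_four_block_mat_lower_left_zero[of _ 1 _ n] A_def det_single)
    finally have formal: "a ^ n * det M = a * det S" .
    have "det (\<phi> a) ^ n * det (blk M) = det (blk (P * M))"
    proof -
      have "blk P = four_block_mat (blk (1\<^sub>m 1)) (blk (0\<^sub>m 1 n)) (blk (- c)) (blk (a \<cdot>\<^sub>m 1\<^sub>m n))"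
        unfolding P_def using car by (intro block_matrix_four_block) auto
      then have "det (blk P) = det (blk (a \<cdot>\<^sub>m 1\<^sub>m n))"
        using bcar by (simp add: block_matrix_one block_matrix_zero det_four_block_mat_upper_right_zero[of _ m _ "n * m"])
      also have "\<dots> = det (\<phi> a) ^ n"
        using Suc.IH[of "a \<cdot>\<^sub>m 1\<^sub>m n"] by (simp add: det_smult pow)
      finally show ?thesis using car M by (simp add: det_blk_mult[of _ "Suc n"])
    qed
    also have "\<dots> = det (\<phi> a) * det (blk S)"
    proof -
      have "blk (P * M) = four_block_mat (blk A) (blk r) (blk (0\<^sub>m n 1)) (blk S)"
        unfolding PM using car by (intro block_matrix_four_block) auto
      then show ?thesis using bcar block_matrix_single[of a]
        by (simp add: block_matrix_zero det_four_block_mat_lower_left_zero[of _ m _ "n * m"] A_def)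
    qed
    also have "\<dots> = det (\<phi> (a * det S))"
      using Suc.IH[OF car(4)] by (simp add: mult det_mult[OF carrier carrier])
    also have "\<dots> = det (\<phi> a) ^ n * det (\<phi> (det M))"
      unfolding formal[symmetric] by (simp add: mult det_mult[OF carrier carrier] pow)
    finally show ?thesis using nz by (simp add: a_def)
  qed
  \<comment> \<open>For \<open>x = k\<close> a natural number, both determinants of \<open>N x\<close> are polynomials in \<open>k\<close>; they agree unless
    \<open>k\<close> is a root of the polynomial \<open>s\<close> below.\<close>
  define N where "N x = mat (Suc n) (Suc n) (\<lambda>(i, j). if i = 0 \<and> j = 0 then M $$ (i, j) + x else M $$ (i, j))" for x
  define E where "E = mat (Suc n) (Suc n) (\<lambda>(i, j). if i = 0 \<and> j = 0 then 1 else (0::'b))"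
  have N: "N x \<in> carrier_mat (Suc n) (Suc n)" for x by (simp add: N_def)
  obtain c where c: "det (N x) = det M + x * c" for x
    using det_add_corner[OF Suc.prems] unfolding N_def by blast
  have blkN: "blk (N (of_nat k)) = blk M + of_nat k \<cdot>\<^sub>m blk E" for k
  proof (rule eq_matI)
    fix i j assume "i < dim_row (blk M + of_nat k \<cdot>\<^sub>m blk E)" "j < dim_col (blk M + of_nat k \<cdot>\<^sub>m blk E)"
    then have *: "i < Suc n * m" "j < Suc n * m" by (auto simp: block_matrix_def E_def)
    note b = div_mod_bounds[OF *(1)] div_mod_bounds[OF *(2)]
    have "\<phi> (of_nat k) = of_nat k \<cdot>\<^sub>m 1\<^sub>m m" using of_nat_mult[of k 1] by (simp add: one)
    then show "blk (N (of_nat k)) $$ (i, j) = (blk M + of_nat k \<cdot>\<^sub>m blk E) $$ (i, j)"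
      using * b Suc.prems by (simp add: block_matrix_def N_def E_def index_add zero one)
  qed (use Suc.prems in \<open>auto simp: block_matrix_def N_def E_def\<close>)
  have phiN: "\<phi> (det (N (of_nat k))) = \<phi> (det M) + of_nat k \<cdot>\<^sub>m \<phi> c" for k
    by (simp add: c add of_nat_mult)
  obtain p where p: "det (blk M + x \<cdot>\<^sub>m blk E) = poly p x" for x
    using det_pencil_poly[of "blk M" "Suc n * m" "blk E"] Suc.prems
    by (metis E_def block_matrix_carrier mat_carrier)
  obtain q where q: "det (\<phi> (det M) + x \<cdot>\<^sub>m \<phi> c) = poly q x" for x
    using det_pencil_poly[OF carrier carrier] by blast
  obtain s where s: "s \<noteq> 0" "det (\<phi> (M $$ (0, 0)) + x \<cdot>\<^sub>m 1\<^sub>m m) = poly s x" for x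
    using det_shift_poly[OF carrier] by blast
  have "poly ((p - q) * s) (of_nat k) = 0" for k
  proof (cases "poly s (of_nat k) = 0")
    case False
    have "\<phi> (N (of_nat k) $$ (0, 0)) = \<phi> (M $$ (0, 0)) + of_nat k \<cdot>\<^sub>m 1\<^sub>m m"
      using of_nat_mult[of k 1] by (simp add: N_def add one)
    then have "det (\<phi> (N (of_nat k) $$ (0, 0))) \<noteq> 0" using False s(2) by simp
    from invertible_case[OF N this] show ?thesis
      by (simp add: blkN phiN p q)
  qed simp
  then have "range (of_nat :: nat \<Rightarrow> 'k) \<subseteq> {x. poly ((p - q) * s) x = 0}" by auto
  moreover have "infinite (range (of_nat :: nat \<Rightarrow> 'k))" using char0 by (simp add: finite_image_iff)
  ultimately have "(p - q) * s = 0" using poly_roots_finite finite_subset by blast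
  then have "p = q" using s(1) by simp
  moreover have "blk M + 0 \<cdot>\<^sub>m blk E = blk M" "\<phi> (det M) + 0 \<cdot>\<^sub>m \<phi> c = \<phi> (det M)"
    using Suc.prems by (auto intro!: eq_matI simp: block_matrix_def E_def)
  ultimately show ?case using p[of 0] q[of 0] by simp
qed

section \<open>Matrices modulo the Jacobson radical\<close>

definition rad_cong :: "'a::ring_1 \<Rightarrow> 'a \<Rightarrow> bool" where
  "rad_cong a b \<longleftrightarrow> a - b \<in> jacobson_radical"

lemma rad_cong_refl [simp]: "rad_cong a a"
  by (simp add: rad_cong_def jacobson_zero)

lemma rad_cong_sym: "rad_cong a b \<Longrightarrow> rad_cong b a"
  using jacobson_uminus[of "a - b"] by (simp add: rad_cong_def)

lemma rad_cong_trans: "rad_cong a b \<Longrightarrow> rad_cong b c \<Longrightarrow> rad_cong a c"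
  using jacobson_add[of "a - b" "b - c"] by (simp add: rad_cong_def)

lemma rad_cong_add: "rad_cong a b \<Longrightarrow> rad_cong c d \<Longrightarrow> rad_cong (a + c) (b + d)"
  using jacobson_add[of "a - b" "c - d"] by (simp add: rad_cong_def algebra_simps)

lemma rad_cong_mult:
  assumes "rad_cong a b" "rad_cong c d"
  shows "rad_cong (a * c) (b * d)"
proof -
  have "a * c - b * d = (a - b) * c + b * (c - d)" by (simp add: algebra_simps)
  then show ?thesis
    using assms jacobson_add[OF jacobson_mult_right[of "a - b" c] jacobson_mult_left[of "c - d" b]]
    by (simp add: rad_cong_def)
qed

lemma rad_cong_sum: "(\<And>x. x \<in> S \<Longrightarrow> rad_cong (f x) (g x)) \<Longrightarrow> rad_cong (\<Sum>x\<in>S. f x) (\<Sum>x\<in>S. g x)"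
  by (induction S rule: infinite_finite_induct) (auto intro: rad_cong_add)

lemma rad_cong_prod:
  assumes "\<And>x. x \<in> S \<Longrightarrow> rad_cong (h (f x)) (h (g x))" and mult: "\<And>x y. h (x * y) = h x * h y"
  shows "rad_cong (h (\<Prod>x\<in>S. f x)) (h (\<Prod>x\<in>S. g x))"
  using assms(1)
proof (induction S rule: infinite_finite_induct)
  case (insert x S)
  then have "rad_cong (h (f x) * h (\<Prod>x\<in>S. f x)) (h (g x) * h (\<Prod>x\<in>S. g x))"
    by (intro rad_cong_mult) blast+
  then show ?case using insert.hyps by (simp add: mult)
qed simp_all

lemma rad_cong_det_one:
  fixes h :: "'b::comm_ring_1 \<Rightarrow> 'a::ring_1"
  assumes hom: "h 1 = 1" "\<And>x y. h (x + y) = h x + h y" "\<And>x y. h (x * y) = h x * h y"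
    and C: "C \<in> carrier_mat n n"
    and cong: "\<And>i j. i < n \<Longrightarrow> j < n \<Longrightarrow> rad_cong (h (C $$ (i, j))) (if i = j then 1 else 0)"
  shows "rad_cong (h (det C)) 1"
proof -
  have h0: "h 0 = 0" using hom(2)[of 0 0] by simp
  have hsum: "h (\<Sum>x\<in>S. f x) = (\<Sum>x\<in>S. h (f x))" for S :: "(nat \<Rightarrow> nat) set" and f
    by (induction S rule: infinite_finite_induct) (auto simp: h0 hom)
  have "rad_cong (h (det C)) (h (det (1\<^sub>m n)))"
    unfolding det_def'[OF C] det_def'[OF one_carrier_mat] hsum hom(3)
  proof (intro rad_cong_sum rad_cong_mult rad_cong_prod[where h = h] hom(3) rad_cong_refl)
    fix p i assume "p \<in> {p. p permutes {0..<n}}" "i \<in> {0..<n}"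
    then have "i < n" "p i < n" using permutes_in_image[of p "{0..<n}" i] by simp_all
    then show "rad_cong (h (C $$ (i, p i))) (h (1\<^sub>m n $$ (i, p i)))"
      using cong[of i "p i"] by (auto simp: hom h0)
  qed
  then show ?thesis by (simp add: hom)
qed

lemma GL_fin_of_products:
  assumes M: "M \<in> carrier_mat n n" and N: "(N :: 'a::ring_1 mat) \<in> carrier_mat n n"
    and "M * N \<in> GL_fin n" "N * M \<in> GL_fin n"
  shows "M \<in> GL_fin n"
proof -
  obtain V W where V: "V \<in> carrier_mat n n" "M * N * V = 1\<^sub>m n" and W: "W \<in> carrier_mat n n" "W * (N * M) = 1\<^sub>m n"
    using assms(3,4) by (auto simp: GL_fin_iff)
  have 1: "M * (N * V) = 1\<^sub>m n" using V M N by (simp add: assoc_mult_mat[of _ n n _ n _ n])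
  have 2: "W * N * M = 1\<^sub>m n" using W M N by (simp add: assoc_mult_mat[of _ n n _ n _ n])
  have "W * N = W * N * (M * (N * V))" using mult_carrier_mat[OF W(1) N] by (simp only: 1 right_mult_one_mat)
  also have "\<dots> = (W * N * M) * (N * V)"
    by (rule assoc_mult_mat[symmetric, of _ n n _ n _ n]) (use V W M N in auto)
  also have "\<dots> = N * V" using mult_carrier_mat[OF N V(1)] by (simp only: 2 left_mult_one_mat)
  finally show ?thesis using 1 2 M N V by (auto simp: GL_fin_iff intro!: bexI[of _ "N * V"])
qed

text \<open>
If \<open>V\<close> inverts \<open>N\<close>, then \<open>M = N (1 + V (M - N))\<close>, and the second factor is congruent to \<open>1\<close>.
\<close>

lemma GL_fin_rad_cong:
  fixes M :: "'a::ring_1 mat"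
  assumes M: "M \<in> carrier_mat n n" and N: "N \<in> GL_fin n" "det_of_unit TYPE('k::idom) N"
    and cong: "\<And>i j. i < n \<Longrightarrow> j < n \<Longrightarrow> rad_cong (M $$ (i, j)) (N $$ (i, j))"
  shows "M \<in> GL_fin n" "det_of_unit TYPE('k) M"
proof -
  obtain V where Nc: "N \<in> carrier_mat n n" and V: "V \<in> carrier_mat n n" "N * V = 1\<^sub>m n"
    using N(1) by (auto simp: GL_fin_iff)
  define D where "D = M - N"
  have D: "D \<in> carrier_mat n n" and Dr: "\<And>i j. i < n \<Longrightarrow> j < n \<Longrightarrow> D $$ (i, j) \<in> jacobson_radical"
    using M Nc cong by (auto simp: D_def rad_cong_def)
  have "(V * D) $$ (i, j) \<in> jacobson_radical" if "i < n" "j < n" for i j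
    using V D Dr that by (auto simp: scalar_prod_def intro!: jacobson_sum jacobson_mult_left)
  then have *: "1\<^sub>m n + V * D \<in> GL_fin n \<and> det_of_unit TYPE('k) (1\<^sub>m n + V * D)"
    using V D by (intro det_of_unit_one_plus_jacobson) auto
  have "N * (1\<^sub>m n + V * D) = N + N * V * D"
    using Nc V(1) D by (simp add: mult_add_distrib_mat[of _ n n _ n] assoc_mult_mat[of _ n n _ n _ n])
  also have "N * V * D = D" by (simp only: V(2) left_mult_one_mat[OF D])
  also have "N + D = M" unfolding D_def using M Nc by (intro eq_matI) auto
  finally have eq: "M = N * (1\<^sub>m n + V * D)" ..
  show "M \<in> GL_fin n" "det_of_unit TYPE('k) M"
    unfolding eq using * N GL_fin_mult det_of_unit_mult[OF N(2), of _ n] Nc V D by auto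
qed

lemma one_plus_mult_one_plus:
  fixes A B :: "'c::ring_1 mat"
  assumes A: "A \<in> carrier_mat N N" and B: "B \<in> carrier_mat N N"
  shows "(1\<^sub>m N + A) * (1\<^sub>m N + B) = 1\<^sub>m N + (A + (B + A * B))"
proof -
  have "(1\<^sub>m N + A) * (1\<^sub>m N + B) = 1\<^sub>m N + A + (B + A * B)"
    using A B by (simp add: mult_add_distrib_mat[of _ N N _ N] add_mult_distrib_mat[of _ N N _ _ N])
  then show ?thesis using A B by (simp add: assoc_add_mat[of _ N N])
qed

lemma sum_delta_mult:
  fixes f :: "nat \<Rightarrow> 'c::ring_1"
  assumes "a < n"
  shows "(\<Sum>i\<in>{0..<n}. (if a = i then x else 0) * f i) = x * f a"
    "(\<Sum>i\<in>{0..<n}. f i * (if a = i then x else 0)) = f a * x"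
proof -
  have "(\<Sum>i\<in>{0..<n}. (if a = i then x else 0) * f i) = (\<Sum>i\<in>{0..<n}. if a = i then x * f i else 0)"
    by (intro sum.cong) auto
  then show "(\<Sum>i\<in>{0..<n}. (if a = i then x else 0) * f i) = x * f a"
    using assms by simp
  have "(\<Sum>i\<in>{0..<n}. f i * (if a = i then x else 0)) = (\<Sum>i\<in>{0..<n}. if a = i then f i * x else 0)"
    by (intro sum.cong) auto
  then show "(\<Sum>i\<in>{0..<n}. f i * (if a = i then x else 0)) = f a * x"
    using assms by simp
qed

text \<open>
Here \<open>e t\<close> stands for a lift of an idempotent of the ring modulo its radical, one from each isomorphism
class of minimal idempotents. Each corner is then commutative modulo the radical.
The homomorphism \<open>ev t\<close> lifts this commutative ring to a commutative subring; subrings for different \<open>t\<close> need not commute with each other.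
\<close>

locale basic_set =
  fixes E :: "'e set" and e :: "'e \<Rightarrow> 'a::ring_1" and ev :: "'e \<Rightarrow> 'b::idom \<Rightarrow> 'a"
  assumes finite_E: "finite E"
    and ev_one: "t \<in> E \<Longrightarrow> ev t 1 = 1"
    and ev_add: "t \<in> E \<Longrightarrow> ev t (x + y) = ev t x + ev t y"
    and ev_mult: "t \<in> E \<Longrightarrow> ev t (x * y) = ev t x * ev t y"
    and orth: "t \<in> E \<Longrightarrow> t' \<in> E \<Longrightarrow> t \<noteq> t' \<Longrightarrow> rad_cong (e t * a * e t') 0"
    and diag: "t \<in> E \<Longrightarrow> \<exists>q. rad_cong (ev t q) (e t * a * e t)"
begin

lemma ev_zero: "t \<in> E \<Longrightarrow> ev t 0 = 0"
  using ev_add[of t 0 0] by simp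

lemma ev_sum: "t \<in> E \<Longrightarrow> ev t (\<Sum>x\<in>S. f x) = (\<Sum>x\<in>S. ev t (f x))"
  by (induction S rule: infinite_finite_induct) (auto simp: ev_zero ev_add)

lemma map_mat_ev_mult:
  "t \<in> E \<Longrightarrow> A \<in> carrier_mat n n \<Longrightarrow> B \<in> carrier_mat n n
    \<Longrightarrow> map_mat (ev t) (A * B) = map_mat (ev t) A * map_mat (ev t) B"
  by (intro eq_matI) (auto simp: scalar_prod_def ev_sum ev_mult)

lemma det_of_unit_map_ev:
  assumes t: "t \<in> E" and char0: "inj (of_nat :: nat \<Rightarrow> 'k::field)"
    and Q: "Q \<in> carrier_mat n n" and u: "ev t (det Q) \<in> units"
  shows "det_of_unit TYPE('k) (map_mat (ev t) Q)"
  unfolding det_of_unit_def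
proof (intro bexI[OF _ u] allI impI)
  fix m and \<phi> :: "'a \<Rightarrow> 'k mat"
  assume "matrix_hom m \<phi>"
  then interpret matrix_hom m \<phi> .
  have hom: "matrix_hom m (\<lambda>q. \<phi> (ev t q))"
    by unfold_locales (simp_all add: t ev_one ev_add ev_mult one add mult)
  have "blk (map_mat (ev t) Q) = block_matrix m (\<lambda>q. \<phi> (ev t q)) Q"
    by (rule eq_matI) (simp_all add: block_matrix_def div_mod_bounds)
  then show "det (blk (map_mat (ev t) Q)) = det (\<phi> (ev t (det Q)))"
    using det_block_matrix_commutative[OF hom char0 Q] by simp
qed

text \<open>
Modulo the radical, \<open>Z\<close> is block diagonal and thus the product over \<open>t\<close> of the matrices that agree
with \<open>Z\<close> on the block of \<open>t\<close> and with the identity elsewhere. Each factor lifts to a matrix with entries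
in the commutative ring of \<open>ev t\<close>, where its determinant can be formed. This determinant is a unit, as
the same construction applied to \<open>Z'\<close> gives an inverse modulo the radical.
\<close>

lemma det_of_unit_block_diagonal:
  assumes char0: "inj (of_nat :: nat \<Rightarrow> 'k::field)"
    and T: "\<And>i. i < n \<Longrightarrow> T i \<in> E"
    and Z: "Z \<in> carrier_mat n n" and Z': "Z' \<in> carrier_mat n n"
    and inv: "Z * Z' = 1\<^sub>m n" "Z' * Z = 1\<^sub>m n"
    and form: "\<And>i j. i < n \<Longrightarrow> j < n \<Longrightarrow> \<exists>a. Z $$ (i, j) = 1\<^sub>m n $$ (i, j) + e (T i) * a * e (T j)"
    and form': "\<And>i j. i < n \<Longrightarrow> j < n \<Longrightarrow> \<exists>a. Z' $$ (i, j) = 1\<^sub>m n $$ (i, j) + e (T i) * a * e (T j)"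
  shows "det_of_unit TYPE('k) Z"
proof -
  \<comment> \<open>\<open>restr M S\<close> agrees with \<open>M\<close> on the diagonal blocks labelled by \<open>S\<close> and with the identity
    elsewhere.\<close>
  define restr where "restr M S i j = (if T i = T j \<and> T i \<in> S then M $$ (i, j) else 1\<^sub>m n $$ (i, j))"
    for M :: "'a mat" and S i j
  have lift: "\<exists>Q. Q \<in> carrier_mat n n \<and> (\<forall>i<n. \<forall>j<n. rad_cong (ev t (Q $$ (i, j))) (restr M {t} i j))"
    if t: "t \<in> E" and M: "\<And>i j. i < n \<Longrightarrow> j < n \<Longrightarrow> \<exists>a. M $$ (i, j) = 1\<^sub>m n $$ (i, j) + e (T i) * a * e (T j)"
    for t and M :: "'a mat"
  proof -
    have "\<exists>q. rad_cong (ev t q) (restr M {t} i j)" if ij: "i < n" "j < n" for i j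
    proof (cases "T i = t \<and> T j = t")
      case True
      obtain a where a: "M $$ (i, j) = 1\<^sub>m n $$ (i, j) + e t * a * e t" using M[OF ij] True by auto
      obtain q where q: "rad_cong (ev t q) (e t * a * e t)" using diag[OF t] by blast
      have "rad_cong (ev t ((if i = j then 1 else 0) + q)) (M $$ (i, j))"
        unfolding a using ij q t by (auto simp: ev_add ev_one ev_zero intro: rad_cong_add)
      then show ?thesis using True by (auto simp: restr_def)
    next
      case False
      then have "restr M {t} i j = ev t (if i = j then 1 else 0)"
        using ij t by (auto simp: restr_def ev_one ev_zero)
      then show ?thesis by (metis rad_cong_refl)
    qed
    then obtain q where "\<And>i j. i < n \<Longrightarrow> j < n \<Longrightarrow> rad_cong (ev t (q i j)) (restr M {t} i j)" by metis
    then show ?thesis by (intro exI[of _ "mat n n (\<lambda>(i, j). q i j)"]) auto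
  qed
  have off: "rad_cong (M $$ (i, j)) 0"
    if "i < n" "j < n" "T i \<noteq> T j" "\<exists>a. M $$ (i, j) = 1\<^sub>m n $$ (i, j) + e (T i) * a * e (T j)"
    for M :: "'a mat" and i j
    using that orth[OF T T, of i j] by auto
  have restr_mult: "rad_cong (\<Sum>k\<in>{0..<n}. restr M {t} i k * restr M' {t} k j) (1\<^sub>m n $$ (i, j))"
    if ij: "i < n" "j < n" and MM': "M \<in> carrier_mat n n" "M' \<in> carrier_mat n n" "M * M' = 1\<^sub>m n"
      and M: "\<And>i j. i < n \<Longrightarrow> j < n \<Longrightarrow> \<exists>a. M $$ (i, j) = 1\<^sub>m n $$ (i, j) + e (T i) * a * e (T j)"
    for M M' :: "'a mat" and t i j
  proof -
    consider "T i \<noteq> t" | "T i = t" "T j \<noteq> t" | "T i = t" "T j = t" by blast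
    then show ?thesis
    proof cases
      case 1
      then have "(\<Sum>k\<in>{0..<n}. restr M {t} i k * restr M' {t} k j)
               = (\<Sum>k\<in>{0..<n}. if k = i then restr M' {t} i j else 0)"
        using ij by (intro sum.cong) (auto simp: restr_def)
      then show ?thesis using 1 ij by (simp add: restr_def)
    next
      case 2
      then have "(\<Sum>k\<in>{0..<n}. restr M {t} i k * restr M' {t} k j)
               = (\<Sum>k\<in>{0..<n}. if k = j then restr M {t} i j else 0)"
        using ij by (intro sum.cong) (auto simp: restr_def)
      then show ?thesis using 2 ij by (simp add: restr_def)
    next
      case 3
      have "rad_cong (restr M {t} i k * restr M' {t} k j) (M $$ (i, k) * M' $$ (k, j))" if "k < n" for k
      proof (cases "T k = t")
        case True
        then show ?thesis using 3 by (simp add: restr_def)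
      next
        case False
        then have "restr M {t} i k = 0" using 3 ij that by (auto simp: restr_def)
        moreover have "rad_cong (M $$ (i, k) * M' $$ (k, j)) (0 * M' $$ (k, j))"
          using off[OF ij(1) that _ M[OF ij(1) that]] 3 False by (intro rad_cong_mult) auto
        ultimately show ?thesis by (simp add: rad_cong_sym)
      qed
      then have "rad_cong (\<Sum>k\<in>{0..<n}. restr M {t} i k * restr M' {t} k j) ((M * M') $$ (i, j))"
        using ij MM'(1,2) by (auto simp: scalar_prod_def intro!: rad_cong_sum)
      then show ?thesis by (simp add: MM'(3))
    qed
  qed
  define Q where "Q t = (SOME Q. Q \<in> carrier_mat n n \<and> (\<forall>i<n. \<forall>j<n. rad_cong (ev t (Q $$ (i, j))) (restr Z {t} i j)))" for t
  have Q: "Q t \<in> carrier_mat n n" "i < n \<Longrightarrow> j < n \<Longrightarrow> rad_cong (ev t (Q t $$ (i, j))) (restr Z {t} i j)"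
    if "t \<in> E" for t i j
    using someI_ex[OF lift[OF that form]] unfolding Q_def by auto
  have Q_GL: "map_mat (ev t) (Q t) \<in> GL_fin n \<and> det_of_unit TYPE('k) (map_mat (ev t) (Q t))" if t: "t \<in> E" for t
  proof -
    obtain Q' where Q': "Q' \<in> carrier_mat n n" "\<And>i j. i < n \<Longrightarrow> j < n \<Longrightarrow> rad_cong (ev t (Q' $$ (i, j))) (restr Z' {t} i j)"
      using lift[OF t form'] by blast
    let ?B = "map_mat (ev t) (Q t)" and ?B' = "map_mat (ev t) Q'"
    have B: "?B \<in> carrier_mat n n" "?B' \<in> carrier_mat n n" using Q(1)[OF t] Q'(1) by auto
    have BB': "rad_cong ((?B * ?B') $$ (i, j)) (1\<^sub>m n $$ (i, j))" if "i < n" "j < n" for i j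
    proof -
      have "rad_cong ((?B * ?B') $$ (i, j)) (\<Sum>k\<in>{0..<n}. restr Z {t} i k * restr Z' {t} k j)"
        using B Q[OF t] Q' that by (auto simp: scalar_prod_def intro!: rad_cong_sum rad_cong_mult)
      then show ?thesis using restr_mult[OF that Z Z' inv(1) form] by (rule rad_cong_trans)
    qed
    have B'B: "rad_cong ((?B' * ?B) $$ (i, j)) (1\<^sub>m n $$ (i, j))" if "i < n" "j < n" for i j
    proof -
      have "rad_cong ((?B' * ?B) $$ (i, j)) (\<Sum>k\<in>{0..<n}. restr Z' {t} i k * restr Z {t} k j)"
        using B Q[OF t] Q' that by (auto simp: scalar_prod_def intro!: rad_cong_sum rad_cong_mult)
      then show ?thesis using restr_mult[OF that Z' Z inv(2) form'] by (rule rad_cong_trans)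
    qed
    have one: "1\<^sub>m n \<in> (GL_fin n :: 'a mat set)" "det_of_unit TYPE('k) (1\<^sub>m n :: 'a mat)"
      using det_of_unit_one_plus_jacobson[of "0\<^sub>m n n" n, where 'k = 'k] by (auto simp: jacobson_zero)
    have "?B * ?B' \<in> GL_fin n" "?B' * ?B \<in> GL_fin n"
      using B BB' B'B by (intro GL_fin_rad_cong(1)[OF _ one]; simp)+
    then have GL: "?B \<in> GL_fin n" by (rule GL_fin_of_products[OF B])
    have "rad_cong (ev t (det (Q t * Q'))) 1"
    proof (rule rad_cong_det_one)
      fix i j assume ij: "i < n" "j < n"
      have "map_mat (ev t) (Q t * Q') $$ (i, j) = (?B * ?B') $$ (i, j)"
        using map_mat_ev_mult[OF t Q(1)[OF t] Q'(1)] by simp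
      then show "rad_cong (ev t ((Q t * Q') $$ (i, j))) (if i = j then 1 else 0)"
        using BB'[OF ij] ij Q(1)[OF t] Q'(1) by simp
    qed (use t Q(1)[OF t] Q'(1) in \<open>auto simp: ev_one ev_add ev_mult\<close>)
    then have "rad_cong (ev t (det (Q t)) * ev t (det Q')) 1"
      using t Q(1)[OF t] Q'(1) by (simp add: det_mult[of _ n] ev_mult)
    moreover have "ev t (det (Q t)) * ev t (det Q') = ev t (det Q') * ev t (det (Q t))"
      using t by (simp add: ev_mult[symmetric] mult.commute)
    ultimately have "ev t (det (Q t)) \<in> units"
      by (intro unit_mod_jacobson[of _ "ev t (det Q')"]) (simp_all add: rad_cong_def)
    then show ?thesis using GL det_of_unit_map_ev[OF t char0 Q(1)[OF t]] by blast
  qed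
  have "\<exists>W. W \<in> GL_fin n \<and> det_of_unit TYPE('k) W \<and> (\<forall>i<n. \<forall>j<n. rad_cong (W $$ (i, j)) (restr Z S i j))"
    if "S \<subseteq> E" for S
    using finite_subset[OF that finite_E] that
  proof (induction S rule: finite_induct)
    case empty
    have "1\<^sub>m n \<in> (GL_fin n :: 'a mat set)" "det_of_unit TYPE('k) (1\<^sub>m n :: 'a mat)"
      using det_of_unit_one_plus_jacobson[of "0\<^sub>m n n" n, where 'k = 'k] by (auto simp: jacobson_zero)
    then show ?case by (intro exI[of _ "1\<^sub>m n"]) (auto simp: restr_def)
  next
    case (insert t S)
    have t: "t \<in> E" and "S \<subseteq> E" using insert.prems by auto
    from insert.IH[OF this(2)] obtain W where "W \<in> GL_fin n \<and> det_of_unit TYPE('k) W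
      \<and> (\<forall>i<n. \<forall>j<n. rad_cong (W $$ (i, j)) (restr Z S i j))" by (rule exE)
    then have W: "W \<in> GL_fin n" "det_of_unit TYPE('k) W"
      "\<And>i j. i < n \<Longrightarrow> j < n \<Longrightarrow> rad_cong (W $$ (i, j)) (restr Z S i j)" by simp_all
    let ?B = "map_mat (ev t) (Q t)"
    have car: "?B \<in> carrier_mat n n" "W \<in> carrier_mat n n" using Q(1)[OF t] W(1) by (auto simp: GL_fin_iff)
    have "rad_cong ((?B * W) $$ (i, j)) (restr Z (insert t S) i j)" if ij: "i < n" "j < n" for i j
    proof -
      have "rad_cong ((?B * W) $$ (i, j)) (\<Sum>k\<in>{0..<n}. restr Z {t} i k * restr Z S k j)"
        using car Q[OF t] W(3) that by (auto simp: scalar_prod_def intro!: rad_cong_sum rad_cong_mult)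
      also have "(\<Sum>k\<in>{0..<n}. restr Z {t} i k * restr Z S k j) = restr Z (insert t S) i j"
      proof (cases "T i = t")
        case True
        then have "(\<Sum>k\<in>{0..<n}. restr Z {t} i k * restr Z S k j)
                 = (\<Sum>k\<in>{0..<n}. if k = j then restr Z {t} i j else 0)"
          using ij insert.hyps by (intro sum.cong) (auto simp: restr_def)
        then show ?thesis using True ij by (simp add: restr_def)
      next
        case False
        then have "(\<Sum>k\<in>{0..<n}. restr Z {t} i k * restr Z S k j)
                 = (\<Sum>k\<in>{0..<n}. if k = i then restr Z S i j else 0)"
          using ij by (intro sum.cong) (auto simp: restr_def)
        then show ?thesis using False ij by (simp add: restr_def)
      qed
      finally show ?thesis .
    qed
    then show ?case
      using GL_fin_mult[OF conjunct1[OF Q_GL[OF t]] W(1)]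
        det_of_unit_mult[OF conjunct2[OF Q_GL[OF t]] W(2) car]
      by (intro exI[of _ "?B * W"] conjI allI impI)
  qed
  from this[OF subset_refl] obtain W where "W \<in> GL_fin n \<and> det_of_unit TYPE('k) W
      \<and> (\<forall>i<n. \<forall>j<n. rad_cong (W $$ (i, j)) (restr Z E i j))" by (rule exE)
  then have W: "W \<in> GL_fin n" "det_of_unit TYPE('k) W"
    "\<And>i j. i < n \<Longrightarrow> j < n \<Longrightarrow> rad_cong (W $$ (i, j)) (restr Z E i j)" by simp_all
  have "rad_cong (Z $$ (i, j)) (W $$ (i, j))" if ij: "i < n" "j < n" for i j
  proof -
    have "rad_cong (Z $$ (i, j)) (restr Z E i j)"
    proof (cases "T i = T j")
      case True
      have "T i = T j \<and> T i \<in> E" using True T[OF ij(1)] by (rule conjI)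
      then have "restr Z E i j = Z $$ (i, j)" unfolding restr_def by (rule if_P)
      then show ?thesis by (simp only: rad_cong_refl)
    next
      case False
      then have "i \<noteq> j" by auto
      then have "restr Z E i j = 0" using False ij by (simp add: restr_def)
      then show ?thesis using off[OF ij False form[OF ij]] by simp
    qed
    then show ?thesis by (rule rad_cong_trans[OF _ rad_cong_sym[OF W(3)[OF ij]]])
  qed
  then show ?thesis by (rule GL_fin_rad_cong(2)[OF Z W(1,2)])
qed

text \<open>
Morita equivalence on the level of determinants: the hypothesis \<open>full\<close> provides matrices with
\<open>P Q = 1\<close>, and Sylvester's identity replaces \<open>M = 1 + (M - 1) P Q\<close> by \<open>1 + Q (M - 1) P\<close>, which has the
form required for block diagonality. The inverse of \<open>M\<close> is transformed in the same way.
\<close>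

lemma det_of_unit_GL:
  fixes k :: nat
  assumes char0: "inj (of_nat :: nat \<Rightarrow> 'k::field)"
    and \<tau>: "\<And>j. j < k \<Longrightarrow> \<tau> j \<in> E"
    and full: "rad_cong (\<Sum>j\<in>{0..<k}. r j * e (\<tau> j) * (e (\<tau> j) * s j)) 1"
    and M: "(M :: 'a mat) \<in> GL_fin n"
  shows "det_of_unit TYPE('k) M"
proof -
  let ?I = "1\<^sub>m (n * k) :: 'a mat"
  obtain M' where Mc: "M \<in> carrier_mat n n" and M': "M' \<in> carrier_mat n n" "M * M' = 1\<^sub>m n" "M' * M = 1\<^sub>m n"
    using M by (auto simp: GL_fin_iff)
  define u where "u = (\<Sum>j\<in>{0..<k}. r j * e (\<tau> j) * (e (\<tau> j) * s j))"
  have "1 + (u - 1) \<in> units"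
    by (rule jacobson_one_plus) (use full in \<open>simp add: rad_cong_def u_def\<close>)
  then obtain w where w: "w * u = 1" by (auto simp: units_iff)
  define R where "R j = w * (r j * e (\<tau> j))" for j
  define S where "S j = e (\<tau> j) * s j" for j
  have "(\<Sum>j\<in>{0..<k}. R j * S j) = w * u"
    unfolding u_def sum_distrib_left by (intro sum.cong) (auto simp: R_def S_def mult.assoc)
  then have RS: "(\<Sum>j\<in>{0..<k}. R j * S j) = 1" by (simp add: w)
  \<comment> \<open>\<open>P\<close> and \<open>Q\<close> are the tensor products of the identity of size \<open>n\<close> with the row of the \<open>R j\<close> and
    the column of the \<open>S j\<close>; the index \<open>c\<close> stands for the pair \<open>(c div k, c mod k)\<close>.\<close>
  define P where "P = mat n (n * k) (\<lambda>(i, c). if c div k = i then R (c mod k) else 0)"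
  define Q where "Q = mat (n * k) n (\<lambda>(c, i). if c div k = i then S (c mod k) else 0)"
  have P: "P \<in> carrier_mat n (n * k)" and Q: "Q \<in> carrier_mat (n * k) n" by (simp_all add: P_def Q_def)
  have PQ: "P * Q = 1\<^sub>m n"
  proof (rule eq_matI)
    fix i j assume ij: "i < dim_row (1\<^sub>m n :: 'a mat)" "j < dim_col (1\<^sub>m n :: 'a mat)"
    have "(P * Q) $$ (i, j) = (\<Sum>c\<in>{0..<n * k}. (if c div k = i then R (c mod k) else 0) * (if c div k = j then S (c mod k) else 0))"
      using ij by (simp add: P_def Q_def scalar_prod_def)
    also have "\<dots> = (\<Sum>a\<in>{0..<n}. \<Sum>b\<in>{0..<k}. (if a = i then R b else 0) * (if a = j then S b else 0))"
      by (rule sum_div_mod)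
    also have "\<dots> = (\<Sum>a\<in>{0..<n}. if a = i then (if i = j then 1 else 0) else 0)"
      by (intro sum.cong) (auto simp: RS)
    finally show "(P * Q) $$ (i, j) = 1\<^sub>m n $$ (i, j)" using ij by simp
  qed (simp_all add: P_def Q_def)
  define T where "T c = \<tau> (c mod k)" for c
  have T: "T c \<in> E" if "c < n * k" for c
    using \<tau> div_mod_bounds(2)[OF that] by (simp add: T_def)
  have form: "\<exists>a. (?I + Q * W * P) $$ (c, d) = ?I $$ (c, d) + e (T c) * a * e (T d)"
    if W: "W \<in> carrier_mat n n" and cd: "c < n * k" "d < n * k" for W c d
  proof -
    have QW: "(Q * W) $$ (c, j) = S (c mod k) * W $$ (c div k, j)" if "j < n" for j
      using W cd that div_mod_bounds(1)[OF cd(1)] by (simp add: Q_def scalar_prod_def sum_delta_mult)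
    have "(Q * W * P) $$ (c, d) = (\<Sum>j\<in>{0..<n}. (Q * W) $$ (c, j) * (if d div k = j then R (d mod k) else 0))"
      using W Q cd by (simp add: P_def scalar_prod_def del: assoc_mult_mat)
    also have "\<dots> = (Q * W) $$ (c, d div k) * R (d mod k)"
      using div_mod_bounds(1)[OF cd(2)] by (simp only: sum_delta_mult)
    also have "\<dots> = S (c mod k) * W $$ (c div k, d div k) * R (d mod k)"
      using div_mod_bounds(1)[OF cd(2)] by (simp only: QW)
    also have "\<dots> = e (T c) * (s (c mod k) * W $$ (c div k, d div k) * w * r (d mod k)) * e (T d)"
      by (simp add: S_def R_def T_def mult.assoc)
    finally have "(Q * W * P) $$ (c, d) = e (T c) * (s (c mod k) * W $$ (c div k, d div k) * w * r (d mod k)) * e (T d)" .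
    moreover have "(?I + Q * W * P) $$ (c, d) = ?I $$ (c, d) + (Q * W * P) $$ (c, d)"
      using cd P Q W by (intro index_add_mat(1)) auto
    ultimately show ?thesis by auto
  qed
  have mult: "(?I + Q * A * P) * (?I + Q * B * P) = ?I"
    if A: "A \<in> carrier_mat n n" and B: "B \<in> carrier_mat n n" and AB: "(1\<^sub>m n + A) * (1\<^sub>m n + B) = 1\<^sub>m n" for A B :: "'a mat"
  proof -
    have QBP: "Q * B * P \<in> carrier_mat (n * k) (n * k)" "Q * A * P \<in> carrier_mat (n * k) (n * k)"
      "A * B \<in> carrier_mat n n" "Q * (A * B) * P \<in> carrier_mat (n * k) (n * k)"
      "Q * A \<in> carrier_mat (n * k) n" "Q * B \<in> carrier_mat (n * k) n" "B * P \<in> carrier_mat n (n * k)"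
      "Q * (A * B) \<in> carrier_mat (n * k) n"
      using A B P Q by auto
    have "Q * A * P * (Q * B * P) = Q * A * P * (Q * (B * P))"
      by (simp only: assoc_mult_mat[OF Q B P])
    also have "\<dots> = Q * A * (P * (Q * (B * P)))"
      by (rule assoc_mult_mat[OF QBP(5) P]) (use Q QBP(7) in auto)
    also have "P * (Q * (B * P)) = B * P"
      using assoc_mult_mat[OF P Q QBP(7)] left_mult_one_mat[OF QBP(7)] by (simp only: PQ)
    also have "Q * A * (B * P) = Q * (A * B) * P"
      using assoc_mult_mat[OF QBP(5) B P] assoc_mult_mat[OF Q A B] by (simp only:)
    finally have *: "Q * A * P * (Q * B * P) = Q * (A * B) * P" .
    have 1: "1\<^sub>m n + (A + (B + A * B)) = 1\<^sub>m n"
      using one_plus_mult_one_plus[OF A B] AB by simp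
    have "A + H = 0\<^sub>m n n" if H: "H \<in> carrier_mat n n" and eq: "1\<^sub>m n + (A + H) = 1\<^sub>m n" for H
    proof (rule eq_matI)
      fix i j assume ij: "i < dim_row (0\<^sub>m n n :: 'a mat)" "j < dim_col (0\<^sub>m n n :: 'a mat)"
      have "(1\<^sub>m n + (A + H)) $$ (i, j) = 1\<^sub>m n $$ (i, j)" by (simp only: eq)
      then show "(A + H) $$ (i, j) = 0\<^sub>m n n $$ (i, j)" using ij A H by (auto simp: add.assoc)
    qed (use A H in auto)
    from this[OF _ 1] have 0: "A + (B + A * B) = 0\<^sub>m n n"
      using add_carrier_mat[OF QBP(3), of B] by blast
    have "(?I + Q * A * P) * (?I + Q * B * P)
        = ?I + (Q * A * P + (Q * B * P + Q * (A * B) * P))"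
      using one_plus_mult_one_plus[OF QBP(2,1)] by (simp only: *)
    also have "Q * A * P + (Q * B * P + Q * (A * B) * P) = Q * A * P + (Q * B + Q * (A * B)) * P"
      by (simp only: add_mult_distrib_mat[OF QBP(6,8) P])
    also have "\<dots> = (Q * A + (Q * B + Q * (A * B))) * P"
      using add_mult_distrib_mat[OF QBP(5) _ P, of "Q * B + Q * (A * B)"] QBP(8) by simp
    also have "\<dots> = Q * (A + (B + A * B)) * P"
      using mult_add_distrib_mat[OF Q B QBP(3)] mult_add_distrib_mat[OF Q A, of "B + A * B"] QBP(3) by simp
    also have "\<dots> = 0\<^sub>m (n * k) (n * k)" unfolding 0 using P Q by simp
    finally show ?thesis by simp
  qed
  define A where "A = M - 1\<^sub>m n"
  define B where "B = M' - 1\<^sub>m n"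
  have AB: "A \<in> carrier_mat n n" "B \<in> carrier_mat n n" "1\<^sub>m n + A = M" "1\<^sub>m n + B = M'"
    using Mc M'(1) by (auto simp: A_def B_def)
  have car: "?I + Q * W * P \<in> carrier_mat (n * k) (n * k)" if "W \<in> carrier_mat n n" for W
    using P Q that by auto
  have "det_of_unit TYPE('k) (?I + Q * A * P)"
    by (rule det_of_unit_block_diagonal[OF char0 T car[OF AB(1)] car[OF AB(2)] mult mult form form])
      (use AB M' in auto)
  moreover have "det (block_matrix m \<phi> (?I + Q * A * P)) = det (block_matrix m \<phi> M)"
    if "matrix_hom m \<phi>" for m and \<phi> :: "'a \<Rightarrow> 'k mat"
  proof -
    interpret matrix_hom m \<phi> by fact
    have "A * P \<in> carrier_mat n (n * k)" using AB(1) P by simp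
    moreover have "Q * A * P = Q * (A * P)"
      by (rule assoc_mult_mat[OF Q AB(1) P])
    moreover have "A * P * Q = A"
      using Q P AB(1) PQ by (simp add: assoc_mult_mat[of _ n n _ "n * k" _ n])
    ultimately show ?thesis using det_blk_commute[of "A * P" n "n * k" Q] Q AB(3) by simp
  qed
  ultimately show ?thesis unfolding det_of_unit_def by metis
qed

end

section \<open>Minimal idempotents of finite semiprime rings\<close>

locale finite_semiprime_ring = ring R for R (structure) +
  assumes finite_carrier: "finite (carrier R)"
    and semiprime: "\<lbrakk>x \<in> carrier R; \<And>y. y \<in> carrier R \<Longrightarrow> x \<otimes> y \<otimes> x = \<zero>\<rbrakk> \<Longrightarrow> x = \<zero>"
begin

definition right_ideal_of :: "'a \<Rightarrow> 'a set" where
  "right_ideal_of x = (\<lambda>y. x \<otimes> y) ` carrier R"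

definition minimal_idempotent :: "'a \<Rightarrow> bool" where
  "minimal_idempotent f \<longleftrightarrow> f \<in> carrier R \<and> f \<noteq> \<zero> \<and> f \<otimes> f = f \<and>
     (\<forall>y\<in>carrier R. f \<otimes> y \<noteq> \<zero> \<longrightarrow> (\<exists>v\<in>carrier R. f \<otimes> y \<otimes> v = f))"

lemma minimal_idempotentD:
  assumes "minimal_idempotent f"
  shows "f \<in> carrier R" "f \<noteq> \<zero>" "f \<otimes> f = f"
    "y \<in> carrier R \<Longrightarrow> f \<otimes> y \<noteq> \<zero> \<Longrightarrow> \<exists>v\<in>carrier R. f \<otimes> y \<otimes> v = f"
  using assms by (auto simp: minimal_idempotent_def)

text \<open>
Brauer's lemma. Let \<open>xR\<close> be a minimal right ideal inside \<open>gR\<close>. As the ring is semiprime, there is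
\<open>z = x y\<close> with \<open>z x \<noteq> 0\<close>, and \<open>z x R = xR\<close> by minimality. Hence some \<open>f\<close> in \<open>xR\<close> satisfies \<open>z f = z\<close>. Then
\<open>z (f f - f) = 0\<close>, and since multiplication by \<open>z\<close> does not annihilate \<open>x\<close>, minimality forces
\<open>f f = f\<close>.
\<close>

lemma ex_minimal_idempotent:
  assumes g: "g \<in> carrier R" "g \<noteq> \<zero>"
  shows "\<exists>f. minimal_idempotent f \<and> (\<exists>x\<in>carrier R. f = g \<otimes> x)"
proof -
  \<comment> \<open>Among the nonzero \<open>x\<close> in \<open>gR\<close> choose one whose right ideal has the fewest elements.\<close>
  define P where "P x \<longleftrightarrow> x \<noteq> \<zero> \<and> (\<exists>a\<in>carrier R. x = g \<otimes> a)" for x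
  have "P g" using g by (auto simp: P_def intro!: bexI[of _ \<one>])
  then obtain x where x: "P x" and least: "\<And>y. P y \<Longrightarrow> card (right_ideal_of x) \<le> card (right_ideal_of y)"
    using ex_has_least_nat[of P g "\<lambda>x. card (right_ideal_of x)"] by blast
  obtain a where a: "a \<in> carrier R" "x = g \<otimes> a" and x0: "x \<noteq> \<zero>" using x by (auto simp: P_def)
  have xc [simp]: "x \<in> carrier R" using a g by simp
  have minimal: "right_ideal_of y = right_ideal_of x" if y: "y \<in> right_ideal_of x" "y \<noteq> \<zero>" for y
  proof -
    obtain b where b: "b \<in> carrier R" "y = x \<otimes> b" using y by (auto simp: right_ideal_of_def)
    then have "P y" using y a g by (auto simp: P_def m_assoc intro!: bexI[of _ "a \<otimes> b"])
    moreover have "right_ideal_of y \<subseteq> right_ideal_of x"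
      using b by (auto simp: right_ideal_of_def m_assoc)
    moreover have "finite (right_ideal_of x)" using finite_carrier by (simp add: right_ideal_of_def)
    ultimately show ?thesis using least card_seteq by blast
  qed
  obtain y where y: "y \<in> carrier R" "x \<otimes> y \<otimes> x \<noteq> \<zero>" using semiprime[OF xc] x0 by blast
  define z where "z = x \<otimes> y"
  have z: "z \<in> carrier R" "z \<in> right_ideal_of x" using y by (auto simp: z_def right_ideal_of_def)
  have "z \<otimes> x \<in> right_ideal_of x" using y by (auto simp: z_def right_ideal_of_def m_assoc)
  then have "right_ideal_of (z \<otimes> x) = right_ideal_of x" using y by (intro minimal) (auto simp: z_def)
  then obtain w where w: "w \<in> carrier R" "z = z \<otimes> x \<otimes> w" using z by (auto simp: right_ideal_of_def)
  define f where "f = x \<otimes> w"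
  have f: "f \<in> carrier R" "f \<in> right_ideal_of x" using w by (auto simp: f_def right_ideal_of_def)
  have zf: "z \<otimes> f = z" using w z by (simp add: f_def m_assoc)
  have f0: "f \<noteq> \<zero>"
  proof
    assume "f = \<zero>"
    then have "z = \<zero>" using zf z by simp
    then show False using y by (simp add: z_def[symmetric])
  qed
  define d where "d = f \<otimes> f \<ominus> f"
  have dc: "d \<in> carrier R" using f by (simp add: d_def)
  have zd: "z \<otimes> d = \<zero>"
    using z f by (simp add: d_def a_minus_def r_distr r_minus m_assoc[symmetric] zf r_neg)
  have "d = x \<otimes> (w \<otimes> f \<ominus> w)" using w f by (simp add: d_def f_def a_minus_def r_distr r_minus m_assoc)
  then have dr: "d \<in> right_ideal_of x" using w f by (auto simp: right_ideal_of_def)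
  have "d = \<zero>"
  proof (rule ccontr)
    assume "d \<noteq> \<zero>"
    then have "right_ideal_of d = right_ideal_of x" by (rule minimal[OF dr])
    moreover have "x \<in> right_ideal_of x" unfolding right_ideal_of_def by (rule image_eqI[of _ _ \<one>]) auto
    ultimately obtain v where v: "v \<in> carrier R" "x = d \<otimes> v" by (auto simp: right_ideal_of_def)
    have "z \<otimes> x = z \<otimes> d \<otimes> v" using v z dc by (simp add: m_assoc)
    then show False using zd v y by (simp add: z_def)
  qed
  then have ff: "f \<otimes> f = f" using f by (simp add: d_def)
  have "\<exists>v\<in>carrier R. f \<otimes> y \<otimes> v = f" if y: "y \<in> carrier R" "f \<otimes> y \<noteq> \<zero>" for y
  proof -
    have "f \<otimes> y \<in> right_ideal_of x" using y w by (auto simp: f_def right_ideal_of_def m_assoc)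
    then have "right_ideal_of (f \<otimes> y) = right_ideal_of x" using y by (intro minimal)
    then have "f \<in> right_ideal_of (f \<otimes> y)" using f by simp
    then show ?thesis unfolding right_ideal_of_def by (elim imageE) metis
  qed
  then have "minimal_idempotent f" using f f0 ff by (auto simp: minimal_idempotent_def)
  moreover have "f = g \<otimes> (a \<otimes> w)" using a g w by (simp add: f_def m_assoc)
  ultimately show ?thesis using a w by blast
qed

text \<open>
Let \<open>z\<close> be an idempotent of \<open>S\<close> with the largest right ideal \<open>zR\<close>. If \<open>z \<noteq> 1\<close>, there is a minimal
idempotent \<open>f\<close> in \<open>(1 - z)R\<close>. Then \<open>f (1 - z)\<close> is an idempotent orthogonal to \<open>z\<close>, and adding it to \<open>z\<close>
enlarges the right ideal.
\<close>

lemma one_in_ideal_of_minimal_idempotents: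
  assumes S: "ideal S R" and min: "\<And>f. minimal_idempotent f \<Longrightarrow> f \<in> S"
  shows "\<one> \<in> S"
proof -
  interpret S: ideal S R by (rule S)
  have Sc: "\<And>s. s \<in> S \<Longrightarrow> s \<in> carrier R" using S.a_subset by blast
  define P where "P z \<longleftrightarrow> z \<in> S \<and> z \<otimes> z = z" for z
  have "card (right_ideal_of z) < Suc (card (carrier R))" if "P z" for z
    unfolding less_Suc_eq_le using that Sc
    by (intro card_mono finite_carrier) (auto simp: right_ideal_of_def P_def)
  moreover have "P \<zero>" by (simp add: P_def S.zero_closed)
  ultimately obtain z where z: "P z" and greatest: "\<And>y. P y \<Longrightarrow> card (right_ideal_of y) \<le> card (right_ideal_of z)"
    using ex_has_greatest_nat[of P \<zero> "\<lambda>x. card (right_ideal_of x)"] by blast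
  have zS: "z \<in> S" and zc [simp]: "z \<in> carrier R" and zz: "z \<otimes> z = z" using z Sc by (auto simp: P_def)
  show ?thesis
  proof (cases "\<one> \<ominus> z = \<zero>")
    case True
    then show ?thesis using zS by (simp add: r_right_minus_eq)
  next
    case False
    define g where "g = \<one> \<ominus> z"
    have gc [simp]: "g \<in> carrier R" by (simp add: g_def)
    have zg: "z \<otimes> g = \<zero>" and gz: "g \<otimes> z = \<zero>" and gg: "g \<otimes> g = g"
      by (simp_all add: g_def a_minus_def l_distr r_distr l_minus r_minus zz r_neg l_neg)
    obtain f a where f: "minimal_idempotent f" and a: "a \<in> carrier R" "f = g \<otimes> a"
      using ex_minimal_idempotent[OF gc False[folded g_def]] by blast
    note fD = minimal_idempotentD[OF f]
    have [simp]: "f \<in> carrier R" by (rule fD)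
    have gf: "g \<otimes> f = f" using a by (simp add: m_assoc[symmetric] gg)
    have zf: "z \<otimes> f = \<zero>" using a by (simp add: m_assoc[symmetric] zg)
    define h where "h = f \<otimes> g"
    have hc [simp]: "h \<in> carrier R" by (simp add: h_def)
    have "h \<otimes> h = f \<otimes> (g \<otimes> f) \<otimes> g" by (simp add: h_def m_assoc)
    then have hh: "h \<otimes> h = h" by (simp add: gf fD h_def)
    have zh: "z \<otimes> h = \<zero>" by (simp add: h_def m_assoc[symmetric] zf)
    have hz: "h \<otimes> z = \<zero>" by (simp add: h_def m_assoc gz)
    have "h \<otimes> f = f" by (simp add: h_def m_assoc gf fD)
    then have h0: "h \<noteq> \<zero>" using fD by auto
    have hS: "h \<in> S" using min[OF f] by (simp add: h_def S.I_r_closed)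
    define z' where "z' = z \<oplus> h"
    have z'c [simp]: "z' \<in> carrier R" by (simp add: z'_def)
    have "P z'" using zS hS by (simp add: P_def z'_def S.a_closed l_distr r_distr zz hh zh hz)
    then have le: "card (right_ideal_of z') \<le> card (right_ideal_of z)" by (rule greatest)
    have z'z: "z' \<otimes> z = z" and z'h: "z' \<otimes> h = h" by (simp_all add: z'_def l_distr zz hh zh hz)
    have "right_ideal_of z \<subseteq> right_ideal_of z'"
    proof
      fix s assume "s \<in> right_ideal_of z"
      then obtain b where "b \<in> carrier R" "s = z \<otimes> b" by (auto simp: right_ideal_of_def)
      then have "s = z' \<otimes> (z \<otimes> b)" by (simp add: m_assoc[symmetric] z'z)
      then show "s \<in> right_ideal_of z'" using \<open>b \<in> carrier R\<close> by (auto simp: right_ideal_of_def)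
    qed
    moreover have "h \<in> right_ideal_of z'" unfolding right_ideal_of_def by (rule image_eqI[of _ _ h]) (simp_all add: z'h)
    moreover have "h \<notin> right_ideal_of z"
    proof
      assume "h \<in> right_ideal_of z"
      then obtain b where b: "b \<in> carrier R" "h = z \<otimes> b" by (auto simp: right_ideal_of_def)
      then have "z \<otimes> h = h" by (simp add: m_assoc[symmetric] zz)
      then show False using zh h0 by simp
    qed
    ultimately have "right_ideal_of z \<subset> right_ideal_of z'" by blast
    moreover have "finite (right_ideal_of z')" using finite_carrier by (simp add: right_ideal_of_def)
    ultimately show ?thesis
      using le psubset_card_mono[of "right_ideal_of z'" "right_ideal_of z"] by simp
  qed
qed

text \<open>
A nonzero \<open>f R h\<close> means that \<open>fR\<close> and \<open>hR\<close> are isomorphic modules. That makes the relation symmetric,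
and isomorphic minimal right ideals generate the same two-sided ideal.
\<close>

lemma linked_idempotents:
  assumes f: "minimal_idempotent f" and h: "minimal_idempotent h"
    and x: "x \<in> carrier R" "f \<otimes> x \<otimes> h \<noteq> \<zero>"
  shows "\<exists>y\<in>carrier R. h \<otimes> y \<otimes> f \<noteq> \<zero>" "ideal S R \<Longrightarrow> f \<in> S \<Longrightarrow> h \<in> S"
proof -
  note fD = minimal_idempotentD[OF f] and hD = minimal_idempotentD[OF h]
  define a where "a = f \<otimes> x \<otimes> h"
  have ac [simp]: "a \<in> carrier R" using fD hD x by (simp add: a_def)
  obtain y where y: "y \<in> carrier R" "a \<otimes> y \<otimes> a \<noteq> \<zero>" using semiprime[OF ac] x by (auto simp: a_def)
  have "a \<otimes> y \<otimes> a = f \<otimes> x \<otimes> (h \<otimes> y \<otimes> f \<otimes> x \<otimes> h)"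
    using fD(1) hD(1) x y by (simp add: a_def m_assoc)
  then have ne: "h \<otimes> y \<otimes> f \<otimes> x \<otimes> h \<noteq> \<zero>" using y fD(1) x by auto
  then show "\<exists>y\<in>carrier R. h \<otimes> y \<otimes> f \<noteq> \<zero>" using y x fD(1) hD(1) by (intro bexI[of _ y]) auto
  assume S: "ideal S R" "f \<in> S"
  interpret S: ideal S R by (rule S)
  have "h \<otimes> (y \<otimes> f \<otimes> x \<otimes> h) \<noteq> \<zero>" using ne y x fD(1) hD(1) by (simp add: m_assoc)
  then obtain v where "v \<in> carrier R" "h \<otimes> (y \<otimes> f \<otimes> x \<otimes> h) \<otimes> v = h"
    using hD(4)[of "y \<otimes> f \<otimes> x \<otimes> h"] y x fD(1) hD(1) by auto
  moreover have "h \<otimes> (y \<otimes> f \<otimes> x \<otimes> h) \<otimes> v \<in> S" if "v \<in> carrier R"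
    using S.I_r_closed[OF S.I_l_closed[OF S.I_r_closed[OF S.I_r_closed[OF S.I_l_closed[OF S(2) y(1)] x(1)] hD(1)] hD(1)] that] .
  ultimately show "h \<in> S" by metis
qed

text \<open>
A maximal family with \<open>f R g = 0\<close> for \<open>f \<noteq> g\<close> contains one idempotent from each isomorphism class of
minimal right ideals, so the two-sided ideal that it generates contains all minimal idempotents.
\<close>

lemma ex_basic_idempotents:
  "\<exists>E. (\<forall>f\<in>E. minimal_idempotent f) \<and> (\<forall>f\<in>E. \<forall>g\<in>E. f \<noteq> g \<longrightarrow> (\<forall>x\<in>carrier R. f \<otimes> x \<otimes> g = \<zero>))
     \<and> (\<forall>S. ideal S R \<longrightarrow> E \<subseteq> S \<longrightarrow> \<one> \<in> S)"
proof -
  define Q where "Q E \<longleftrightarrow> (\<forall>f\<in>E. minimal_idempotent f) \<and> (\<forall>f\<in>E. \<forall>g\<in>E. f \<noteq> g \<longrightarrow> (\<forall>x\<in>carrier R. f \<otimes> x \<otimes> g = \<zero>))" for E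
  have sub: "{E. Q E} \<subseteq> Pow (carrier R)" using minimal_idempotentD(1) by (auto simp: Q_def)
  have fin: "finite {E. Q E}" using finite_carrier by (intro finite_subset[OF sub]) simp
  have empty: "{} \<in> {E. Q E}" by (simp add: Q_def)
  from finite_has_maximal2[OF fin empty]
  obtain E where "E \<in> {E. Q E}" "\<forall>E'\<in>{E. Q E}. E \<subseteq> E' \<longrightarrow> E = E'" by (elim bexE conjE)
  then have E: "Q E" and max: "\<And>E'. Q E' \<Longrightarrow> E \<subseteq> E' \<Longrightarrow> E = E'" by simp_all
  have "\<one> \<in> S" if S: "ideal S R" "E \<subseteq> S" for S
  proof (rule one_in_ideal_of_minimal_idempotents[OF S(1)])
    fix h assume h: "minimal_idempotent h"
    show "h \<in> S"
    proof (cases "h \<in> E")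
      case True
      then show ?thesis by (rule subsetD[OF S(2)])
    next
      case False
      then have "\<not> Q (insert h E)" using max[of "insert h E"] by blast
      then obtain f x where f: "f \<in> E" "x \<in> carrier R" "f \<otimes> x \<otimes> h \<noteq> \<zero> \<or> h \<otimes> x \<otimes> f \<noteq> \<zero>"
        using E h unfolding Q_def by blast
      then have mf: "minimal_idempotent f" using E by (auto simp: Q_def)
      obtain y where y: "y \<in> carrier R" "f \<otimes> y \<otimes> h \<noteq> \<zero>"
        using f(2,3) linked_idempotents(1)[OF h mf f(2)] by metis
      show ?thesis by (rule linked_idempotents(2)[OF mf h y S(1) subsetD[OF S(2) f(1)]])
    qed
  qed
  then show ?thesis using E unfolding Q_def by blast
qed

definition corner :: "'a \<Rightarrow> 'a ring" where
  "corner f = \<lparr>carrier = {f \<otimes> x \<otimes> f |x. x \<in> carrier R}, monoid.mult = (\<otimes>), one = f, zero = \<zero>, add = (\<oplus>)\<rparr>"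

lemma corner_carrier:
  assumes f: "minimal_idempotent f"
  shows "a \<in> carrier (corner f) \<longleftrightarrow> a \<in> carrier R \<and> f \<otimes> a = a \<and> a \<otimes> f = a"
proof -
  note fD = minimal_idempotentD[OF f]
  have fx: "f \<otimes> (f \<otimes> x \<otimes> f) = f \<otimes> x \<otimes> f" "f \<otimes> x \<otimes> f \<otimes> f = f \<otimes> x \<otimes> f" if "x \<in> carrier R" for x
    using that fD(1) by (simp_all add: m_assoc fD(3)) (simp add: m_assoc[symmetric] fD(3))
  show ?thesis
  proof
    assume "a \<in> carrier (corner f)"
    then obtain x where "x \<in> carrier R" "a = f \<otimes> x \<otimes> f" by (auto simp: corner_def)
    then show "a \<in> carrier R \<and> f \<otimes> a = a \<and> a \<otimes> f = a" using fD(1) fx by simp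
  next
    assume "a \<in> carrier R \<and> f \<otimes> a = a \<and> a \<otimes> f = a"
    then have "a = f \<otimes> a \<otimes> f" "a \<in> carrier R" by simp_all
    then show "a \<in> carrier (corner f)" by (auto simp: corner_def)
  qed
qed

lemma corner_division_ring:
  assumes f: "minimal_idempotent f"
  shows "ring (corner f)" "finite (carrier (corner f))"
    "Units (corner f) = carrier (corner f) - {\<zero>\<^bsub>corner f\<^esub>}"
proof -
  note fD = minimal_idempotentD[OF f] and C = corner_carrier[OF f]
  have ops [simp]: "monoid.mult (corner f) = (\<otimes>)" "one (corner f) = f" "zero (corner f) = \<zero>" "add (corner f) = (\<oplus>)"
    by (simp_all add: corner_def)
  have m: "x \<otimes> y \<in> carrier (corner f)" if xy: "x \<in> carrier (corner f)" "y \<in> carrier (corner f)" for x y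
  proof -
    have xy': "x \<in> carrier R" "y \<in> carrier R" "f \<otimes> x = x" "y \<otimes> f = y" using xy C by auto
    then show ?thesis using m_assoc[OF fD(1) xy'(1,2)] m_assoc[OF xy'(1,2) fD(1)] by (simp add: C)
  qed
  show ring: "ring (corner f)"
  proof (intro ringI abelian_groupI monoidI)
    fix a assume "a \<in> carrier (corner f)"
    then show "\<exists>b\<in>carrier (corner f). b \<oplus>\<^bsub>corner f\<^esub> a = \<zero>\<^bsub>corner f\<^esub>"
      by (intro bexI[of _ "\<ominus> a"]) (auto simp: C fD l_minus r_minus l_neg)
  qed (use m in \<open>auto simp: C fD l_distr r_distr m_assoc a_ac\<close>)
  show "finite (carrier (corner f))" using finite_carrier C by (meson finite_subset subsetI)
  interpret D: ring "corner f" by (rule ring)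
  have right: "\<exists>b\<in>carrier (corner f). a \<otimes> b = f" if a: "a \<in> carrier (corner f)" "a \<noteq> \<zero>" for a
  proof -
    have ac: "a \<in> carrier R" "f \<otimes> a = a" "a \<otimes> f = a" using a C by auto
    obtain v where v: "v \<in> carrier R" "a \<otimes> v = f" using fD(4)[OF ac(1)] a ac by auto
    have "a \<otimes> (f \<otimes> v \<otimes> f) = a \<otimes> f \<otimes> (v \<otimes> f)"
      using m_assoc[OF fD(1) v(1) fD(1)] m_assoc[OF ac(1) fD(1), of "v \<otimes> f"] v(1) fD(1) by simp
    also have "\<dots> = a \<otimes> v \<otimes> f" using m_assoc[OF ac(1) v(1) fD(1)] by (simp only: ac(3))
    finally have "a \<otimes> (f \<otimes> v \<otimes> f) = f" by (simp only: v(2) fD(3))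
    moreover have "f \<otimes> v \<otimes> f \<in> carrier (corner f)" using v by (auto simp: corner_def)
    ultimately show ?thesis by blast
  qed
  have unit: "a \<in> Units (corner f)" if a: "a \<in> carrier (corner f)" "a \<noteq> \<zero>" for a
  proof -
    obtain b where b: "b \<in> carrier (corner f)" "a \<otimes> b = f" using right[OF a] by metis
    have "a \<in> carrier R" using a C by simp
    then have "b \<noteq> \<zero>" using b(2) fD(2) by auto
    then obtain c where c: "c \<in> carrier (corner f)" "b \<otimes> c = f" using right[OF b(1)] by metis
    have abc: "a \<in> carrier R" "b \<in> carrier R" "c \<in> carrier R" "a \<otimes> f = a" "f \<otimes> c = c"
      using a b(1) c(1) C by simp_all
    have "a = c" using m_assoc[OF abc(1-3)] by (simp only: b(2) c(2) abc(4,5))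
    then show ?thesis using a b c unfolding Units_def ops by blast
  qed
  have "\<zero> \<notin> Units (corner f)" using fD(1,2) C by (auto simp: Units_def)
  then show "Units (corner f) = carrier (corner f) - {\<zero>\<^bsub>corner f\<^esub>}"
    using unit by (auto simp: Units_def)
qed

end

section \<open>Wedderburn's little theorem\<close>

text \<open>
Each linear factor of \<open>p\<close> contributes a factor larger than \<open>c\<close>, and the leading coefficient one of at
least \<open>1\<close>.
\<close>

lemma norm_poly_gt:
  fixes p :: "complex poly"
  assumes "p \<noteq> 0" "norm (lead_coeff p) \<ge> 1" "degree p > 0" and "c \<ge> 1"
    and "\<And>z. poly p z = 0 \<Longrightarrow> norm (x - z) > c"
  shows "norm (poly p x) > c"
  using assms(1-3,5)
proof (induction "degree p" arbitrary: p rule: less_induct)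
  case less
  have "\<not> constant (poly p)" using less.prems(3) by (simp add: constant_degree)
  then obtain z where z: "poly p z = 0" using fundamental_theorem_of_algebra by blast
  then obtain r where r: "p = [:- z, 1:] * r" by (auto simp: poly_eq_0_iff_dvd)
  have r0: "r \<noteq> 0" using r less.prems(1) by auto
  have deg: "degree p = Suc (degree r)" using r r0 by (simp add: degree_mult_eq del: mult_pCons_left)
  have lc: "lead_coeff p = lead_coeff r" unfolding r lead_coeff_mult by simp
  have big: "norm (x - z) > c" by (rule less.prems(4)[OF z])
  have "norm (poly r x) \<ge> 1"
  proof (cases "degree r = 0")
    case True
    then obtain a where "r = [:a:]" by (rule degree_eq_zeroE)
    then show ?thesis using lc less.prems(2) by simp
  next
    case False
    have "norm (poly r x) > c"
      using False deg lc less.prems(2) r0 by (intro less.hyps less.prems(4)) (auto simp: r)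
    then show ?thesis using assms(4) by simp
  qed
  then have "c * 1 < norm (x - z) * norm (poly r x)"
    using big assms(4) by (intro mult_less_le_imp_less) auto
  then show ?case by (simp add: r norm_mult del: mult_pCons_left)
qed

lemma ex_lcm_finite:
  assumes "finite S"
  shows "\<exists>g :: int poly. (\<forall>p\<in>S. p dvd g) \<and> (\<forall>m. (\<forall>p\<in>S. p dvd m) \<longrightarrow> g dvd m)"
  using assms
proof (induction S rule: finite_induct)
  case empty
  then show ?case by (intro exI[of _ 1]) auto
next
  case (insert p S)
  then obtain g where "\<forall>p\<in>S. p dvd g" "\<forall>m. (\<forall>p\<in>S. p dvd m) \<longrightarrow> g dvd m" by blast
  then show ?case by (intro exI[of _ "lcm p g"]) (auto intro: lcm_least dvd_trans)
qed

lemma map_poly_of_int_mult: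
  "map_poly (of_int :: int \<Rightarrow> complex) (p * q) = map_poly of_int p * map_poly of_int q"
  by (rule poly_eqI) (simp add: coeff_map_poly coeff_mult)

lemma poly_map_of_int: "poly (map_poly (of_int :: int \<Rightarrow> complex) p) (of_int x) = of_int (poly p x)"
  by (induction p) (auto simp: map_poly_pCons)

lemma power_minus_one_dvd:
  fixes q :: "'a::comm_ring_1"
  assumes "d dvd n"
  shows "q ^ d - 1 dvd q ^ n - 1"
proof -
  obtain k where n: "n = d * k" using assms by blast
  have "q ^ d - 1 dvd (q ^ d) ^ k - 1"
    using power_diff_1_eq[of "q ^ d" k] by (metis dvd_triv_left)
  then show ?thesis by (simp add: n power_mult)
qed

text \<open>
The number \<open>h\<close> is the value at \<open>q\<close> of the polynomial \<open>(x ^ n - 1) / g\<close>, where \<open>g\<close> is the least common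
multiple of the \<open>x ^ d - 1\<close> for the proper divisors \<open>d\<close> of \<open>n\<close>; this is the \<open>n\<close>-th cyclotomic polynomial
up to sign. Its complex roots are \<open>n\<close>-th roots of unity other than \<open>1\<close>, all of which have distance
larger than \<open>q - 1\<close> from \<open>q\<close>. It is not constant, because \<open>g\<close> does not vanish at a primitive \<open>n\<close>-th
root of unity.
\<close>

lemma cyclotomic_divisor:
  fixes q n :: nat
  assumes q: "q \<ge> 2" and n: "n \<ge> 2"
  shows "\<exists>h. h dvd int q ^ n - 1 \<and> \<not> h dvd int q - 1 \<and>
      (\<forall>d. d dvd n \<longrightarrow> d < n \<longrightarrow> h * (int q ^ d - 1) dvd int q ^ n - 1)"
proof -
  define W :: "nat \<Rightarrow> int poly" where "W d = monom 1 d - 1" for d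
  have pW: "poly (W d) x = x ^ d - 1" for d x by (simp add: W_def poly_monom)
  define D where "D = {d. d dvd n \<and> d < n}"
  have D: "finite D" "\<And>d. d \<in> D \<Longrightarrow> d > 0" using n by (auto simp: D_def dvd_pos_nat)
  have "finite (W ` D)" using D by simp
  from ex_lcm_finite[OF this] obtain g
    where "(\<forall>p\<in>W ` D. p dvd g) \<and> (\<forall>m. (\<forall>p\<in>W ` D. p dvd m) \<longrightarrow> g dvd m)" by (rule exE)
  then have g: "\<And>d. d \<in> D \<Longrightarrow> W d dvd g" "\<And>m. (\<And>d. d \<in> D \<Longrightarrow> W d dvd m) \<Longrightarrow> g dvd m" by simp_all
  have "g dvd W n"
  proof (rule g(2))
    fix d assume "d \<in> D"
    then show "W d dvd W n"
      using power_minus_one_dvd[of d n "[:0, 1:] :: int poly"] by (simp add: D_def W_def monom_altdef)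
  qed
  then obtain h where h: "W n = g * h" by (rule dvdE)
  define c where "c = map_poly (of_int :: int \<Rightarrow> complex)"
  have c_mult: "c (p * r) = c p * c r" for p r by (simp only: c_def map_poly_of_int_mult)
  have c_coeff: "coeff (c p) i = of_int (coeff p i)" for p i by (simp add: c_def coeff_map_poly)
  have c_degree: "degree (c p) = degree p" for p by (simp add: c_def degree_map_poly)
  have c_one: "c 1 = 1" by (rule poly_eqI) (simp add: c_coeff)
  have c_eval: "poly (c p) (of_int x) = of_int (poly p x)" for p x by (simp only: c_def poly_map_of_int)
  have cW: "poly (c (W d)) z = z ^ d - 1" for d z
  proof -
    have "c (W d) = monom 1 d - 1"
      by (rule poly_eqI) (auto simp: W_def c_coeff)
    then show ?thesis by (simp add: poly_monom)
  qed
  have Wn0: "c (W n) \<noteq> 0"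
  proof
    assume "c (W n) = 0"
    then have "poly (c (W n)) 0 = 0" by simp
    then show False using n by (simp add: cW power_0_left)
  qed
  have ch: "c (W n) = c g * c h" by (simp add: h c_mult)
  have roots: "z ^ n = 1 \<and> z \<noteq> 1" if z: "poly (c h) z = 0" for z
  proof -
    have "z ^ n - 1 = poly (c g * c h) z" by (simp only: cW[symmetric] ch)
    then have zn: "z ^ n = 1" by (simp add: z)
    \<comment> \<open>Otherwise \<open>1\<close> is a root of both \<open>g\<close> and \<open>h\<close>, hence a double root of the separable
      polynomial \<open>x ^ n - 1\<close>.\<close>
    moreover have "z \<noteq> 1"
    proof
      assume "z = 1"
      have "1 \<in> D" using n by (auto simp: D_def)
      from g(1)[OF this] obtain r where "g = W 1 * r" by (rule dvdE)
      then have "c (W n) = c (W 1) * c r * c h" by (simp only: ch c_mult)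
      moreover have "c (W 1) = [:-1, 1:]"
        by (rule poly_eqI) (auto simp: W_def c_coeff coeff_pCons split: nat.split)
      moreover obtain t where "c h = [:-1, 1:] * t" using z \<open>z = 1\<close> by (auto simp: poly_eq_0_iff_dvd)
      ultimately have eq: "c (W n) = [:-1, 1:] * [:-1, 1:] * (c r * t)" by (simp only: mult_ac)
      have "poly (pderiv (c (W n))) 1 = 0"
        unfolding eq pderiv_mult by simp
      moreover have "pderiv (c (W n)) = monom (of_nat n) (n - 1)"
      proof -
        have "c (W n) = monom 1 n - 1"
          by (rule poly_eqI) (auto simp: W_def c_coeff)
        then show ?thesis by (simp add: pderiv_diff pderiv_monom)
      qed
      ultimately show False using n by (simp add: poly_monom)
    qed
    ultimately show ?thesis ..
  qed
  have lead: "norm (lead_coeff (c h)) = 1"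
  proof -
    have "lead_coeff (W n) = 1"
    proof -
      have "degree (W n) = n"
        using n degree_add_eq_left[of "- 1" "monom 1 n :: int poly"] by (simp add: W_def degree_monom_eq)
      then show ?thesis using n by (simp add: W_def)
    qed
    then have "lead_coeff g * lead_coeff h = 1" unfolding h lead_coeff_mult .
    then have "\<bar>lead_coeff h\<bar> = 1" using zmult_eq_1_iff[of "lead_coeff g" "lead_coeff h"] by auto
    moreover have "lead_coeff (c h) = of_int (lead_coeff h)"
      by (simp add: c_coeff c_degree)
    ultimately have "norm (lead_coeff (c h)) = of_int \<bar>lead_coeff h\<bar>"
      by (simp only: norm_of_int of_int_abs)
    then show ?thesis using \<open>\<bar>lead_coeff h\<bar> = 1\<close> by simp
  qed
  define \<zeta> where "\<zeta> = cis (2 * pi / n)"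
  have \<zeta>: "\<zeta> ^ n = 1" using n by (simp add: \<zeta>_def DeMoivre)
  have \<zeta>': "\<zeta> ^ d \<noteq> 1" if "d \<in> D" for d
  proof
    assume "\<zeta> ^ d = 1"
    then have "cos (real d * (2 * pi / n)) = 1" by (simp add: \<zeta>_def DeMoivre complex_eq_iff)
    then obtain k :: int where "real d * (2 * pi / n) = k * 2 * pi" by (auto simp: cos_one_2pi_int)
    then have "real d = k * real n" using n by (simp add: field_simps)
    then have "int d = k * int n" by (metis of_int_eq_iff of_int_mult of_int_of_nat_eq)
    then have "int n dvd int d" by simp
    then have "n dvd d" by (simp only: int_dvd_int_iff)
    then show False using D(2)[OF that] that by (auto simp: D_def dest: dvd_imp_le)
  qed
  have "poly (c h) \<zeta> = 0"
  proof -
    have "g dvd (\<Prod>d\<in>D. W d)" by (rule g(2)) (use D in auto)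
    then obtain r where "(\<Prod>d\<in>D. W d) = g * r" by (rule dvdE)
    moreover have "poly (c (\<Prod>d\<in>D. W d)) \<zeta> = (\<Prod>d\<in>D. poly (c (W d)) \<zeta>)"
      using D(1) by (induction D rule: finite_induct) (auto simp: c_mult c_one)
    ultimately have "poly (c g) \<zeta> * poly (c r) \<zeta> = (\<Prod>d\<in>D. poly (c (W d)) \<zeta>)"
      by (simp add: c_mult)
    also have "\<dots> \<noteq> 0" using D(1) \<zeta>' by (simp add: cW)
    finally have "poly (c g) \<zeta> \<noteq> 0" by auto
    moreover have "poly (c g) \<zeta> * poly (c h) \<zeta> = 0" using cW[of n \<zeta>] \<zeta> by (simp add: ch)
    ultimately show ?thesis by simp
  qed
  have ch0: "c h \<noteq> 0" using Wn0 ch by auto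
  have deg: "degree (c h) > 0"
  proof (rule ccontr)
    assume "\<not> degree (c h) > 0"
    then obtain a where "c h = [:a:]" using degree_eq_zeroE[of "c h"] by blast
    then show False using \<open>poly (c h) \<zeta> = 0\<close> ch0 by simp
  qed
  have "norm (complex_of_int (int q) - z) > real (q - 1)" if "poly (c h) z = 0" for z
  proof -
    have "norm z ^ n = 1" using roots[OF that] by (metis norm_one norm_power)
    then have nz: "norm z = 1" using n power_eq_imp_eq_base[of "norm z" n 1] by simp
    have "Re z < 1"
    proof (rule ccontr)
      assume "\<not> Re z < 1"
      then have "Re z = 1" using complex_Re_le_cmod[of z] nz by simp
      then have "Im z = 0" using nz by (simp add: cmod_def)
      then show False using \<open>Re z = 1\<close> roots[OF that] by (simp add: complex_eq_iff)
    qed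
    then have "real (q - 1) < Re (complex_of_int (int q) - z)" using q by (simp add: of_nat_diff)
    also have "\<dots> \<le> norm (complex_of_int (int q) - z)" by (rule complex_Re_le_cmod)
    finally show ?thesis .
  qed
  then have "norm (poly (c h) (of_int (int q))) > real (q - 1)"
    using ch0 lead deg q by (intro norm_poly_gt) auto
  then have "\<bar>poly h (int q)\<bar> > int q - 1"
    using q unfolding c_eval by (simp add: of_nat_diff)
  then have nd: "\<not> poly h (int q) dvd int q - 1"
    using q zdvd_not_zless[of "int q - 1" "\<bar>poly h (int q)\<bar>"] by simp
  have "poly h (int q) dvd int q ^ n - 1"
    unfolding pW[symmetric] h poly_mult by (rule dvd_triv_right)
  moreover have "poly h (int q) * (int q ^ d - 1) dvd int q ^ n - 1" if "d dvd n" "d < n" for d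
  proof -
    have "d \<in> D" using that by (simp add: D_def)
    from g(1)[OF this] obtain r where "g = W d * r" by (rule dvdE)
    then have eq: "W n = h * W d * r" using h by (simp add: mult_ac)
    show ?thesis unfolding pW[symmetric] eq poly_mult by (rule dvd_triv_left)
  qed
  ultimately show ?thesis using nd by (intro exI[of _ "poly h (int q)"] conjI allI impI)
qed

text \<open>
Modulo \<open>q ^ d - 1\<close> the number \<open>q ^ n - 1\<close> is congruent to \<open>q ^ (n mod d) - 1\<close>, which is smaller than the
modulus.
\<close>

lemma power_minus_one_dvd_imp_dvd:
  fixes q :: nat
  assumes q: "q \<ge> 2" and d: "d > 0" and dvd: "int q ^ d - 1 dvd int q ^ n - 1"
  shows "d dvd n"
proof -
  define r where "r = n mod d"
  have "int q ^ n = int q ^ (d * (n div d)) * int q ^ r"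
    unfolding r_def power_add[symmetric] by simp
  then have eq: "int q ^ n - 1 = int q ^ r * (int q ^ (d * (n div d)) - 1) + (int q ^ r - 1)"
    by (simp add: algebra_simps)
  have "int q ^ d - 1 dvd int q ^ r * (int q ^ (d * (n div d)) - 1)"
    by (rule dvd_mult[OF power_minus_one_dvd]) simp
  then have "int q ^ d - 1 dvd int q ^ r - 1" using dvd unfolding eq by (simp add: dvd_add_right_iff)
  moreover have "int q ^ r - 1 < int q ^ d - 1" using q d by (simp add: r_def power_strict_increasing)
  ultimately have "\<not> 0 < int q ^ r - 1" using zdvd_not_zless by blast
  then have "q ^ r \<le> 1" by (metis diff_gt_0_iff_gt not_le of_nat_1 of_nat_less_iff of_nat_power)
  moreover have "q ^ 1 \<le> q ^ r" if "r \<noteq> 0" using q that by (intro power_increasing) auto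
  ultimately have "r = 0" using q by fastforce
  then show ?thesis by (simp add: r_def dvd_eq_mod_eq_0)
qed

locale finite_division_ring = ring R for R (structure) +
  assumes finite_carrier: "finite (carrier R)"
    and Units_eq: "Units R = carrier R - {\<zero>}"
begin

lemma one_not_zero: "\<one> \<noteq> \<zero>"
  using Units_one_closed Units_eq by auto

definition center :: "'a set" where
  "center = {z \<in> carrier R. \<forall>x\<in>carrier R. z \<otimes> x = x \<otimes> z}"

lemma centerD: "z \<in> center \<Longrightarrow> z \<in> carrier R" "z \<in> center \<Longrightarrow> x \<in> carrier R \<Longrightarrow> z \<otimes> x = x \<otimes> z"
  by (auto simp: center_def)

lemma center_minus: "z \<in> center \<Longrightarrow> z' \<in> center \<Longrightarrow> z \<ominus> z' \<in> center"
  by (auto simp: center_def a_minus_def l_distr r_distr l_minus r_minus)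

lemma center_one: "\<one> \<in> center"
  by (auto simp: center_def)

lemma center_zero: "\<zero> \<in> center"
  by (auto simp: center_def)

lemma center_inv:
  assumes z: "z \<in> center" "z \<noteq> \<zero>"
  shows "inv z \<in> center"
proof -
  have u: "z \<in> Units R" and zc: "z \<in> carrier R" using z Units_eq by (auto simp: center_def)
  have "inv z \<otimes> x = x \<otimes> inv z" if x: "x \<in> carrier R" for x
  proof -
    have "inv z \<otimes> x = inv z \<otimes> (x \<otimes> z) \<otimes> inv z"
      using x u zc by (simp add: m_assoc)
    also have "x \<otimes> z = z \<otimes> x" using centerD(2)[OF z(1) x] ..
    also have "inv z \<otimes> (z \<otimes> x) \<otimes> inv z = x \<otimes> inv z" using x u zc by (simp add: m_assoc[symmetric])
    finally show ?thesis .
  qed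
  then show ?thesis using u by (simp add: center_def)
qed

definition center_subspace :: "'a set \<Rightarrow> bool" where
  "center_subspace V \<longleftrightarrow> V \<subseteq> carrier R \<and> \<zero> \<in> V \<and> (\<forall>x\<in>V. \<forall>y\<in>V. x \<oplus> y \<in> V) \<and> (\<forall>z\<in>center. \<forall>x\<in>V. z \<otimes> x \<in> V)"

lemma center_subspaceD:
  assumes "center_subspace V"
  shows "x \<in> V \<Longrightarrow> x \<in> carrier R" "\<zero> \<in> V" "x \<in> V \<Longrightarrow> y \<in> V \<Longrightarrow> x \<oplus> y \<in> V"
    "z \<in> center \<Longrightarrow> x \<in> V \<Longrightarrow> z \<otimes> x \<in> V" "x \<in> V \<Longrightarrow> y \<in> V \<Longrightarrow> x \<ominus> y \<in> V"
proof -
  show *: "x \<in> V \<Longrightarrow> x \<in> carrier R" "\<zero> \<in> V" "x \<in> V \<Longrightarrow> y \<in> V \<Longrightarrow> x \<oplus> y \<in> V"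
    "z \<in> center \<Longrightarrow> x \<in> V \<Longrightarrow> z \<otimes> x \<in> V" for x y z
    using assms by (auto simp: center_subspace_def)
  assume xy: "x \<in> V" "y \<in> V"
  have "\<ominus> \<one> \<in> center" using center_minus[OF center_zero center_one] by (simp add: a_minus_def)
  then have "(\<ominus> \<one>) \<otimes> y \<in> V" by (rule *(4)[OF _ xy(2)])
  then have "\<ominus> y \<in> V" using *(1)[OF xy(2)] by (simp add: l_minus)
  then show "x \<ominus> y \<in> V" unfolding a_minus_def by (rule *(3)[OF xy(1)])
qed

text \<open>
A dimension count: a subspace of \<open>W\<close> that is maximal among those whose cardinality is a power of the
cardinality of the center is all of \<open>W\<close>, since adjoining one more vector multiplies the cardinality by that
of the center.
\<close>

lemma card_center_subspace:
  assumes W: "center_subspace W"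
  shows "\<exists>d. card W = card center ^ d"
proof -
  define Q where "Q = {V. center_subspace V \<and> V \<subseteq> W \<and> (\<exists>d. card V = card center ^ d)}"
  have "Q \<subseteq> Pow (carrier R)" using W by (auto simp: Q_def center_subspace_def)
  then have fin: "finite Q" using finite_carrier by (meson finite_Pow_iff finite_subset)
  have "center_subspace {\<zero>}" by (auto simp: center_subspace_def center_def)
  moreover have "card {\<zero>} = card center ^ 0" by simp
  ultimately have "{\<zero>} \<in> Q" using center_subspaceD(2)[OF W] unfolding Q_def by blast
  from finite_has_maximal2[OF fin this]
  obtain V where V: "V \<in> Q" and max: "\<forall>V'\<in>Q. V \<subseteq> V' \<longrightarrow> V = V'" by (elim bexE conjE)
  have sV: "center_subspace V" and VW: "V \<subseteq> W" using V by (simp_all add: Q_def)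
  note VD = center_subspaceD[OF sV] and WD = center_subspaceD[OF W]
  obtain d where d: "card V = card center ^ d" using V by (auto simp: Q_def)
  show ?thesis
  proof (cases "V = W")
    case True
    then show ?thesis using d by blast
  next
    case False
    then obtain w where w: "w \<in> W" "w \<notin> V" using VW by blast
    have wc: "w \<in> carrier R" by (rule WD(1)[OF w(1)])
    define f where "f = (\<lambda>(v, z). v \<oplus> z \<otimes> w)"
    define V' where "V' = f ` (V \<times> center)"
    have inj: "inj_on f (V \<times> center)"
    proof (rule inj_onI, clarify)
      fix v z v' z' assume v: "v \<in> V" "v' \<in> V" and z: "z \<in> center" "z' \<in> center" and eq: "f (v, z) = f (v', z')"
      note c = VD(1)[OF v(1)] VD(1)[OF v(2)] centerD(1)[OF z(1)] centerD(1)[OF z(2)]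
      have eq: "v \<oplus> z \<otimes> w = v' \<oplus> z' \<otimes> w" using eq by (simp add: f_def)
      define t where "t = z \<otimes> w"
      define t' where "t' = z' \<otimes> w"
      have tc: "t \<in> carrier R" "t' \<in> carrier R" using c wc by (simp_all add: t_def t'_def)
      have "t = v' \<oplus> t' \<oplus> \<ominus> v"
        using r_neg1[OF c(1) tc(1)] eq c tc by (simp add: t_def t'_def a_comm)
      then have "t \<ominus> t' = (v' \<oplus> \<ominus> v) \<oplus> (t' \<oplus> \<ominus> t')"
        using c tc(2) unfolding a_minus_def by (simp only:) (simp add: a_ac)
      then have "t \<ominus> t' = v' \<ominus> v" using c tc by (simp add: r_neg a_minus_def)
      moreover have "(z \<ominus> z') \<otimes> w = t \<ominus> t'"
        using c wc by (simp add: a_minus_def l_distr l_minus t_def t'_def)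
      ultimately have "(z \<ominus> z') \<otimes> w \<in> V" using VD(5)[OF v(2,1)] by simp
      have zz: "z = z'"
      proof (rule ccontr)
        assume "z \<noteq> z'"
        then have nz: "z \<ominus> z' \<noteq> \<zero>" using c by simp
        have "z \<ominus> z' \<in> center" by (rule center_minus[OF z])
        then have i: "inv (z \<ominus> z') \<in> center" using nz by (rule center_inv)
        have u: "z \<ominus> z' \<in> Units R" using nz c by (simp add: Units_eq)
        have "inv (z \<ominus> z') \<otimes> ((z \<ominus> z') \<otimes> w) \<in> V" by (rule VD(4)[OF i \<open>(z \<ominus> z') \<otimes> w \<in> V\<close>])
        moreover have "inv (z \<ominus> z') \<otimes> ((z \<ominus> z') \<otimes> w) = w" using u wc c by (simp add: m_assoc[symmetric])
        ultimately show False using w by simp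
      qed
      then show "v = v' \<and> z = z'" using eq c wc by simp
    qed
    have "card V' = card center ^ Suc d"
      unfolding V'_def card_image[OF inj] by (simp add: card_cartesian_product d)
    moreover have "V' \<subseteq> W"
      using VW WD(3,4) w by (auto simp: V'_def f_def)
    moreover have "center_subspace V'"
      unfolding center_subspace_def
    proof (intro conjI ballI)
      show "V' \<subseteq> carrier R" by (rule subset_trans[OF \<open>V' \<subseteq> W\<close> subsetI[OF WD(1)]])
      show "\<zero> \<in> V'" unfolding V'_def
        by (rule image_eqI[of _ _ "(\<zero>, \<zero>)"]) (auto simp: f_def wc VD(2) center_zero)
      fix x assume "x \<in> V'"
      then obtain v z where v: "v \<in> V" "z \<in> center" "x = v \<oplus> z \<otimes> w" by (auto simp: V'_def f_def)
      note c = VD(1)[OF v(1)] centerD(1)[OF v(2)]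
      {
        fix y assume "y \<in> V'"
        then obtain v' z' where v': "v' \<in> V" "z' \<in> center" "y = v' \<oplus> z' \<otimes> w" by (auto simp: V'_def f_def)
        note c' = VD(1)[OF v'(1)] centerD(1)[OF v'(2)]
        have "z \<oplus> z' \<in> center" using v v' by (auto simp: center_def l_distr r_distr)
        moreover have "x \<oplus> y = (v \<oplus> v') \<oplus> (z \<oplus> z') \<otimes> w" using c c' wc by (simp add: v v' l_distr a_ac)
        ultimately show "x \<oplus> y \<in> V'" unfolding V'_def using VD(3)[OF v(1) v'(1)]
          by (intro image_eqI[of _ _ "(v \<oplus> v', z \<oplus> z')"]) (auto simp: f_def)
      }
      fix t assume t: "t \<in> center"
      note tc = centerD(1)[OF t]
      have "t \<otimes> z \<in> center"
      proof -
        have "t \<otimes> z \<otimes> x = x \<otimes> (t \<otimes> z)" if x: "x \<in> carrier R" for x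
        proof -
          have "t \<otimes> z \<otimes> x = t \<otimes> (x \<otimes> z)" using x c tc centerD(2)[OF v(2) x] by (simp add: m_assoc)
          also have "\<dots> = x \<otimes> t \<otimes> z" using x c tc centerD(2)[OF t x] by (simp add: m_assoc[symmetric])
          finally show ?thesis using x c tc by (simp add: m_assoc)
        qed
        then show ?thesis using c tc by (simp add: center_def)
      qed
      moreover have "t \<otimes> x = t \<otimes> v \<oplus> (t \<otimes> z) \<otimes> w" using c wc tc by (simp add: v r_distr m_assoc)
      ultimately show "t \<otimes> x \<in> V'" unfolding V'_def using VD(4)[OF t v(1)]
        by (intro image_eqI[of _ _ "(t \<otimes> v, t \<otimes> z)"]) (auto simp: f_def)
    qed
    ultimately have "V' \<in> Q" unfolding Q_def by blast
    moreover have "V \<subseteq> V'"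
    proof
      fix v assume "v \<in> V"
      then show "v \<in> V'" unfolding V'_def
        by (intro image_eqI[of _ _ "(v, \<zero>)"]) (auto simp: f_def wc VD(1) center_zero)
    qed
    ultimately have "V = V'" using max by simp
    moreover have "w \<in> V'" unfolding V'_def
      by (intro image_eqI[of _ _ "(\<zero>, \<one>)"]) (auto simp: f_def wc VD(2) center_one)
    ultimately show ?thesis using w by simp
  qed
qed

definition centralizer :: "'a \<Rightarrow> 'a set" where
  "centralizer a = {x \<in> carrier R. a \<otimes> x = x \<otimes> a}"

lemma centralizer_subspace:
  assumes a: "a \<in> carrier R"
  shows "center_subspace (centralizer a)"
proof -
  have "a \<otimes> (z \<otimes> x) = z \<otimes> x \<otimes> a" if z: "z \<in> center" and x: "x \<in> carrier R" "a \<otimes> x = x \<otimes> a" for z x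
  proof -
    have "a \<otimes> (z \<otimes> x) = a \<otimes> z \<otimes> x" using a x centerD(1)[OF z] by (simp add: m_assoc)
    also have "a \<otimes> z = z \<otimes> a" using centerD(2)[OF z a] ..
    also have "z \<otimes> a \<otimes> x = z \<otimes> (x \<otimes> a)" using a x centerD(1)[OF z] by (simp add: m_assoc)
    finally show ?thesis using a x centerD(1)[OF z] by (simp add: m_assoc)
  qed
  then show ?thesis using a centerD(1)
    by (auto simp: center_subspace_def centralizer_def l_distr r_distr)
qed

text \<open>
Wedderburn's little theorem by Witt's class equation argument. Let the center have \<open>q\<close> elements and
the ring \<open>q ^ n\<close>. The centralizer of a noncentral element has \<open>q ^ d\<close> elements for a proper divisor \<open>d\<close> of
\<open>n\<close>, so the number \<open>h\<close> of \<open>cyclotomic_divisor\<close> divides the size of its conjugacy class. Therefore \<open>h\<close>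
divides \<open>q ^ n - q\<close>, the number of noncentral elements. It also divides \<open>q ^ n - 1\<close>, hence \<open>q - 1\<close>, which
is excluded.
\<close>

theorem commutative: "x \<in> carrier R \<Longrightarrow> y \<in> carrier R \<Longrightarrow> x \<otimes> y = y \<otimes> x"
proof -
  have "center = carrier R"
  proof (rule ccontr)
    assume nc: "center \<noteq> carrier R"
    define q where "q = card center"
    have cen: "center \<subseteq> carrier R" by (auto simp: center_def)
    have finite_center: "finite center" by (rule finite_subset[OF cen finite_carrier])
    have "card {\<zero>, \<one>} \<le> card center"
      by (rule card_mono[OF finite_center]) (simp add: center_zero center_one)
    then have q2: "q \<ge> 2" using one_not_zero by (simp add: q_def)
    have "center_subspace (carrier R)" by (auto simp: center_subspace_def center_def)
    then obtain n where n: "card (carrier R) = q ^ n" using card_center_subspace unfolding q_def by blast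
    have "card center < card (carrier R)" using cen nc finite_carrier by (intro psubset_card_mono) auto
    then have "q < q ^ n" by (simp only: n q_def[symmetric])
    then have "q ^ 1 < q ^ n" by simp
    then have "1 < n" using q2 by (subst (asm) power_strict_increasing_iff) auto
    then have n2: "n \<ge> 2" by simp
    obtain h where h: "h dvd int q ^ n - 1" "\<not> h dvd int q - 1"
      "\<And>d. d dvd n \<Longrightarrow> d < n \<Longrightarrow> h * (int q ^ d - 1) dvd int q ^ n - 1"
      using cyclotomic_divisor[OF q2 n2] by metis
    define G where "G = units_of R"
    define \<phi> where "\<phi> = (\<lambda>g. \<lambda>h\<in>carrier G. g \<otimes>\<^bsub>G\<^esub> h \<otimes>\<^bsub>G\<^esub> inv\<^bsub>G\<^esub> g)"
    interpret G: group G unfolding G_def by (rule units_group)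
    interpret A: group_action G "carrier G" \<phi> unfolding \<phi>_def by (rule G.action_by_conjugation)
    have carG: "carrier G = carrier R - {\<zero>}" by (simp add: G_def units_of_carrier Units_eq)
    have \<phi>: "\<phi> g a = g \<otimes> a \<otimes> inv g" if "g \<in> carrier G" "a \<in> carrier G" for g a
      using that units_of_inv[of g] by (simp add: \<phi>_def G_def units_of_mult units_of_carrier)
    have order_G: "int (Coset.order G) = int q ^ n - 1"
    proof -
      have "Coset.order G = q ^ n - 1" using finite_carrier n by (simp add: Coset.order_def carG card_Diff_singleton)
      then show ?thesis using q2 by (simp add: of_nat_diff)
    qed
    have fix_iff: "\<phi> g a = a \<longleftrightarrow> a \<otimes> g = g \<otimes> a" if ga: "g \<in> carrier G" "a \<in> carrier G" for g a :: 'a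
    proof -
      have gu: "g \<in> Units R" and ac: "a \<in> carrier R" using ga carG by (auto simp: Units_eq)
      have gc: "g \<in> carrier R" "inv g \<in> carrier R" using gu by auto
      show ?thesis unfolding \<phi>[OF ga]
      proof
        assume "g \<otimes> a \<otimes> inv g = a"
        then have "a \<otimes> g = g \<otimes> a \<otimes> inv g \<otimes> g" by simp
        also have "\<dots> = g \<otimes> a" using gu gc ac by (simp add: m_assoc)
        finally show "a \<otimes> g = g \<otimes> a" .
      next
        assume "a \<otimes> g = g \<otimes> a"
        then have "g \<otimes> a \<otimes> inv g = a \<otimes> g \<otimes> inv g" by simp
        also have "\<dots> = a" using gu gc ac by (simp add: m_assoc)
        finally show "g \<otimes> a \<otimes> inv g = a" .
      qed
    qed
    have stab: "stabilizer G \<phi> a = centralizer a - {\<zero>}" if a: "a \<in> carrier G" for a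
      using fix_iff[OF _ a] by (auto simp: stabilizer_def centralizer_def carG)
    define N where "N = carrier R - center"
    have NG: "N \<subseteq> carrier G" using center_zero by (auto simp: N_def carG)
    have orbit_dvd: "h dvd int (card (orbit G \<phi> a))" if a: "a \<in> N" for a
    proof -
      have aG: "a \<in> carrier G" by (rule subsetD[OF NG a])
      have aR: "a \<in> carrier R" using a by (simp add: N_def)
      obtain d where d: "card (centralizer a) = q ^ d"
        using card_center_subspace[OF centralizer_subspace[OF aR]] by (auto simp: q_def)
      have finC: "finite (centralizer a)" by (rule finite_subset[OF _ finite_carrier]) (auto simp: centralizer_def)
      have "\<exists>x\<in>carrier R. a \<otimes> x \<noteq> x \<otimes> a" using a by (auto simp: N_def center_def)
      then have "centralizer a \<subset> carrier R" by (auto simp: centralizer_def)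
      from psubset_card_mono[OF finite_carrier this] have "q ^ d < q ^ n" by (simp only: d n)
      then have dn: "d < n" using q2 by (simp add: power_strict_increasing_iff)
      have "card {\<zero>, \<one>} \<le> card (centralizer a)"
        by (rule card_mono[OF finC]) (auto simp: centralizer_def aR)
      then have "d > 0" using one_not_zero by (cases d) (auto simp: d)
      have "card (stabilizer G \<phi> a) = q ^ d - 1"
        unfolding stab[OF aG] using finC center_subspaceD(2)[OF centralizer_subspace[OF aR]]
        by (simp add: card_Diff_singleton d)
      then have "int (card (stabilizer G \<phi> a)) = int q ^ d - 1" using q2 by (simp add: of_nat_diff)
      then have eq: "int (card (orbit G \<phi> a)) * (int q ^ d - 1) = int q ^ n - 1"
        by (simp only: order_G[symmetric] A.orbit_stabilizer_theorem[OF aG, symmetric] of_nat_mult)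
      have "int q ^ d - 1 dvd int q ^ n - 1" unfolding eq[symmetric] by simp
      then have "d dvd n" using power_minus_one_dvd_imp_dvd[OF q2 \<open>d > 0\<close>] by blast
      then have "h * (int q ^ d - 1) dvd int (card (orbit G \<phi> a)) * (int q ^ d - 1)"
        unfolding eq using h(3) dn by simp
      moreover have "1 < int q ^ d" by (rule one_less_power) (use q2 \<open>d > 0\<close> in auto)
      ultimately show ?thesis by simp
    qed
    define C where "C = orbit G \<phi> ` N"
    have orbit_sub: "orbit G \<phi> a \<subseteq> N" if a: "a \<in> N" for a
    proof
      fix b assume "b \<in> orbit G \<phi> a"
      then obtain g where g: "g \<in> carrier G" "b = \<phi> g a" unfolding orbit_def by blast
      have aG: "a \<in> carrier G" by (rule subsetD[OF NG a])
      have bG: "b \<in> carrier G" using A.element_image[OF g(1) aG] g by simp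
      have gu: "g \<in> Units R" and ac: "a \<in> carrier R" using g aG carG by (auto simp: Units_eq)
      have gc: "g \<in> carrier R" "inv g \<in> carrier R" using gu by auto
      have b: "b = g \<otimes> a \<otimes> inv g" using g \<phi> aG by simp
      have "b \<notin> center"
      proof
        assume bc: "b \<in> center"
        have "g \<otimes> a = b \<otimes> g" unfolding b using gu gc ac by (simp add: m_assoc)
        also have "\<dots> = g \<otimes> b" by (rule centerD(2)[OF bc gc(1)])
        finally have "inv g \<otimes> (g \<otimes> a) = inv g \<otimes> (g \<otimes> b)" by simp
        then have "a = b" using gu gc ac centerD(1)[OF bc] by (simp add: m_assoc[symmetric])
        then show False using bc a by (simp add: N_def)
      qed
      then show "b \<in> N" using bG carG by (simp add: N_def)
    qed
    have "\<Union>C = N"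
    proof
      show "\<Union>C \<subseteq> N" using orbit_sub by (auto simp: C_def)
      show "N \<subseteq> \<Union>C" using A.orbit_refl NG by (auto simp: C_def)
    qed
    moreover have "nat \<bar>h\<bar> dvd card (\<Union>C)"
    proof (rule dvd_partition)
      show "finite (\<Union>C)" unfolding \<open>\<Union>C = N\<close> using finite_carrier by (simp add: N_def)
      show "\<forall>c\<in>C. nat \<bar>h\<bar> dvd card c" using orbit_dvd by (auto simp: C_def nat_abs_dvd_iff)
      interpret partition "carrier G" "orbits G (carrier G) \<phi>" by (rule A.orbit_partition)
      have "C \<subseteq> orbits G (carrier G) \<phi>" using NG by (auto simp: C_def orbits_def)
      then have "c1 = c2" if "c1 \<in> C" "c2 \<in> C" "x \<in> c1" "x \<in> c2" for c1 c2 x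
        using unique_class[of x] incl[of c1] that by (metis subsetD)
      then show "\<forall>c1\<in>C. \<forall>c2\<in>C. c1 \<noteq> c2 \<longrightarrow> c1 \<inter> c2 = {}" by (metis disjoint_iff)
    qed
    ultimately have "h dvd int (card N)" by (simp add: nat_abs_dvd_iff)
    moreover have "int (card N) = (int q ^ n - 1) - (int q - 1)"
    proof -
      have "card N = q ^ n - q" unfolding N_def using card_Diff_subset[OF finite_center cen] by (simp add: n q_def)
      then show ?thesis using \<open>q < q ^ n\<close> by (simp add: of_nat_diff)
    qed
    ultimately have "h dvd int q - 1" using h(1) using dvd_diff[of h "int q ^ n - 1" "int (card N)"] by simp
    then show False using h(2) by simp
  qed
  then show "x \<otimes> y = y \<otimes> x" if "x \<in> carrier R" "y \<in> carrier R"
    using that by (auto simp: center_def)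
qed

end

section \<open>Corners of finite semiprime rings are finite fields\<close>

lemma (in ring) ideal_if_closed:
  assumes S: "S \<subseteq> carrier R" "\<zero> \<in> S" and add: "\<And>x y. x \<in> S \<Longrightarrow> y \<in> S \<Longrightarrow> x \<oplus> y \<in> S"
    and l: "\<And>x c. x \<in> S \<Longrightarrow> c \<in> carrier R \<Longrightarrow> c \<otimes> x \<in> S" and r: "\<And>x c. x \<in> S \<Longrightarrow> c \<in> carrier R \<Longrightarrow> x \<otimes> c \<in> S"
  shows "ideal S R"
proof (rule idealI[OF ring_axioms])
  have "\<ominus> x \<in> S" if "x \<in> S" for x
  proof -
    have "(\<ominus> \<one>) \<otimes> x \<in> S" using l[OF that, of "\<ominus> \<one>"] by simp
    then show ?thesis using S(1) that by (simp add: l_minus subset_iff)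
  qed
  then show "subgroup S (add_monoid R)"
    using S add by (intro subgroup.intro) (auto simp flip: a_inv_def)
qed (use l r in auto)

context finite_semiprime_ring
begin

text \<open>
The corner of \<open>f\<close> is a finite field, so its nonzero elements are the powers of one of them. Exponents are
positive because the zeroth power in \<open>R\<close> is the neutral element of \<open>R\<close>, not \<open>f\<close>.
\<close>

lemma corner_cyclic:
  assumes f: "minimal_idempotent f"
  shows "\<exists>\<alpha>\<in>carrier R. \<forall>x\<in>carrier R. f \<otimes> x \<otimes> f = \<zero> \<or> (\<exists>k::nat. f \<otimes> x \<otimes> f = \<alpha> [^] Suc k)"
proof -
  let ?D = "corner f"
  have ops [simp]: "monoid.mult ?D = (\<otimes>)" "one ?D = f" "zero ?D = \<zero>"
    by (simp_all add: corner_def)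
  interpret D: finite_division_ring ?D
    using corner_division_ring[OF f] by (simp add: finite_division_ring_def finite_division_ring_axioms_def)
  interpret D: cring ?D by unfold_locales (rule D.commutative)
  interpret D: field ?D by (rule D.cring_fieldI[OF D.Units_eq])
  obtain a where a: "a \<in> carrier (Multiplicative_Group.mult_of ?D)" "carrier (Multiplicative_Group.mult_of ?D) = {a [^]\<^bsub>?D\<^esub> i | i::nat. i \<in> UNIV}"
    using D.finite_field_mult_group_has_gen[OF D.finite_carrier] by (elim bexE)
  have aD: "a \<in> carrier ?D" "a \<noteq> \<zero>" using a(1) by auto
  have aR: "a \<in> carrier R" "f \<otimes> a = a" "a \<otimes> f = a" using aD(1) corner_carrier[OF f] by auto
  have pow: "a [^]\<^bsub>?D\<^esub> Suc k = a [^] Suc k" for k :: nat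
    by (induction k) (simp_all add: aR)
  have "\<exists>k::nat. y = a [^] Suc k" if y: "y \<in> carrier ?D" "y \<noteq> \<zero>" for y
  proof -
    have "a \<in> Units ?D" using aD D.Units_eq by simp
    then obtain b where b: "b \<in> carrier ?D" "b \<otimes> a = f" by (auto simp: Units_def)
    have "y \<otimes> b \<noteq> \<zero>"
    proof
      assume "y \<otimes> b = \<zero>"
      then have "y \<otimes> (b \<otimes> a) = \<zero>" using D.m_assoc[OF y(1) b(1) aD(1)] aR by simp
      then show False using y D.r_one[OF y(1)] b by simp
    qed
    then have "y \<otimes> b \<in> carrier (Multiplicative_Group.mult_of ?D)" using D.m_closed[OF y(1) b(1)] by simp
    then obtain k :: nat where k: "y \<otimes> b = a [^]\<^bsub>?D\<^esub> k" using a(2) by auto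
    have "y = y \<otimes> (b \<otimes> a)" using D.r_one[OF y(1)] b by simp
    also have "\<dots> = y \<otimes> b \<otimes> a" using D.m_assoc[OF y(1) b(1) aD(1)] by simp
    also have "\<dots> = a [^]\<^bsub>?D\<^esub> Suc k" by (simp add: k)
    finally show ?thesis using pow by metis
  qed
  moreover have "f \<otimes> x \<otimes> f \<in> carrier ?D" if "x \<in> carrier R" for x
    using that by (auto simp: corner_def)
  ultimately show ?thesis using aR(1) by blast
qed

theorem ex_cyclic_basic_idempotents:
  "\<exists>E \<alpha>. finite E \<and> E \<subseteq> carrier R \<and> (\<forall>f\<in>E. f \<otimes> f = f \<and> \<alpha> f \<in> carrier R)
     \<and> (\<forall>f\<in>E. \<forall>g\<in>E. f \<noteq> g \<longrightarrow> (\<forall>x\<in>carrier R. f \<otimes> x \<otimes> g = \<zero>))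
     \<and> (\<forall>f\<in>E. \<forall>x\<in>carrier R. f \<otimes> x \<otimes> f = \<zero> \<or> (\<exists>k::nat. f \<otimes> x \<otimes> f = \<alpha> f [^] Suc k))
     \<and> (\<forall>S. ideal S R \<longrightarrow> E \<subseteq> S \<longrightarrow> \<one> \<in> S)"
proof -
  obtain E where E: "\<forall>f\<in>E. minimal_idempotent f"
    and orth: "\<forall>f\<in>E. \<forall>g\<in>E. f \<noteq> g \<longrightarrow> (\<forall>x\<in>carrier R. f \<otimes> x \<otimes> g = \<zero>)"
    and gen: "\<forall>S. ideal S R \<longrightarrow> E \<subseteq> S \<longrightarrow> \<one> \<in> S"
    using ex_basic_idempotents by (elim exE conjE)
  have EE: "E \<subseteq> carrier R" using E minimal_idempotentD(1) by auto
  obtain \<alpha> where "\<forall>f\<in>E. \<alpha> f \<in> carrier R \<and> (\<forall>x\<in>carrier R. f \<otimes> x \<otimes> f = \<zero> \<or> (\<exists>k::nat. f \<otimes> x \<otimes> f = \<alpha> f [^] Suc k))"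
    using bchoice[of E "\<lambda>f a. a \<in> carrier R \<and> (\<forall>x\<in>carrier R. f \<otimes> x \<otimes> f = \<zero> \<or> (\<exists>k::nat. f \<otimes> x \<otimes> f = a [^] Suc k))"]
      corner_cyclic E by (metis (no_types, lifting))
  then show ?thesis
    using EE finite_subset[OF EE finite_carrier] E minimal_idempotentD(3) orth gen
    by (intro exI[of _ E] exI[of _ \<alpha>]) simp
qed

end

section \<open>Group rings over p-adically complete rings\<close>

definition scalar :: "'r::idom \<Rightarrow> ('g::{group_add,finite} \<Rightarrow>\<^sub>0 'r)" where
  "scalar r = Poly_Mapping.single 0 r"

lemma lookup_mult_finite:
  fixes a b :: "'g::{group_add,finite} \<Rightarrow>\<^sub>0 'r::comm_ring_1"
  shows "Poly_Mapping.lookup (a * b) k = (\<Sum>l\<in>UNIV. Poly_Mapping.lookup a l * Poly_Mapping.lookup b (- l + k))"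
proof -
  have "(\<Sum>q. Poly_Mapping.lookup b q when k = l + q) = Poly_Mapping.lookup b (- l + k)" for l
  proof -
    have "(k = l + q) = (q = - l + k)" for q
      by (metis add_minus_cancel minus_add_cancel)
    then show ?thesis by simp
  qed
  then show ?thesis
    by (simp add: lookup_mult Sum_any.expand_superset[of UNIV])
qed

lemma lookup_scalar_mult: "Poly_Mapping.lookup (scalar r * a) g = r * Poly_Mapping.lookup a g"
  by (simp add: scalar_def lookup_mult_finite lookup_single when_def if_distrib[of "\<lambda>x. x * _"] cong: if_cong)

lemma lookup_mult_scalar: "Poly_Mapping.lookup (a * scalar r) g = r * Poly_Mapping.lookup a g"
proof -
  have "Poly_Mapping.lookup a l * Poly_Mapping.lookup (scalar r) (- l + g)
      = (if l = g then r * Poly_Mapping.lookup a g else 0)" for l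
  proof -
    have "(0 = - l + g) = (l = g)" by (metis add.right_neutral add_minus_cancel left_minus)
    then show ?thesis by (auto simp: scalar_def lookup_single when_def)
  qed
  then show ?thesis by (simp add: lookup_mult_finite)
qed

lemma scalar_commute: "scalar r * a = a * scalar r"
  by (rule poly_mapping_eqI) (simp only: lookup_scalar_mult lookup_mult_scalar)

lemma scalar_mult: "scalar (r * s) = scalar r * scalar s"
  by (rule poly_mapping_eqI) (simp add: lookup_scalar_mult, simp add: scalar_def lookup_single when_def)

definition of_int_coeffs :: "('g::{group_add,finite} \<Rightarrow>\<^sub>0 int) \<Rightarrow> ('g \<Rightarrow>\<^sub>0 'r::idom)" where
  "of_int_coeffs = Poly_Mapping.map of_int"

lemma lookup_of_int_coeffs: "Poly_Mapping.lookup (of_int_coeffs a) g = of_int (Poly_Mapping.lookup a g)"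
  by (simp add: of_int_coeffs_def map.rep_eq when_def)

lemma of_int_coeffs_add: "of_int_coeffs (a + b) = of_int_coeffs a + of_int_coeffs b"
  by (rule poly_mapping_eqI) (simp add: lookup_of_int_coeffs lookup_add)

lemma of_int_coeffs_diff: "of_int_coeffs (a - b) = of_int_coeffs a - of_int_coeffs b"
  by (rule poly_mapping_eqI) (simp add: lookup_of_int_coeffs lookup_minus)

lemma of_int_coeffs_mult: "of_int_coeffs (a * b) = of_int_coeffs a * of_int_coeffs b"
  by (rule poly_mapping_eqI) (simp add: lookup_of_int_coeffs lookup_mult_finite)

lemma of_int_coeffs_one: "of_int_coeffs 1 = 1"
  by (rule poly_mapping_eqI) (simp add: lookup_of_int_coeffs lookup_one when_def)

lemma of_int_coeffs_zero: "of_int_coeffs 0 = 0"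
  by (rule poly_mapping_eqI) (simp add: lookup_of_int_coeffs)

lemma of_int_coeffs_power: "of_int_coeffs (a ^ n) = of_int_coeffs a ^ n"
  by (induction n) (simp_all add: of_int_coeffs_one of_int_coeffs_mult)

lemma group_ring_expansion:
  fixes a :: "'g::{group_add,finite} \<Rightarrow>\<^sub>0 'r::idom"
  shows "a = (\<Sum>g\<in>UNIV. scalar (Poly_Mapping.lookup a g) * of_int_coeffs (Poly_Mapping.single g 1))"
proof (rule poly_mapping_eqI)
  fix h
  have "Poly_Mapping.lookup (\<Sum>g\<in>UNIV. scalar (Poly_Mapping.lookup a g) * of_int_coeffs (Poly_Mapping.single g 1)) h
      = (\<Sum>g\<in>UNIV. if g = h then Poly_Mapping.lookup a g else 0)"
    unfolding lookup_sum
    by (intro sum.cong) (auto simp: lookup_scalar_mult lookup_of_int_coeffs lookup_single when_def)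
  then show "Poly_Mapping.lookup a h
      = Poly_Mapping.lookup (\<Sum>g\<in>UNIV. scalar (Poly_Mapping.lookup a g) * of_int_coeffs (Poly_Mapping.single g 1)) h"
    by simp
qed

text \<open>
Scalars are central. Statements about \<open>b * a * c\<close> for all \<open>a\<close> therefore reduce to the case where \<open>a\<close> is
a group element and comes from the integral group ring.
\<close>

lemma sandwich_expansion:
  fixes a :: "'g::{group_add,finite} \<Rightarrow>\<^sub>0 'r::idom"
  shows "b * a * c = (\<Sum>g\<in>UNIV. scalar (Poly_Mapping.lookup a g) * (b * of_int_coeffs (Poly_Mapping.single g 1) * c))"
proof -
  have "b * a * c = (\<Sum>g\<in>UNIV. b * (scalar (Poly_Mapping.lookup a g) * of_int_coeffs (Poly_Mapping.single g 1)) * c)"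
    by (subst group_ring_expansion[of a]) (simp only: sum_distrib_left sum_distrib_right)
  also have "\<dots> = (\<Sum>g\<in>UNIV. scalar (Poly_Mapping.lookup a g) * (b * of_int_coeffs (Poly_Mapping.single g 1) * c))"
    by (simp only: mult.assoc[symmetric] scalar_commute[of _ b])
  finally show ?thesis .
qed

lemma adic_limit_exists:
  fixes s :: "nat \<Rightarrow> 'r::idom"
  assumes complete: "adically_complete p TYPE('r)"
    and s: "\<And>n. of_nat (p ^ n) dvd s (Suc n) - s n"
  shows "\<exists>t. \<forall>n. of_nat (p ^ n) dvd t - s n"
proof -
  define x where "x n = power_ideal p n +>\<^bsub>class_ring\<^esub> s n" for n
  have mem: "r \<in> power_ideal p n +>\<^bsub>class_ring\<^esub> u \<longleftrightarrow> of_nat (p ^ n) dvd r - u" for r u :: 'r and n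
  proof -
    have "r = (r - u) + u" by simp
    then show ?thesis by (auto simp: a_r_coset_def r_coset_def power_ideal_def)
  qed
  have "x n \<in> carrier ((class_ring :: 'r ring) Quot power_ideal p n)" for n
    by (auto simp: x_def FactRing_def A_RCOSETS_def RCOSETS_def a_r_coset_def)
  moreover have "x (Suc n) \<subseteq> x n" for n
  proof
    fix r assume "r \<in> x (Suc n)"
    then have "of_nat (p ^ Suc n) dvd r - s (Suc n)" unfolding x_def mem .
    then have "of_nat (p ^ n) dvd r - s (Suc n)" by (rule dvd_trans[rotated]) simp
    then have "of_nat (p ^ n) dvd (r - s (Suc n)) + (s (Suc n) - s n)" using s by (rule dvd_add)
    then show "r \<in> x n" unfolding x_def mem by simp
  qed
  ultimately have "x \<in> adic_limit p" unfolding adic_limit_def by blast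
  then have "x \<in> range (adic_map p)" using complete by (simp add: adically_complete_def bij_betw_def)
  then obtain t where t: "x = adic_map p t" by blast
  have "of_nat (p ^ n) dvd t - s n" for n
  proof -
    have "t \<in> adic_map p t n" unfolding adic_map_def mem by simp
    then show ?thesis unfolding t[symmetric] x_def mem .
  qed
  then show ?thesis by blast
qed

lemma adically_separated:
  fixes r :: "'r::idom"
  assumes complete: "adically_complete p TYPE('r)" and dvd: "\<And>n. of_nat (p ^ n) dvd r"
  shows "r = 0"
proof -
  have mem: "u \<in> power_ideal p n +>\<^bsub>class_ring\<^esub> v \<longleftrightarrow> of_nat (p ^ n) dvd u - v" for u v :: 'r and n
  proof -
    have "u = (u - v) + v" by simp
    then show ?thesis by (auto simp: a_r_coset_def r_coset_def power_ideal_def)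
  qed
  have "adic_map p r n = adic_map p 0 n" for n
  proof (rule Set.set_eqI)
    fix u
    have "u = (u - r) + r" by simp
    then show "u \<in> adic_map p r n \<longleftrightarrow> u \<in> adic_map p 0 n"
      unfolding adic_map_def mem using dvd[of n] dvd_add_left_iff[of "of_nat (p ^ n)" r "u - r"] by simp
  qed
  then have "adic_map p r = adic_map p 0" by (rule ext)
  then show ?thesis using complete by (simp add: adically_complete_def bij_betw_def inj_eq)
qed

lemma of_nat_mult_coeffs:
  fixes a :: "'g::{group_add,finite} \<Rightarrow>\<^sub>0 'r::idom"
  shows "(\<exists>b. a = scalar (of_nat k) * b) \<longleftrightarrow> (\<forall>g. of_nat k dvd Poly_Mapping.lookup a g)"
proof
  assume "\<forall>g. of_nat k dvd Poly_Mapping.lookup a g"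
  then have "\<exists>c. \<forall>g. Poly_Mapping.lookup a g = of_nat k * c g" unfolding dvd_def by (rule choice)
  then obtain c where c: "\<forall>g. Poly_Mapping.lookup a g = of_nat k * c g" by (rule exE)
  have "a = scalar (of_nat k) * Abs_poly_mapping c"
    by (rule poly_mapping_eqI) (simp add: lookup_scalar_mult c)
  then show "\<exists>b. a = scalar (of_nat k) * b" by blast
qed (auto simp: lookup_scalar_mult)

text \<open>
The inverse of \<open>1 + p x\<close> is the sum of the geometric series of \<open>- p x\<close>, which converges \<open>p\<close>-adically in
each coefficient.
\<close>

lemma p_in_jacobson_radical:
  assumes complete: "adically_complete p TYPE('r::idom)"
  shows "scalar (of_nat p) \<in> (jacobson_radical :: ('g::{group_add,finite} \<Rightarrow>\<^sub>0 'r) set)"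
proof -
  have "1 + scalar (of_nat p) * x \<in> units" for x :: "'g \<Rightarrow>\<^sub>0 'r"
  proof -
    define y where "y = - (scalar (of_nat p) * x)"
    define s where "s n = (\<Sum>i<n. y ^ i)" for n
    have pow: "y ^ n = scalar (of_nat (p ^ n)) * (- x) ^ n" for n
    proof (induction n)
      case (Suc n)
      have "y ^ Suc n = (scalar (of_nat p) * - x) * (scalar (of_nat (p ^ n)) * (- x) ^ n)"
        by (simp add: y_def Suc[unfolded y_def])
      also have "\<dots> = scalar (of_nat p) * ((- x) * scalar (of_nat (p ^ n))) * (- x) ^ n"
        by (simp only: mult.assoc)
      also have "\<dots> = scalar (of_nat p) * scalar (of_nat (p ^ n)) * ((- x) * (- x) ^ n)"
        unfolding scalar_commute[of _ "- x", symmetric] by (simp only: mult.assoc)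
      finally show ?case by (simp add: scalar_mult mult.assoc)
    qed (simp add: scalar_def)
    have sSuc: "s (Suc n) = s n + y ^ n" for n by (simp add: s_def)
    have geo1: "(1 - y) * s n = 1 - y ^ n" for n
    proof (induction n)
      case (Suc n)
      have "(1 - y) * s (Suc n) = (1 - y) * s n + (y ^ n - y * y ^ n)"
        unfolding sSuc distrib_left by (simp add: left_diff_distrib)
      then show ?case by (simp add: Suc)
    qed (simp add: s_def)
    have geo2: "s n * (1 - y) = 1 - y ^ n" for n
    proof (induction n)
      case (Suc n)
      have "s (Suc n) * (1 - y) = s n * (1 - y) + (y ^ n - y * y ^ n)"
        unfolding sSuc distrib_right by (simp add: right_diff_distrib power_commutes)
      then show ?case by (simp add: Suc)
    qed (simp add: s_def)
    have "\<exists>t. \<forall>n. of_nat (p ^ n) dvd t - Poly_Mapping.lookup (s n) g" for g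
    proof (rule adic_limit_exists[OF complete])
      fix n
      have "s (Suc n) - s n = scalar (of_nat (p ^ n)) * (- x) ^ n" by (simp add: s_def pow)
      then have "Poly_Mapping.lookup (s (Suc n)) g - Poly_Mapping.lookup (s n) g
          = of_nat (p ^ n) * Poly_Mapping.lookup ((- x) ^ n) g"
        by (simp only: lookup_minus[symmetric] lookup_scalar_mult[symmetric])
      then show "of_nat (p ^ n) dvd Poly_Mapping.lookup (s (Suc n)) g - Poly_Mapping.lookup (s n) g"
        by simp
    qed
    then have "\<exists>c. \<forall>g. \<forall>n. of_nat (p ^ n) dvd c g - Poly_Mapping.lookup (s n) g" by (intro choice allI)
    then obtain c where c: "\<forall>g. \<forall>n. of_nat (p ^ n) dvd c g - Poly_Mapping.lookup (s n) g" by (rule exE)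
    define t where "t = Abs_poly_mapping c"
    have t: "Poly_Mapping.lookup t g = c g" for g by (simp add: t_def)
    have "\<exists>b. t - s n = scalar (of_nat (p ^ n)) * b" for n
      unfolding of_nat_mult_coeffs using c by (simp add: lookup_minus t)
    then have "\<exists>b. \<forall>n. t - s n = scalar (of_nat (p ^ n)) * b n" by (intro choice allI)
    then obtain b where "\<forall>n. t - s n = scalar (of_nat (p ^ n)) * b n" by (rule exE)
    then have b: "\<And>n. t - s n = scalar (of_nat (p ^ n)) * b n" by simp
    have zero: "z = 0" if "\<And>n. \<exists>b. z = scalar (of_nat (p ^ n)) * b" for z :: "'g \<Rightarrow>\<^sub>0 'r"
      using that unfolding of_nat_mult_coeffs
      by (intro poly_mapping_eqI) (simp add: adically_separated[OF complete])
    have "(1 - y) * t - 1 = 0"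
    proof (rule zero)
      fix n
      have "(1 - y) * t - 1 = (1 - y) * (t - s n) - y ^ n" using geo1[of n] by (simp add: algebra_simps)
      also have "(1 - y) * (t - s n) = scalar (of_nat (p ^ n)) * ((1 - y) * b n)"
        unfolding b by (simp only: mult.assoc[symmetric] scalar_commute[of _ "1 - y"])
      also have "\<dots> - y ^ n = scalar (of_nat (p ^ n)) * ((1 - y) * b n - (- x) ^ n)"
        unfolding pow by (rule right_diff_distrib[symmetric])
      finally show "\<exists>b. (1 - y) * t - 1 = scalar (of_nat (p ^ n)) * b" by blast
    qed
    moreover have "t * (1 - y) - 1 = 0"
    proof (rule zero)
      fix n
      have "t * (1 - y) - 1 = (t - s n) * (1 - y) - y ^ n" using geo2[of n] by (simp add: algebra_simps)
      also have "(t - s n) * (1 - y) = scalar (of_nat (p ^ n)) * (b n * (1 - y))"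
        unfolding b by (rule mult.assoc)
      also have "\<dots> - y ^ n = scalar (of_nat (p ^ n)) * (b n * (1 - y) - (- x) ^ n)"
        unfolding pow by (rule right_diff_distrib[symmetric])
      finally show "\<exists>b. t * (1 - y) - 1 = scalar (of_nat (p ^ n)) * b" by blast
    qed
    ultimately show ?thesis unfolding units_iff by (intro exI[of _ t]) (simp add: y_def)
  qed
  then show ?thesis by (simp add: jacobson_radical_def)
qed

text \<open>
If \<open>a y a\<close> is in the radical for all \<open>y\<close>, then \<open>(1 + a y) (1 - a y)\<close> is congruent to \<open>1\<close>.
\<close>

lemma jacobson_semiprime:
  fixes a :: "'g::{group_add,finite} \<Rightarrow>\<^sub>0 'r::idom"
  assumes "\<And>g. a * of_int_coeffs (Poly_Mapping.single g 1) * a \<in> jacobson_radical"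
  shows "a \<in> jacobson_radical"
proof -
  have aya: "a * y * a \<in> jacobson_radical" for y
    unfolding sandwich_expansion[of a y a] by (intro jacobson_sum jacobson_mult_left assms)
  have "1 + a * y \<in> units" for y
  proof -
    have sq: "- (a * y * (a * y)) \<in> jacobson_radical"
      using jacobson_uminus[OF jacobson_mult_right[OF aya[of y], of y]] by (simp add: mult.assoc)
    show ?thesis
      by (rule unit_mod_jacobson[of _ "1 - a * y"]) (use sq in \<open>simp_all add: algebra_simps\<close>)
  qed
  then show ?thesis by (simp add: jacobson_radical_def)
qed

definition int_radical :: "'r::idom itself \<Rightarrow> ('g::{group_add,finite} \<Rightarrow>\<^sub>0 int) set" where
  "int_radical _ = {x. (of_int_coeffs x :: 'g \<Rightarrow>\<^sub>0 'r) \<in> jacobson_radical}"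

lemma int_radical_iff:
  "x - y \<in> int_radical TYPE('r::idom) \<longleftrightarrow> rad_cong (of_int_coeffs x :: 'g::{group_add,finite} \<Rightarrow>\<^sub>0 'r) (of_int_coeffs y)"
  by (simp add: int_radical_def rad_cong_def of_int_coeffs_diff)

lemma ring_class_ring: "ring (class_ring :: 'a::ring_1 ring)"
  by (rule class_ring.ring_axioms)

lemma int_radical_ideal: "ideal (int_radical TYPE('r::idom)) (class_ring :: ('g::{group_add,finite} \<Rightarrow>\<^sub>0 int) ring)"
  by (rule ring.ideal_if_closed[OF ring_class_ring])
    (auto simp: int_radical_def of_int_coeffs_add of_int_coeffs_mult of_int_coeffs_zero
      jacobson_zero jacobson_add jacobson_mult_left jacobson_mult_right)

text \<open>
The image of \<open>\<int>[G]\<close> in \<open>R[G]\<close> modulo the radical, which it spans over \<open>R\<close>. When \<open>p\<close> lies in the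
radical, this image is finite even if the residue rings of \<open>R\<close> are not.
\<close>

definition int_quotient :: "'r::idom itself \<Rightarrow> ('g::{group_add,finite} \<Rightarrow>\<^sub>0 int) set ring" where
  "int_quotient R = class_ring Quot int_radical R"

definition int_class :: "'r::idom itself \<Rightarrow> ('g::{group_add,finite} \<Rightarrow>\<^sub>0 int) \<Rightarrow> ('g \<Rightarrow>\<^sub>0 int) set" where
  "int_class R a = int_radical R +>\<^bsub>class_ring\<^esub> a"

lemma int_class_eq_iff:
  "int_class TYPE('r::idom) a = int_class TYPE('r) b
    \<longleftrightarrow> rad_cong (of_int_coeffs a :: 'g::{group_add,finite} \<Rightarrow>\<^sub>0 'r) (of_int_coeffs b)"
proof -
  have "\<ominus>\<^bsub>class_ring\<^esub> b = - b"
    by (rule abelian_group.minus_equality[OF ring.is_abelian_group[OF ring_class_ring]]) simp_all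
  then have "a \<ominus>\<^bsub>class_ring\<^esub> b = a - b" by (simp add: a_minus_def)
  then show ?thesis
    using ring.quotient_eq_iff_same_a_r_cos[OF ring_class_ring int_radical_ideal[where 'r = 'r], of a b]
    by (simp add: int_class_def int_radical_iff)
qed

lemma int_quotient_carrier: "carrier (int_quotient R) = range (int_class R)"
  by (auto simp: int_quotient_def int_class_def FactRing_def A_RCOSETS_def RCOSETS_def a_r_coset_def)

lemma int_quotient_ring: "ring (int_quotient TYPE('r::idom) :: ('g::{group_add,finite} \<Rightarrow>\<^sub>0 int) set ring)"
  unfolding int_quotient_def by (rule ideal.quotient_is_ring[OF int_radical_ideal])

lemma int_class_hom:
  fixes a b :: "'g::{group_add,finite} \<Rightarrow>\<^sub>0 int"
  shows "int_class TYPE('r::idom) a \<otimes>\<^bsub>int_quotient TYPE('r)\<^esub> int_class TYPE('r) b = int_class TYPE('r) (a * b)"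
    "int_class TYPE('r) a \<oplus>\<^bsub>int_quotient TYPE('r)\<^esub> int_class TYPE('r) b = int_class TYPE('r) (a + b)"
    "\<one>\<^bsub>int_quotient TYPE('r)\<^esub> = int_class TYPE('r) (1 :: 'g \<Rightarrow>\<^sub>0 int)"
    "\<zero>\<^bsub>int_quotient TYPE('r)\<^esub> = int_class TYPE('r) (0 :: 'g \<Rightarrow>\<^sub>0 int)"
proof -
  have hom: "(+>\<^bsub>class_ring\<^esub>) (int_radical TYPE('r)) \<in> Ring.ring_hom class_ring (int_quotient TYPE('r) :: ('g \<Rightarrow>\<^sub>0 int) set ring)"
    unfolding int_quotient_def by (rule ideal.rcos_ring_hom[OF int_radical_ideal])
  show mult: "int_class TYPE('r) a \<otimes>\<^bsub>int_quotient TYPE('r)\<^esub> int_class TYPE('r) b = int_class TYPE('r) (a * b)"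
    using ring_hom_mult[OF hom, of a b] by (simp add: int_class_def)
  show add: "int_class TYPE('r) a \<oplus>\<^bsub>int_quotient TYPE('r)\<^esub> int_class TYPE('r) b = int_class TYPE('r) (a + b)"
    for a b :: "'g \<Rightarrow>\<^sub>0 int"
    using ring_hom_add[OF hom, of a b] by (simp add: int_class_def)
  show "\<one>\<^bsub>int_quotient TYPE('r)\<^esub> = int_class TYPE('r) (1 :: 'g \<Rightarrow>\<^sub>0 int)"
    using ring_hom_one[OF hom] by (simp add: int_class_def)
  interpret ring "int_quotient TYPE('r) :: ('g \<Rightarrow>\<^sub>0 int) set ring" by (rule int_quotient_ring)
  have c: "int_class TYPE('r) (0 :: 'g \<Rightarrow>\<^sub>0 int) \<in> carrier (int_quotient TYPE('r))"
    by (simp add: int_quotient_carrier)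
  show "\<zero>\<^bsub>int_quotient TYPE('r)\<^esub> = int_class TYPE('r) (0 :: 'g \<Rightarrow>\<^sub>0 int)"
    using add[of 0 0] c by (metis add.l_cancel_one' add_0 zero_closed)
qed

lemma int_class_power:
  fixes a :: "'g::{group_add,finite} \<Rightarrow>\<^sub>0 int"
  shows "int_class TYPE('r::idom) a [^]\<^bsub>int_quotient TYPE('r)\<^esub> (k::nat) = int_class TYPE('r) (a ^ k)"
proof -
  interpret ring "int_quotient TYPE('r) :: ('g \<Rightarrow>\<^sub>0 int) set ring" by (rule int_quotient_ring)
  show ?thesis by (induction k) (simp_all add: int_class_hom power_commutes)
qed

lemma int_quotient_finite_semiprime:
  assumes p: "p > 0" and complete: "adically_complete p TYPE('r::idom)"
  shows "finite_semiprime_ring (int_quotient TYPE('r) :: ('g::{group_add,finite} \<Rightarrow>\<^sub>0 int) set ring)"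
proof -
  let ?h = "int_class TYPE('r) :: ('g \<Rightarrow>\<^sub>0 int) \<Rightarrow> _"
  interpret ring "int_quotient TYPE('r) :: ('g \<Rightarrow>\<^sub>0 int) set ring" by (rule int_quotient_ring)
  define Box where "Box = {a :: 'g \<Rightarrow>\<^sub>0 int. \<forall>g. Poly_Mapping.lookup a g \<in> {0..<int p}}"
  have "finite {f :: 'g \<Rightarrow> int. \<forall>g. f g \<in> {0..<int p}}"
    using finite_PiE[of "UNIV :: 'g set" "\<lambda>_. {0..<int p}"] by (simp add: PiE_def Pi_def)
  moreover have "Poly_Mapping.lookup ` Box \<subseteq> {f. \<forall>g. f g \<in> {0..<int p}}" by (auto simp: Box_def)
  ultimately have "finite (Poly_Mapping.lookup ` Box)" by (rule finite_subset[rotated])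
  then have Box: "finite Box"
    by (rule finite_imageD) (rule inj_onI, rule poly_mapping_eqI, simp)
  \<comment> \<open>Coefficients may be reduced modulo \<open>p\<close>, because \<open>p\<close> lies in the radical.\<close>
  have "?h a \<in> ?h ` Box" for a
  proof -
    define b where "b = Abs_poly_mapping (\<lambda>g. Poly_Mapping.lookup a g mod int p)"
    have b: "Poly_Mapping.lookup b g = Poly_Mapping.lookup a g mod int p" for g by (simp add: b_def)
    have "b \<in> Box" using p by (simp add: Box_def b)
    have "\<forall>g. of_nat p dvd Poly_Mapping.lookup (of_int_coeffs a - of_int_coeffs b :: 'g \<Rightarrow>\<^sub>0 'r) g"
    proof
      fix g
      have "Poly_Mapping.lookup (of_int_coeffs a - of_int_coeffs b :: 'g \<Rightarrow>\<^sub>0 'r) g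
          = of_int (int p * (Poly_Mapping.lookup a g div int p))"
        by (simp only: lookup_minus lookup_of_int_coeffs b of_int_diff[symmetric] minus_mod_eq_mult_div)
      then show "of_nat p dvd Poly_Mapping.lookup (of_int_coeffs a - of_int_coeffs b :: 'g \<Rightarrow>\<^sub>0 'r) g" by simp
    qed
    then obtain c where "of_int_coeffs a - of_int_coeffs b = scalar (of_nat p :: 'r) * c"
      using of_nat_mult_coeffs by blast
    then have "rad_cong (of_int_coeffs a) (of_int_coeffs b :: 'g \<Rightarrow>\<^sub>0 'r)"
      using jacobson_mult_right[OF p_in_jacobson_radical[OF complete]] by (simp add: rad_cong_def)
    then have "?h a = ?h b" by (simp add: int_class_eq_iff)
    then show ?thesis using \<open>b \<in> Box\<close> by simp
  qed
  then have "carrier (int_quotient TYPE('r) :: ('g \<Rightarrow>\<^sub>0 int) set ring) \<subseteq> ?h ` Box"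
    by (auto simp: int_quotient_carrier)
  then have fin: "finite (carrier (int_quotient TYPE('r) :: ('g \<Rightarrow>\<^sub>0 int) set ring))"
    using Box by (rule finite_subset[OF _ finite_imageI])
  show ?thesis
  proof
    show "finite (carrier (int_quotient TYPE('r) :: ('g \<Rightarrow>\<^sub>0 int) set ring))" by (rule fin)
    fix x :: "('g \<Rightarrow>\<^sub>0 int) set"
    assume "x \<in> carrier (int_quotient TYPE('r))"
      and x: "\<And>y. y \<in> carrier (int_quotient TYPE('r)) \<Longrightarrow>
        x \<otimes>\<^bsub>int_quotient TYPE('r)\<^esub> y \<otimes>\<^bsub>int_quotient TYPE('r)\<^esub> x = \<zero>\<^bsub>int_quotient TYPE('r)\<^esub>"
    then obtain a where a: "x = ?h a" by (auto simp: int_quotient_carrier)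
    have "of_int_coeffs a * of_int_coeffs (Poly_Mapping.single g 1) * of_int_coeffs a
        \<in> (jacobson_radical :: ('g \<Rightarrow>\<^sub>0 'r) set)" for g
      using x[of "?h (Poly_Mapping.single g 1)"] unfolding a int_class_hom int_class_eq_iff
      by (simp add: int_quotient_carrier rad_cong_def of_int_coeffs_zero of_int_coeffs_mult)
    then have "(of_int_coeffs a :: 'g \<Rightarrow>\<^sub>0 'r) \<in> jacobson_radical" by (rule jacobson_semiprime)
    then show "x = \<zero>\<^bsub>int_quotient TYPE('r)\<^esub>"
      unfolding a int_class_hom int_class_eq_iff by (simp add: rad_cong_def of_int_coeffs_zero)
  qed
qed

text \<open>
Substitution into a polynomial is a homomorphism although the group ring is not commutative, because
the coefficients are central.
\<close>

definition eval_at :: "('g::{group_add,finite} \<Rightarrow>\<^sub>0 'r::idom) \<Rightarrow> 'r poly \<Rightarrow> ('g \<Rightarrow>\<^sub>0 'r)" where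
  "eval_at a q = (\<Sum>i\<le>degree q. scalar (coeff q i) * a ^ i)"

lemma scalar_zero: "scalar 0 = 0"
  by (simp add: scalar_def)

lemma scalar_one: "scalar 1 = 1"
  by (simp add: scalar_def)

lemma scalar_add: "scalar (r + s) = scalar r + scalar s"
  by (simp add: scalar_def single_add)

lemma eval_at_bound:
  assumes "degree q \<le> n"
  shows "eval_at a q = (\<Sum>i\<le>n. scalar (coeff q i) * a ^ i)"
  unfolding eval_at_def using assms
  by (intro sum.mono_neutral_left) (auto simp: coeff_eq_0 scalar_zero)

lemma eval_at_add: "eval_at a (p + q) = eval_at a p + eval_at a q"
proof -
  define n where "n = max (degree p) (degree q)"
  have "degree (p + q) \<le> n" "degree p \<le> n" "degree q \<le> n"
    by (simp_all add: n_def degree_add_le_max)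
  then show ?thesis
    by (simp add: eval_at_bound[of _ n] scalar_add distrib_right sum.distrib)
qed

lemma eval_at_smult: "eval_at a (Polynomial.smult c q) = scalar c * eval_at a q"
proof -
  have "eval_at a (Polynomial.smult c q) = (\<Sum>i\<le>degree q. scalar (coeff (Polynomial.smult c q) i) * a ^ i)"
    by (rule eval_at_bound) (rule degree_smult_le)
  then show ?thesis by (simp add: eval_at_def scalar_mult sum_distrib_left mult.assoc)
qed

lemma eval_at_pCons: "eval_at a (pCons c q) = scalar c + a * eval_at a q"
proof -
  have "eval_at a (pCons c q) = (\<Sum>i\<le>Suc (degree q). scalar (coeff (pCons c q) i) * a ^ i)"
    by (rule eval_at_bound) (rule degree_pCons_le)
  also have "\<dots> = scalar c + (\<Sum>i\<le>degree q. scalar (coeff q i) * (a * a ^ i))"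
    by (subst sum.atMost_Suc_shift) simp
  also have "(\<Sum>i\<le>degree q. scalar (coeff q i) * (a * a ^ i)) = a * eval_at a q"
    unfolding eval_at_def sum_distrib_left
    by (intro sum.cong refl) (simp only: mult.assoc[symmetric] scalar_commute[of _ a])
  finally show ?thesis .
qed

lemma eval_at_zero: "eval_at a 0 = 0"
  by (simp add: eval_at_def scalar_zero)

lemma eval_at_one: "eval_at a 1 = 1"
  by (simp add: eval_at_def scalar_one)

lemma eval_at_mult: "eval_at a (p * q) = eval_at a p * eval_at a q"
proof (induction p)
  case (pCons c p)
  have "eval_at a (pCons c p * q) = scalar c * eval_at a q + a * (eval_at a p * eval_at a q)"
    by (simp add: mult_pCons_left eval_at_add eval_at_smult eval_at_pCons scalar_zero pCons eval_at_zero)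
  then show ?case by (simp add: eval_at_pCons distrib_right mult.assoc)
qed (simp add: eval_at_zero)

lemma eval_at_monom: "eval_at a (Polynomial.monom 1 k) = a ^ k"
  by (induction k) (simp_all add: eval_at_one monom_0 monom_Suc eval_at_pCons scalar_zero scalar_one eval_at_zero)

lemma eval_at_sum: "eval_at a (\<Sum>x\<in>S. f x) = (\<Sum>x\<in>S. eval_at a (f x))"
  by (induction S rule: infinite_finite_induct) (simp_all add: eval_at_zero eval_at_add)

text \<open>
The basic idempotents of \<open>int_quotient\<close> and the generators of their corners are lifted to arbitrary
elements of \<open>\<int>[G]\<close>. By \<open>sandwich_expansion\<close> each corner of \<open>R[G]\<close> is spanned over \<open>R\<close>, modulo the
radical, by powers of one element, so that \<open>ev f\<close> can be substitution of that element into polynomials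
over \<open>R\<close>. The idempotents generate the unit ideal, and this is the decomposition of \<open>1\<close> that
\<open>det_of_unit_GL\<close> needs.
\<close>

theorem det_of_unit_group_ring:
  fixes M :: "('g::{group_add,finite} \<Rightarrow>\<^sub>0 'r::idom) mat"
  assumes p: "p > 0" and complete: "adically_complete p TYPE('r)"
    and char0: "inj (of_nat :: nat \<Rightarrow> 'k::field)" and M: "M \<in> GL_fin n"
  shows "det_of_unit TYPE('k) M"
proof -
  let ?F = "int_quotient TYPE('r) :: ('g \<Rightarrow>\<^sub>0 int) set ring"
  let ?h = "int_class TYPE('r) :: ('g \<Rightarrow>\<^sub>0 int) \<Rightarrow> _"
  let ?\<iota> = "of_int_coeffs :: ('g \<Rightarrow>\<^sub>0 int) \<Rightarrow> ('g \<Rightarrow>\<^sub>0 'r)"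
  interpret F: finite_semiprime_ring ?F by (rule int_quotient_finite_semiprime[OF p complete])
  obtain E \<alpha> where E: "finite E" "E \<subseteq> carrier ?F"
    and "\<forall>f\<in>E. f \<otimes>\<^bsub>?F\<^esub> f = f \<and> \<alpha> f \<in> carrier ?F"
    and "\<forall>f\<in>E. \<forall>g\<in>E. f \<noteq> g \<longrightarrow> (\<forall>x\<in>carrier ?F. f \<otimes>\<^bsub>?F\<^esub> x \<otimes>\<^bsub>?F\<^esub> g = \<zero>\<^bsub>?F\<^esub>)"
    and "\<forall>f\<in>E. \<forall>x\<in>carrier ?F. f \<otimes>\<^bsub>?F\<^esub> x \<otimes>\<^bsub>?F\<^esub> f = \<zero>\<^bsub>?F\<^esub>
        \<or> (\<exists>k::nat. f \<otimes>\<^bsub>?F\<^esub> x \<otimes>\<^bsub>?F\<^esub> f = \<alpha> f [^]\<^bsub>?F\<^esub> Suc k)"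
    and "\<forall>S. ideal S ?F \<longrightarrow> E \<subseteq> S \<longrightarrow> \<one>\<^bsub>?F\<^esub> \<in> S"
    using F.ex_cyclic_basic_idempotents by (elim exE conjE)
  note idem = this(3)[rule_format] and orth = this(4)[rule_format] and cyc = this(5)[rule_format]
    and gen = this(6)[rule_format]
  define l where "l x = (SOME a. ?h a = x)" for x
  have l: "?h (l x) = x" if x: "x \<in> carrier ?F" for x
  proof -
    obtain a where "?h a = x" using x by (auto simp: int_quotient_carrier)
    then show ?thesis unfolding l_def by (rule someI)
  qed
  have hc: "?h a \<in> carrier ?F" for a by (simp add: int_quotient_carrier)
  define e where "e f = ?\<iota> (l f)" for f
  define ev where "ev f = eval_at (?\<iota> (l (\<alpha> f)))" for f
  have lE: "?h (l f) = f" if "f \<in> E" for f using l E(2) that by blast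
  interpret basic_set E e ev
  proof
    fix f assume f: "f \<in> E"
    fix a :: "'g \<Rightarrow>\<^sub>0 'r"
    {
      fix g assume g: "g \<in> E" "f \<noteq> g"
      have "rad_cong (e f * ?\<iota> (Poly_Mapping.single s 1) * e g) 0" for s
      proof -
        have "?h (l f * Poly_Mapping.single s 1 * l g) = ?h 0"
        proof -
          have "?h (l f * Poly_Mapping.single s 1 * l g) = f \<otimes>\<^bsub>?F\<^esub> ?h (Poly_Mapping.single s 1) \<otimes>\<^bsub>?F\<^esub> g"
            by (simp only: int_class_hom(1)[symmetric] lE[OF f] lE[OF g(1)])
          also have "\<dots> = \<zero>\<^bsub>?F\<^esub>" by (rule orth[OF f g hc])
          also have "\<dots> = ?h 0" by (rule int_class_hom(4))
          finally show ?thesis .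
        qed
        then show ?thesis by (simp add: int_class_eq_iff of_int_coeffs_mult of_int_coeffs_zero e_def)
      qed
      then have mem: "e f * ?\<iota> (Poly_Mapping.single s 1) * e g \<in> jacobson_radical" for s
        by (simp add: rad_cong_def)
      have "e f * a * e g \<in> jacobson_radical"
        unfolding sandwich_expansion[of "e f" a] by (rule jacobson_sum, rule jacobson_mult_left, rule mem)
      then show "rad_cong (e f * a * e g) 0" by (simp add: rad_cong_def)
    }
    have "\<exists>q. rad_cong (ev f q) (e f * ?\<iota> (Poly_Mapping.single s 1) * e f)" for s
    proof -
      let ?x = "l f * Poly_Mapping.single s 1 * l f"
      have h: "?h ?x = f \<otimes>\<^bsub>?F\<^esub> ?h (Poly_Mapping.single s 1) \<otimes>\<^bsub>?F\<^esub> f"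
        by (simp only: int_class_hom(1)[symmetric] lE[OF f])
      have x: "?\<iota> ?x = e f * ?\<iota> (Poly_Mapping.single s 1) * e f"
        by (simp add: of_int_coeffs_mult e_def)
      show ?thesis
      proof (cases "f \<otimes>\<^bsub>?F\<^esub> ?h (Poly_Mapping.single s 1) \<otimes>\<^bsub>?F\<^esub> f = \<zero>\<^bsub>?F\<^esub>")
        case True
        then have "?h 0 = ?h ?x" by (simp only: h int_class_hom(4))
        then have "rad_cong (ev f 0) (?\<iota> ?x)"
          unfolding int_class_eq_iff by (simp add: ev_def eval_at_zero of_int_coeffs_zero)
        then show ?thesis unfolding x by blast
      next
        case False
        with cyc[OF f hc[of "Poly_Mapping.single s 1"]] obtain k :: nat
          where "f \<otimes>\<^bsub>?F\<^esub> ?h (Poly_Mapping.single s 1) \<otimes>\<^bsub>?F\<^esub> f = \<alpha> f [^]\<^bsub>?F\<^esub> Suc k"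
          by blast
        then have "?h (l (\<alpha> f) ^ Suc k) = ?h ?x"
          using l[OF conjunct2[OF idem[OF f]]] by (simp only: h int_class_power[symmetric])
        then have "rad_cong (ev f (Polynomial.monom 1 (Suc k))) (?\<iota> ?x)"
          unfolding int_class_eq_iff ev_def eval_at_monom of_int_coeffs_power .
        then show ?thesis unfolding x by blast
      qed
    qed
    then have "\<exists>q. \<forall>s. rad_cong (ev f (q s)) (e f * ?\<iota> (Poly_Mapping.single s 1) * e f)"
      by (intro choice allI)
    then obtain q where q: "\<forall>s. rad_cong (ev f (q s)) (e f * ?\<iota> (Poly_Mapping.single s 1) * e f)" by (rule exE)
    have "rad_cong (ev f (\<Sum>s\<in>UNIV. Polynomial.smult (Poly_Mapping.lookup a s) (q s))) (e f * a * e f)"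
      unfolding sandwich_expansion[of "e f" a] ev_def eval_at_sum eval_at_smult
      by (intro rad_cong_sum rad_cong_mult rad_cong_refl) (use q in \<open>simp add: ev_def\<close>)
    then show "\<exists>q. rad_cong (ev f q) (e f * a * e f)" by blast
  qed (simp_all add: E(1) ev_def eval_at_one eval_at_add eval_at_mult)
  \<comment> \<open>\<open>T\<close> is the two-sided ideal generated by the \<open>e f * e f\<close> and the radical. The corresponding
    ideal \<open>S\<close> of the finite quotient contains all of \<open>E\<close>.\<close>
  define t where "t = (\<lambda>(r, f, s). r * e f * (e f * s))"
  define T where "T b \<longleftrightarrow> (\<exists>xs. (\<forall>(r, f, s)\<in>set xs. f \<in> E) \<and> rad_cong (sum_list (map t xs)) b)" for b
  have T0: "T 0" unfolding T_def by (intro exI[of _ "[]"]) simp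
  have Tadd: "T (b + c)" if bc: "T b" "T c" for b c
  proof -
    obtain xs ys where "\<forall>(r, f, s)\<in>set xs. f \<in> E" "rad_cong (sum_list (map t xs)) b"
      "\<forall>(r, f, s)\<in>set ys. f \<in> E" "rad_cong (sum_list (map t ys)) c"
      using bc unfolding T_def by (elim exE conjE)
    then show ?thesis unfolding T_def
      by (intro exI[of _ "xs @ ys"]) (auto intro: rad_cong_add)
  qed
  have Tl: "T (c * b)" if b: "T b" for b c
  proof -
    obtain xs where xs: "\<forall>(r, f, s)\<in>set xs. f \<in> E" "rad_cong (sum_list (map t xs)) b"
      using b unfolding T_def by (elim exE conjE)
    have "sum_list (map t (map (\<lambda>(r, f, s). (c * r, f, s)) ys)) = c * sum_list (map t ys)" for ys
      by (induction ys) (auto simp: t_def distrib_left mult.assoc)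
    then show ?thesis unfolding T_def using xs rad_cong_mult[OF rad_cong_refl xs(2)]
      by (intro exI[of _ "map (\<lambda>(r, f, s). (c * r, f, s)) xs"]) auto
  qed
  have Tr: "T (b * c)" if b: "T b" for b c
  proof -
    obtain xs where xs: "\<forall>(r, f, s)\<in>set xs. f \<in> E" "rad_cong (sum_list (map t xs)) b"
      using b unfolding T_def by (elim exE conjE)
    have "sum_list (map t (map (\<lambda>(r, f, s). (r, f, s * c)) ys)) = sum_list (map t ys) * c" for ys
      by (induction ys) (auto simp: t_def distrib_right mult.assoc)
    then show ?thesis unfolding T_def using xs rad_cong_mult[OF xs(2) rad_cong_refl]
      by (intro exI[of _ "map (\<lambda>(r, f, s). (r, f, s * c)) xs"]) auto
  qed
  have Tcong: "T c" if b: "T b" and bc: "rad_cong b c" for b c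
  proof -
    obtain xs where "\<forall>(r, f, s)\<in>set xs. f \<in> E" "rad_cong (sum_list (map t xs)) b"
      using b unfolding T_def by (elim exE conjE)
    then show ?thesis unfolding T_def
      by (intro exI[of _ xs] conjI rad_cong_trans[OF _ bc])
  qed
  define S where "S = {x \<in> carrier ?F. T (?\<iota> (l x))}"
  have TS: "?h a \<in> S \<longleftrightarrow> T (?\<iota> a)" for a
  proof -
    have c: "rad_cong (?\<iota> (l (?h a))) (?\<iota> a)" using l[OF hc[of a]] unfolding int_class_eq_iff .
    show ?thesis using Tcong[OF _ c] Tcong[OF _ rad_cong_sym[OF c]] hc[of a] unfolding S_def by blast
  qed
  have "ideal S ?F"
  proof (rule F.ideal_if_closed)
    show "S \<subseteq> carrier ?F" by (auto simp: S_def)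
    show "\<zero>\<^bsub>?F\<^esub> \<in> S" by (simp add: int_class_hom TS of_int_coeffs_zero T0)
    fix x assume x: "x \<in> S"
    then obtain a where a: "x = ?h a" by (auto simp: S_def int_quotient_carrier)
    {
      fix y assume y: "y \<in> S"
      then obtain b where b: "y = ?h b" by (auto simp: S_def int_quotient_carrier)
      show "x \<oplus>\<^bsub>?F\<^esub> y \<in> S"
        using x y Tadd by (simp add: a b int_class_hom TS of_int_coeffs_add)
    }
    fix y assume "y \<in> carrier ?F"
    then obtain b where b: "y = ?h b" by (auto simp: int_quotient_carrier)
    show "y \<otimes>\<^bsub>?F\<^esub> x \<in> S" "x \<otimes>\<^bsub>?F\<^esub> y \<in> S"
      using x Tl Tr by (simp_all add: a b int_class_hom TS of_int_coeffs_mult)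
  qed
  moreover have "E \<subseteq> S"
  proof
    fix f assume f: "f \<in> E"
    have "?h (l f * l f) = ?h (l f)"
      using idem[OF f] by (simp only: int_class_hom(1)[symmetric] lE[OF f])
    then have "rad_cong (sum_list (map t [(1, f, 1)])) (?\<iota> (l f))"
      unfolding int_class_eq_iff by (simp add: t_def e_def of_int_coeffs_mult)
    then have "T (?\<iota> (l f))" unfolding T_def by (intro exI[of _ "[(1, f, 1)]"]) (simp add: f)
    then show "f \<in> S" using E(2) f by (auto simp: S_def)
  qed
  ultimately have "?h 1 \<in> S" unfolding int_class_hom(3)[symmetric] by (rule gen)
  then have "T 1" unfolding TS of_int_coeffs_one .
  then obtain xs where xs: "\<forall>(r, f, s)\<in>set xs. f \<in> E" "rad_cong (sum_list (map t xs)) 1"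
    unfolding T_def by (elim exE conjE)
  have "sum_list (map t xs)
      = (\<Sum>j\<in>{0..<length xs}. fst (xs ! j) * e (fst (snd (xs ! j))) * (e (fst (snd (xs ! j))) * snd (snd (xs ! j))))"
    by (simp add: sum_list_sum_nth t_def case_prod_unfold)
  then show ?thesis
    using xs by (intro det_of_unit_GL[OF char0 _ _ M, of "length xs" "\<lambda>j. fst (snd (xs ! j))"
        "\<lambda>j. fst (xs ! j)" "\<lambda>j. snd (snd (xs ! j))"]) (auto simp: case_prod_unfold)
qed

section \<open>The stable general linear group and K1\<close>

lemma stabilize_four_block:
  assumes A: "A \<in> carrier_mat n n"
  shows "stabilize (four_block_mat A (0\<^sub>m n k) (0\<^sub>m k n) (1\<^sub>m k)) = stabilize (A :: 'a::ring_1 mat)"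
  using A by (intro ext) (auto simp: stabilize_def)

lemma four_block_of_stabilize_eq:
  assumes A: "(A :: 'a::ring_1 mat) \<in> carrier_mat n n" and B: "B \<in> carrier_mat (n + k) (n + k)"
    and eq: "stabilize A = stabilize B"
  shows "B = four_block_mat A (0\<^sub>m n k) (0\<^sub>m k n) (1\<^sub>m k)"
proof (rule eq_matI)
  fix i j assume "i < dim_row (four_block_mat A (0\<^sub>m n k) (0\<^sub>m k n) (1\<^sub>m k))"
    "j < dim_col (four_block_mat A (0\<^sub>m n k) (0\<^sub>m k n) (1\<^sub>m k))"
  then have ij: "i < n + k" "j < n + k" using A by auto
  then have "B $$ (i, j) = stabilize A i j" using B unfolding eq by (simp add: stabilize_def)
  then show "B $$ (i, j) = four_block_mat A (0\<^sub>m n k) (0\<^sub>m k n) (1\<^sub>m k) $$ (i, j)"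
    using ij A by (auto simp: stabilize_def)
qed (use A B in auto)

lemma four_block_GL_fin:
  assumes A: "(A :: 'a::ring_1 mat) \<in> GL_fin n"
  shows "four_block_mat A (0\<^sub>m n k) (0\<^sub>m k n) (1\<^sub>m k) \<in> GL_fin (n + k)"
proof -
  obtain B where Ac: "A \<in> carrier_mat n n" and B: "B \<in> carrier_mat n n" "A * B = 1\<^sub>m n" "B * A = 1\<^sub>m n"
    using A by (auto simp: GL_fin_iff)
  have "four_block_mat A (0\<^sub>m n k) (0\<^sub>m k n) (1\<^sub>m k) * four_block_mat B (0\<^sub>m n k) (0\<^sub>m k n) (1\<^sub>m k) = 1\<^sub>m (n + k)"
    "four_block_mat B (0\<^sub>m n k) (0\<^sub>m k n) (1\<^sub>m k) * four_block_mat A (0\<^sub>m n k) (0\<^sub>m k n) (1\<^sub>m k) = 1\<^sub>m (n + k)"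
    using Ac B by (simp_all add: mult_four_block_mat[of _ n n _ k _ k _ _ n _ k])
  then show ?thesis using Ac B(1) unfolding GL_fin_iff
    by (intro conjI bexI[of _ "four_block_mat B (0\<^sub>m n k) (0\<^sub>m k n) (1\<^sub>m k)"]) auto
qed

lemma GL_common_size:
  assumes "finite S" "S \<subseteq> carrier (GL TYPE('a::ring_1))"
  shows "\<exists>n. \<forall>M\<in>S. \<exists>A. A \<in> GL_fin n \<and> M = stabilize A"
  using assms
proof (induction S rule: finite_induct)
  case empty
  then show ?case by simp
next
  case (insert M S)
  then obtain n where n: "\<forall>N\<in>S. \<exists>A. A \<in> GL_fin n \<and> N = stabilize A" by auto
  obtain k B where B: "B \<in> GL_fin k" "M = stabilize B" using insert.prems by (auto simp: GL_def)
  have up: "\<exists>A'. A' \<in> GL_fin (l + j) \<and> stabilize A = stabilize A'" if A: "A \<in> GL_fin l" for A :: "'a mat" and l j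
    using four_block_GL_fin[OF A, of j] stabilize_four_block[of A l j] A unfolding GL_fin_iff[of A] by metis
  have "\<exists>A. A \<in> GL_fin (n + k) \<and> N = stabilize A" if N: "N \<in> insert M S" for N
  proof (cases "N \<in> S")
    case True
    then obtain A where "A \<in> GL_fin n" "N = stabilize A" using n by blast
    then show ?thesis using up[of A n k] by auto
  next
    case False
    then have "N = stabilize B" using N B by simp
    then show ?thesis using up[OF B(1), of n] by (auto simp: add.commute)
  qed
  then show ?case by blast
qed

lemma stabilize_mult:
  assumes A: "(A :: 'a::ring_1 mat) \<in> carrier_mat n n" and B: "B \<in> carrier_mat n n"
  shows "stabilize A \<otimes>\<^bsub>GL TYPE('a)\<^esub> stabilize B = stabilize (A * B)"
proof (intro ext)
  fix i j
  let ?a = "stabilize A" and ?b = "stabilize B"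
  have "(stabilize A \<otimes>\<^bsub>GL TYPE('a)\<^esub> stabilize B) i j = (\<Sum>k\<in>{k. ?a i k \<noteq> 0}. ?a i k * ?b k j)"
    by (simp add: GL_def)
  also have "\<dots> = stabilize (A * B) i j"
  proof (cases "i < n")
    case True
    have sub: "{k. ?a i k \<noteq> 0} \<subseteq> {0..<n}"
    proof
      fix k assume "k \<in> {k. ?a i k \<noteq> 0}"
      then show "k \<in> {0..<n}" using True A by (cases "k < n") (auto simp: stabilize_def)
    qed
    have "(\<Sum>k\<in>{k. ?a i k \<noteq> 0}. ?a i k * ?b k j) = (\<Sum>k\<in>{0..<n}. ?a i k * ?b k j)"
      by (rule sum.mono_neutral_left) (use sub in auto)
    also have "\<dots> = stabilize (A * B) i j"
    proof (cases "j < n")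
      case j: True
      then show ?thesis using True A B by (simp add: stabilize_def scalar_prod_def)
    next
      case False
      then have "(\<Sum>k\<in>{0..<n}. ?a i k * ?b k j) = 0"
        using A B by (intro sum.neutral) (auto simp: stabilize_def)
      then show ?thesis using False True A B by (simp add: stabilize_def)
    qed
    finally show ?thesis .
  next
    case False
    then have "{k. ?a i k \<noteq> 0} = {i}" "?a i i = 1" using A by (auto simp: stabilize_def)
    then have "(\<Sum>k\<in>{k. ?a i k \<noteq> 0}. ?a i k * ?b k j) = ?b i j" by simp
    then show ?thesis using False A B by (simp add: stabilize_def)
  qed
  finally show "(stabilize A \<otimes>\<^bsub>GL TYPE('a)\<^esub> stabilize B) i j = stabilize (A * B) i j" .
qed

lemma stabilize_one: "stabilize (1\<^sub>m n :: 'a::ring_1 mat) = \<one>\<^bsub>GL TYPE('a)\<^esub>"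
  by (intro ext) (auto simp: stabilize_def GL_def)

lemma GL_fin_one: "1\<^sub>m n \<in> (GL_fin n :: 'a::ring_1 mat set)"
  by (auto simp: GL_fin_iff)

lemma stabilize_in_GL: "(A :: 'a::ring_1 mat) \<in> GL_fin n \<Longrightarrow> stabilize A \<in> carrier (GL TYPE('a))"
  by (auto simp: GL_def)

lemma group_GL: "group (GL TYPE('a::ring_1))"
proof (rule groupI)
  let ?G = "GL TYPE('a)"
  fix M N :: "nat \<Rightarrow> nat \<Rightarrow> 'a"
  assume M: "M \<in> carrier ?G" and N: "N \<in> carrier ?G"
  have "{M, N} \<subseteq> carrier ?G" using M N by simp
  then obtain n A B where A: "A \<in> GL_fin n" "M = stabilize A" and B: "B \<in> GL_fin n" "N = stabilize B"
    using GL_common_size[of "{M, N}"] by auto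
  have "M \<otimes>\<^bsub>?G\<^esub> N = stabilize (A * B)"
    unfolding A B by (rule stabilize_mult[of _ n]) (use A B in \<open>simp_all add: GL_fin_iff\<close>)
  then show "M \<otimes>\<^bsub>?G\<^esub> N \<in> carrier ?G"
    using GL_fin_mult[OF A(1) B(1)] by (simp add: stabilize_in_GL)
next
  let ?G = "GL TYPE('a)"
  show "\<one>\<^bsub>?G\<^esub> \<in> carrier ?G"
    unfolding stabilize_one[of 0, symmetric] by (rule stabilize_in_GL[OF GL_fin_one])
next
  let ?G = "GL TYPE('a)"
  fix M N L :: "nat \<Rightarrow> nat \<Rightarrow> 'a"
  assume M: "M \<in> carrier ?G" and N: "N \<in> carrier ?G" and L: "L \<in> carrier ?G"
  have "{M, N, L} \<subseteq> carrier ?G" using M N L by simp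
  then obtain n A B C where "A \<in> GL_fin n" and A: "M = stabilize A" and "B \<in> GL_fin n" and B: "N = stabilize B"
    and "C \<in> GL_fin n" and C: "L = stabilize C"
    using GL_common_size[of "{M, N, L}"] by auto
  then have c: "A \<in> carrier_mat n n" "B \<in> carrier_mat n n" "C \<in> carrier_mat n n" by (simp_all add: GL_fin_iff)
  then show "M \<otimes>\<^bsub>?G\<^esub> N \<otimes>\<^bsub>?G\<^esub> L = M \<otimes>\<^bsub>?G\<^esub> (N \<otimes>\<^bsub>?G\<^esub> L)"
    unfolding A B C by (simp add: stabilize_mult[of _ n] assoc_mult_mat[of _ n n _ n _ n])
next
  let ?G = "GL TYPE('a)"
  fix M :: "nat \<Rightarrow> nat \<Rightarrow> 'a"
  assume M: "M \<in> carrier ?G"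
  then obtain n A where A: "A \<in> GL_fin n" "M = stabilize A" by (auto simp: GL_def)
  then obtain B where Ac: "A \<in> carrier_mat n n" and B: "B \<in> carrier_mat n n" "A * B = 1\<^sub>m n" "B * A = 1\<^sub>m n"
    by (auto simp: GL_fin_iff)
  show "\<one>\<^bsub>?G\<^esub> \<otimes>\<^bsub>?G\<^esub> M = M"
    unfolding A(2) stabilize_one[of n, symmetric] using Ac by (simp add: stabilize_mult[of _ n])
  have "B \<in> GL_fin n" using Ac B by (auto simp: GL_fin_iff)
  moreover have "stabilize B \<otimes>\<^bsub>?G\<^esub> M = \<one>\<^bsub>?G\<^esub>"
    unfolding A(2) stabilize_one[of n, symmetric] using Ac B by (simp add: stabilize_mult[of _ n])
  ultimately show "\<exists>N\<in>carrier ?G. N \<otimes>\<^bsub>?G\<^esub> M = \<one>\<^bsub>?G\<^esub>"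
    by (intro bexI[of _ "stabilize B"] stabilize_in_GL)
qed

section \<open>The determinant map\<close>

lemma to_Nc_hom: "to_Nc (a + b) = to_Nc a + to_Nc b" "to_Nc (a * b) = to_Nc a * to_Nc b"
  "to_Nc 0 = 0" "to_Nc 1 = 1"
  by (simp_all add: to_Nc_def)

lemma to_Nc_eq_0: "to_Nc a = 0 \<longleftrightarrow> a = 0"
  by (simp add: to_Nc_def)

lemma to_Nc_sum: "to_Nc (\<Sum>x\<in>S. f x) = (\<Sum>x\<in>S. to_Nc (f x))"
  by (induction S rule: infinite_finite_induct) (simp_all add: to_Nc_hom)

lemma to_Nc_of_nat: "to_Nc (of_nat n) = of_nat n"
  by (induction n) (simp_all add: to_Nc_hom)

lemma inj_of_nat_Nc:
  assumes "torsion_free TYPE('r::idom)"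
  shows "inj (of_nat :: nat \<Rightarrow> 'r fract alg_closure)"
proof (rule linorder_injI)
  fix m n :: nat assume mn: "m < n"
  show "(of_nat m :: 'r fract alg_closure) \<noteq> of_nat n"
  proof
    assume "(of_nat m :: 'r fract alg_closure) = of_nat n"
    then have "(of_nat (n - m) :: 'r fract alg_closure) = 0" using mn by (simp add: of_nat_diff)
    then have "to_Nc (of_nat (n - m) :: 'r) = 0" by (simp only: to_Nc_of_nat)
    then have "of_nat (n - m) * (1 :: 'r) = 0" by (simp add: to_Nc_eq_0)
    then show False using assms mn unfolding torsion_free_def by (metis zero_less_diff zero_neq_one)
  qed
qed

definition linear_extension ::
  "nat \<Rightarrow> ('g::{group_add,finite} \<Rightarrow> 'r::idom fract alg_closure mat) \<Rightarrow> ('g \<Rightarrow>\<^sub>0 'r) \<Rightarrow> 'r fract alg_closure mat" where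
  "linear_extension m T a = mat m m (\<lambda>(i, j). \<Sum>g\<in>UNIV. to_Nc (Poly_Mapping.lookup a g) * T g $$ (i, j))"

lemma matrix_hom_linear_extension:
  fixes T :: "'g::{group_add,finite} \<Rightarrow> 'r::idom fract alg_closure mat"
  assumes T: "representation m T"
  shows "matrix_hom m (linear_extension m T :: ('g \<Rightarrow>\<^sub>0 'r) \<Rightarrow> _)"
proof
  have Tc: "\<And>g. T g \<in> carrier_mat m m" and T0: "T 0 = 1\<^sub>m m" and Tm: "\<And>g h. T (g + h) = T g * T h"
    using T by (auto simp: representation_def)
  have dim [simp]: "dim_row (T g) = m" "dim_col (T g) = m" for g using Tc[of g] by auto
  fix a b :: "'g \<Rightarrow>\<^sub>0 'r"
  show "linear_extension m T a \<in> carrier_mat m m" by (simp add: linear_extension_def)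
  show "linear_extension m T 1 = (1\<^sub>m m :: 'r fract alg_closure mat)"
  proof (rule eq_matI)
    fix i j assume ij: "i < dim_row (1\<^sub>m m :: 'r fract alg_closure mat)" "j < dim_col (1\<^sub>m m :: 'r fract alg_closure mat)"
    have "(\<Sum>g\<in>UNIV. to_Nc (Poly_Mapping.lookup (1 :: 'g \<Rightarrow>\<^sub>0 'r) g) * T g $$ (i, j))
        = (\<Sum>g\<in>UNIV. if g = 0 then T g $$ (i, j) else 0)"
      by (intro sum.cong) (auto simp: lookup_one to_Nc_hom when_def)
    then show "linear_extension m T 1 $$ (i, j) = (1\<^sub>m m :: 'r fract alg_closure mat) $$ (i, j)"
      using ij by (simp add: linear_extension_def T0)
  qed (auto simp: linear_extension_def)
  show "linear_extension m T (a + b) = linear_extension m T a + linear_extension m T b"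
    by (rule eq_matI) (auto simp: linear_extension_def lookup_add to_Nc_hom distrib_right sum.distrib)
  show "linear_extension m T (a * b) = linear_extension m T a * linear_extension m T b"
  proof (rule eq_matI)
    fix i j assume "i < dim_row (linear_extension m T a * linear_extension m T b)"
      "j < dim_col (linear_extension m T a * linear_extension m T b)"
    then have ij: "i < m" "j < m" by (auto simp: linear_extension_def)
    let ?a = "\<lambda>g. to_Nc (Poly_Mapping.lookup a g)" and ?b = "\<lambda>g. to_Nc (Poly_Mapping.lookup b g)"
    have "linear_extension m T (a * b) $$ (i, j)
        = (\<Sum>k\<in>UNIV. \<Sum>l\<in>UNIV. ?a l * ?b (- l + k) * T k $$ (i, j))"
      using ij by (simp add: linear_extension_def lookup_mult_finite to_Nc_sum to_Nc_hom sum_distrib_right)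
    also have "\<dots> = (\<Sum>l\<in>UNIV. \<Sum>k\<in>UNIV. ?a l * ?b (- l + k) * T k $$ (i, j))" by (rule sum.swap)
    also have "\<dots> = (\<Sum>l\<in>UNIV. \<Sum>q\<in>UNIV. ?a l * ?b q * T (l + q) $$ (i, j))"
    proof (rule sum.cong[OF refl])
      fix l :: 'g
      have "bij_betw (\<lambda>q. l + q) UNIV UNIV"
        by (rule bij_betw_byWitness[where f' = "\<lambda>k. - l + k"]) (auto simp: add.assoc[symmetric])
      from sum.reindex_bij_betw[OF this, of "\<lambda>k. ?a l * ?b (- l + k) * T k $$ (i, j)"]
      show "(\<Sum>k\<in>UNIV. ?a l * ?b (- l + k) * T k $$ (i, j)) = (\<Sum>q\<in>UNIV. ?a l * ?b q * T (l + q) $$ (i, j))"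
        by (simp add: add.assoc[symmetric])
    qed
    also have "\<dots> = (\<Sum>l\<in>UNIV. \<Sum>q\<in>UNIV. \<Sum>r\<in>{0..<m}. (?a l * T l $$ (i, r)) * (?b q * T q $$ (r, j)))"
      using ij by (simp add: Tm scalar_prod_def sum_distrib_left mult_ac)
    also have "\<dots> = (\<Sum>l\<in>UNIV. \<Sum>r\<in>{0..<m}. \<Sum>q\<in>UNIV. (?a l * T l $$ (i, r)) * (?b q * T q $$ (r, j)))"
      by (rule sum.cong[OF refl], rule sum.swap)
    also have "\<dots> = (\<Sum>r\<in>{0..<m}. \<Sum>l\<in>UNIV. \<Sum>q\<in>UNIV. (?a l * T l $$ (i, r)) * (?b q * T q $$ (r, j)))"
      by (rule sum.swap)
    also have "\<dots> = (linear_extension m T a * linear_extension m T b) $$ (i, j)"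
      using ij by (simp add: linear_extension_def scalar_prod_def sum_product)
    finally show "linear_extension m T (a * b) $$ (i, j)
        = (linear_extension m T a * linear_extension m T b) $$ (i, j)" .
  qed (auto simp: linear_extension_def)
qed

lemma extend_rep_eq_block_matrix:
  assumes "representation m T"
  shows "extend_rep T A = block_matrix m (linear_extension m T) A"
proof -
  have "dim_row (T 0) = m" using assms by (simp add: representation_def)
  then show ?thesis
    by (intro eq_matI) (auto simp: extend_rep_def block_matrix_def linear_extension_def Let_def div_mod_bounds)
qed

lemma rep_of_character_representation:
  assumes "\<chi> \<in> irreducible_characters"
  shows "\<exists>m. representation m (rep_of_character \<chi>)"
proof -
  have "\<exists>T. (\<exists>m. representation m T) \<and> character_of T = \<chi>"
    using assms by (auto simp: irreducible_characters_def irreducible_representation_def)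
  from someI_ex[OF this] show ?thesis unfolding rep_of_character_def by blast
qed

lemma Det_fin_matrix_hom:
  fixes \<chi> :: "'g::{group_add,finite} \<Rightarrow> 'r::idom fract alg_closure"
  assumes "\<chi> \<in> irreducible_characters"
  shows "\<exists>m \<phi>. matrix_hom m \<phi> \<and> (\<forall>A :: ('g \<Rightarrow>\<^sub>0 'r) mat. Det_fin A \<chi> = det (block_matrix m \<phi> A))"
proof -
  obtain m where m: "representation m (rep_of_character \<chi>)"
    using rep_of_character_representation[OF assms] by blast
  show ?thesis
    by (intro exI[of _ m] exI[of _ "linear_extension m (rep_of_character \<chi>)"] conjI allI
        matrix_hom_linear_extension[OF m])
      (simp add: Det_fin_def assms extend_rep_eq_block_matrix[OF m])
qed

lemma Det_fin_cong:
  fixes A B :: "('g::{group_add,finite} \<Rightarrow>\<^sub>0 'r::idom) mat"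
  assumes "\<And>m (\<phi> :: ('g \<Rightarrow>\<^sub>0 'r) \<Rightarrow> 'r fract alg_closure mat). matrix_hom m \<phi> \<Longrightarrow>
      det (block_matrix m \<phi> A) = det (block_matrix m \<phi> B)"
  shows "Det_fin A = Det_fin B"
proof
  fix \<chi> :: "'g \<Rightarrow> 'r fract alg_closure"
  show "Det_fin A \<chi> = Det_fin B \<chi>"
  proof (cases "\<chi> \<in> irreducible_characters")
    case True
    then obtain m and \<phi> :: "('g \<Rightarrow>\<^sub>0 'r) \<Rightarrow> 'r fract alg_closure mat"
      where hom: "matrix_hom m \<phi>" and D: "\<forall>A. Det_fin A \<chi> = det (block_matrix m \<phi> A)"
      using Det_fin_matrix_hom[OF True] by (elim exE conjE)
    then show ?thesis using assms[OF hom] by simp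
  qed (simp add: Det_fin_def)
qed

lemma Det_fin_stabilize:
  fixes A B :: "('g::{group_add,finite} \<Rightarrow>\<^sub>0 'r::idom) mat"
  assumes A: "A \<in> carrier_mat n n" and B: "B \<in> carrier_mat k k" and eq: "stabilize A = stabilize B"
  shows "Det_fin A = Det_fin B"
proof -
  have le: "Det_fin A = Det_fin B"
    if A: "A \<in> carrier_mat n n" and B: "B \<in> carrier_mat (n + j) (n + j)" and eq: "stabilize A = stabilize B"
    for A B :: "('g \<Rightarrow>\<^sub>0 'r) mat" and n j
  proof (rule Det_fin_cong)
    fix m and \<phi> :: "('g \<Rightarrow>\<^sub>0 'r) \<Rightarrow> 'r fract alg_closure mat"
    assume "matrix_hom m \<phi>"
    then interpret matrix_hom m \<phi> .
    have "blk B = four_block_mat (blk A) (blk (0\<^sub>m n j)) (blk (0\<^sub>m j n)) (blk (1\<^sub>m j))"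
      unfolding four_block_of_stabilize_eq[OF A B eq] using A by (intro block_matrix_four_block) auto
    then show "det (blk A) = det (blk B)"
      using A by (simp add: block_matrix_zero block_matrix_one
          det_four_block_mat_upper_right_zero[of _ "n * m" _ "j * m"])
  qed
  show ?thesis
  proof (cases "n \<le> k")
    case True
    then show ?thesis using le[OF A, of B "k - n"] B eq by simp
  next
    case False
    then show ?thesis using le[OF B, of A "n - k"] A eq by simp
  qed
qed

lemma Det_GL_stabilize:
  fixes A :: "('g::{group_add,finite} \<Rightarrow>\<^sub>0 'r::idom) mat"
  assumes A: "A \<in> GL_fin n"
  shows "Det_GL (stabilize A) = Det_fin A"
proof -
  define B where "B = (SOME B. (\<exists>n. B \<in> GL_fin n) \<and> stabilize B = stabilize A)"
  have "(\<exists>n. B \<in> GL_fin n) \<and> stabilize B = stabilize A"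
    unfolding B_def by (rule someI[of _ A]) (use A in blast)
  then obtain k where "B \<in> GL_fin k" "stabilize B = stabilize A" by blast
  then have "Det_fin B = Det_fin A"
    using A by (intro Det_fin_stabilize[of _ k _ n]) (auto simp: GL_fin_iff)
  then show ?thesis by (simp add: Det_GL_def B_def)
qed

lemma Det_GL_mult:
  fixes M N :: "nat \<Rightarrow> nat \<Rightarrow> ('g::{group_add,finite} \<Rightarrow>\<^sub>0 'r::idom)"
  assumes M: "M \<in> carrier (GL TYPE('g \<Rightarrow>\<^sub>0 'r))" and N: "N \<in> carrier (GL TYPE('g \<Rightarrow>\<^sub>0 'r))"
    and \<chi>: "\<chi> \<in> irreducible_characters"
  shows "Det_GL (M \<otimes>\<^bsub>GL TYPE('g \<Rightarrow>\<^sub>0 'r)\<^esub> N) \<chi> = Det_GL M \<chi> * Det_GL N \<chi>"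
proof -
  have "{M, N} \<subseteq> carrier (GL TYPE('g \<Rightarrow>\<^sub>0 'r))" using M N by simp
  then obtain n A B where A: "A \<in> GL_fin n" "M = stabilize A" and B: "B \<in> GL_fin n" "N = stabilize B"
    using GL_common_size[of "{M, N}"] by auto
  have c: "A \<in> carrier_mat n n" "B \<in> carrier_mat n n" using A B by (simp_all add: GL_fin_iff)
  obtain m and \<phi> :: "('g \<Rightarrow>\<^sub>0 'r) \<Rightarrow> 'r fract alg_closure mat"
    where hom: "matrix_hom m \<phi>" and D: "\<forall>A. Det_fin A \<chi> = det (block_matrix m \<phi> A)"
    using Det_fin_matrix_hom[OF \<chi>] by (elim exE conjE)
  show ?thesis
    unfolding A(2) B(2) stabilize_mult[OF c] Det_GL_stabilize[OF A(1)] Det_GL_stabilize[OF B(1)]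
      Det_GL_stabilize[OF GL_fin_mult[OF A(1) B(1)]] D[rule_format]
    by (rule matrix_hom.det_blk_mult[OF hom c])
qed

lemma Det_GL_extensional:
  fixes M :: "nat \<Rightarrow> nat \<Rightarrow> ('g::{group_add,finite} \<Rightarrow>\<^sub>0 'r::idom)"
  shows "\<chi> \<notin> irreducible_characters \<Longrightarrow> Det_GL M \<chi> = undefined"
  by (simp add: Det_GL_def Det_fin_def)

lemma Det_GL_one:
  assumes "\<chi> \<in> irreducible_characters"
  shows "Det_GL (\<one>\<^bsub>GL TYPE('g::{group_add,finite} \<Rightarrow>\<^sub>0 'r::idom)\<^esub>) \<chi> = 1"
proof -
  obtain m and \<phi> :: "('g \<Rightarrow>\<^sub>0 'r) \<Rightarrow> 'r fract alg_closure mat"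
    where hom: "matrix_hom m \<phi>" and D: "\<forall>A. Det_fin A \<chi> = det (block_matrix m \<phi> A)"
    using Det_fin_matrix_hom[OF assms] by (elim exE conjE)
  show ?thesis
    unfolding stabilize_one[of 0, symmetric] Det_GL_stabilize[OF GL_fin_one] D[rule_format]
    by (simp add: matrix_hom.block_matrix_one[OF hom])
qed

text \<open>
The elements on which \<open>Det\<close> is \<open>1\<close> at \<open>\<chi>\<close> form a subgroup, and it contains all commutators since the
values of \<open>Det\<close> commute.
\<close>

lemma Det_GL_derived:
  fixes M :: "nat \<Rightarrow> nat \<Rightarrow> ('g::{group_add,finite} \<Rightarrow>\<^sub>0 'r::idom)"
  assumes M: "M \<in> derived (GL TYPE('g \<Rightarrow>\<^sub>0 'r)) (carrier (GL TYPE('g \<Rightarrow>\<^sub>0 'r)))"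
    and \<chi>: "\<chi> \<in> irreducible_characters"
  shows "Det_GL M \<chi> = 1"
proof -
  let ?G = "GL TYPE('g \<Rightarrow>\<^sub>0 'r)"
  interpret group ?G by (rule group_GL)
  have inv: "Det_GL A \<chi> * Det_GL (inv\<^bsub>?G\<^esub> A) \<chi> = 1" if A: "A \<in> carrier ?G" for A
    using Det_GL_mult[OF A inv_closed[OF A] \<chi>] Det_GL_one[OF \<chi>] r_inv[OF A] by simp
  define H where "H = {A \<in> carrier ?G. Det_GL A \<chi> = 1}"
  have "subgroup H ?G"
  proof (rule subgroupI)
    show "H \<noteq> {}" using Det_GL_one[OF \<chi>] by (auto simp: H_def)
    fix A assume A: "A \<in> H"
    then show "inv\<^bsub>?G\<^esub> A \<in> H" using inv[of A] by (simp add: H_def)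
    fix B assume "B \<in> H"
    then show "A \<otimes>\<^bsub>?G\<^esub> B \<in> H" using A by (simp add: H_def Det_GL_mult[OF _ _ \<chi>])
  qed (auto simp: H_def)
  moreover have "derived_set ?G (carrier ?G) \<subseteq> H"
  proof
    fix C assume "C \<in> derived_set ?G (carrier ?G)"
    then obtain A B where AB: "A \<in> carrier ?G" "B \<in> carrier ?G"
      and C: "C = A \<otimes>\<^bsub>?G\<^esub> B \<otimes>\<^bsub>?G\<^esub> inv\<^bsub>?G\<^esub> A \<otimes>\<^bsub>?G\<^esub> inv\<^bsub>?G\<^esub> B"
      by (elim UN_E singletonE)
    have "Det_GL C \<chi> = (Det_GL A \<chi> * Det_GL (inv\<^bsub>?G\<^esub> A) \<chi>) * (Det_GL B \<chi> * Det_GL (inv\<^bsub>?G\<^esub> B) \<chi>)"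
      unfolding C using AB by (simp add: Det_GL_mult[OF _ _ \<chi>])
    then show "C \<in> H" using AB by (simp add: H_def inv C)
  qed
  ultimately have "derived ?G (carrier ?G) \<subseteq> H"
    unfolding derived_def by (intro generate_subgroup_incl)
  then show ?thesis using M by (auto simp: H_def)
qed

lemma Det_K1_coset:
  fixes M :: "nat \<Rightarrow> nat \<Rightarrow> ('g::{group_add,finite} \<Rightarrow>\<^sub>0 'r::idom)"
  assumes M: "M \<in> carrier (GL TYPE('g \<Rightarrow>\<^sub>0 'r))"
  shows "Det_K1 (derived (GL TYPE('g \<Rightarrow>\<^sub>0 'r)) (carrier (GL TYPE('g \<Rightarrow>\<^sub>0 'r))) #>\<^bsub>GL TYPE('g \<Rightarrow>\<^sub>0 'r)\<^esub> M) = Det_GL M"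
proof -
  let ?G = "GL TYPE('g \<Rightarrow>\<^sub>0 'r)"
  let ?D = "derived ?G (carrier ?G)"
  interpret group ?G by (rule group_GL)
  interpret D: subgroup ?D ?G by (rule derived_is_subgroup) simp
  have eq: "Det_GL (h \<otimes>\<^bsub>?G\<^esub> M) = Det_GL M" if h: "h \<in> ?D" for h
  proof
    fix \<chi>
    show "Det_GL (h \<otimes>\<^bsub>?G\<^esub> M) \<chi> = Det_GL M \<chi>"
    proof (cases "\<chi> \<in> irreducible_characters")
      case True
      then show ?thesis using Det_GL_mult[OF D.mem_carrier[OF h] M True] Det_GL_derived[OF h True] by simp
    qed (simp add: Det_GL_extensional)
  qed
  have "Det_GL ` (?D #>\<^bsub>?G\<^esub> M) = {Det_GL M}"
  proof
    show "Det_GL ` (?D #>\<^bsub>?G\<^esub> M) \<subseteq> {Det_GL M}" using eq by (auto simp: r_coset_def)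
    have "\<one>\<^bsub>?G\<^esub> \<otimes>\<^bsub>?G\<^esub> M \<in> ?D #>\<^bsub>?G\<^esub> M" using D.one_closed unfolding r_coset_def by blast
    then show "{Det_GL M} \<subseteq> Det_GL ` (?D #>\<^bsub>?G\<^esub> M)" using M by simp
  qed
  then show ?thesis by (simp add: Det_K1_def)
qed

theorem theorem1p2:
  fixes p :: nat
  assumes "prime p"
    and "hypothesis_H p TYPE('r::idom)"
    and "(\<exists>k. card (UNIV :: 'g::{group_add,finite} set) = p ^ k)
         \<or> (noetherian_ring (class_ring :: 'r ring) \<and> normal_domain TYPE('r))"
  shows "Det_GL ` unit_to_GL ` Units (class_ring :: ('g \<Rightarrow>\<^sub>0 'r) ring)
           = Det_GL ` carrier (GL TYPE('g \<Rightarrow>\<^sub>0 'r))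
         \<and> Det_GL ` carrier (GL TYPE('g \<Rightarrow>\<^sub>0 'r))
           = Det_K1 ` carrier (K1 TYPE('g \<Rightarrow>\<^sub>0 'r))"
proof
  have p: "p > 0" and complete: "adically_complete p TYPE('r)" and tf: "torsion_free TYPE('r)"
    using assms(1,2) by (auto simp: hypothesis_H_def prime_gt_0_nat)
  let ?G = "GL TYPE('g \<Rightarrow>\<^sub>0 'r)"
  have unit: "mat 1 1 (\<lambda>_. u) \<in> GL_fin 1" if u: "u \<in> units" for u :: "'g \<Rightarrow>\<^sub>0 'r"
  proof -
    obtain v where "u * v = 1" "v * u = 1" using u by (auto simp: units_iff)
    then show ?thesis unfolding GL_fin_iff
      by (intro conjI bexI[of _ "mat 1 1 (\<lambda>_. v)"]) (auto intro!: eq_matI simp: scalar_prod_def)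
  qed
  show "Det_GL ` unit_to_GL ` Units (class_ring :: ('g \<Rightarrow>\<^sub>0 'r) ring) = Det_GL ` carrier ?G"
  proof
    show "Det_GL ` unit_to_GL ` Units (class_ring :: ('g \<Rightarrow>\<^sub>0 'r) ring) \<subseteq> Det_GL ` carrier ?G"
      unfolding unit_to_GL_def using stabilize_in_GL[OF unit] by blast
    show "Det_GL ` carrier ?G \<subseteq> Det_GL ` unit_to_GL ` Units (class_ring :: ('g \<Rightarrow>\<^sub>0 'r) ring)"
    proof (rule image_subsetI)
      fix M assume "M \<in> carrier ?G"
      then obtain n A where A: "A \<in> GL_fin n" "M = stabilize A" by (auto simp: GL_def)
      have "det_of_unit TYPE('r fract alg_closure) A"
        by (rule det_of_unit_group_ring[OF p complete inj_of_nat_Nc[OF tf] A(1)])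
      then obtain u where u: "u \<in> units"
        and det: "\<And>m (\<phi> :: ('g \<Rightarrow>\<^sub>0 'r) \<Rightarrow> 'r fract alg_closure mat). matrix_hom m \<phi> \<Longrightarrow> det (block_matrix m \<phi> A) = det (\<phi> u)"
        unfolding det_of_unit_def by blast
      have "Det_fin A = Det_fin (mat 1 1 (\<lambda>_. u))"
      proof (rule Det_fin_cong)
        fix m and \<phi> :: "('g \<Rightarrow>\<^sub>0 'r) \<Rightarrow> 'r fract alg_closure mat"
        assume hom: "matrix_hom m \<phi>"
        show "det (block_matrix m \<phi> A) = det (block_matrix m \<phi> (mat 1 1 (\<lambda>_. u)))"
          by (simp only: det[OF hom] matrix_hom.block_matrix_single[OF hom])
      qed
      then have "Det_GL M = Det_GL (unit_to_GL u)"
        by (simp only: A(2) unit_to_GL_def Det_GL_stabilize[OF A(1)] Det_GL_stabilize[OF unit[OF u]])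
      then show "Det_GL M \<in> Det_GL ` unit_to_GL ` Units (class_ring :: ('g \<Rightarrow>\<^sub>0 'r) ring)"
        using u by blast
    qed
  qed
  have "Det_K1 ` carrier (K1 TYPE('g \<Rightarrow>\<^sub>0 'r))
      = (\<lambda>M. Det_K1 (derived ?G (carrier ?G) #>\<^bsub>?G\<^esub> M)) ` carrier ?G"
    by (auto simp: K1_def FactGroup_def RCOSETS_def)
  also have "\<dots> = Det_GL ` carrier ?G" by (rule image_cong) (simp_all add: Det_K1_coset)
  finally show "Det_GL ` carrier ?G = Det_K1 ` carrier (K1 TYPE('g \<Rightarrow>\<^sub>0 'r))" ..
qed

end
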